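(* Steiner Forest is FPT by the vertex cover number of the input graph.
   Context: Steiner Forest: given a graph $G$, a set $S$ of terminal pairs and an integer $k$, decide whether $(G,S)$ has a Steiner forest $F$ (a subgraph in which each terminal pair lies in the same connected component) with $|E(F)|\leq k$. *)

theory Defs
  imports Main
begin

text \<open>A (finite simple) graph has vertex set {0..<n} and an edge set E of
  two-element subsets of {0..<n}.  Terminal pairs are pairs of vertices.\<close>

definition connected_in :: "nat set set \<Rightarrow> nat \<Rightarrow> nat \<Rightarrow> bool" where
  "connected_in F s t \<longleftrightarrow> (s, t) \<in> {(u, v). {u, v} \<in> F}\<^sup>*"

definition steiner_forest :: "nat set set \<Rightarrow> (nat \<times> nat) set \<Rightarrow> nat set set \<Rightarrow> bool" where
  "steiner_forest E S F \<longleftrightarrow> F \<subseteq> E \<and> (\<forall>(s, t) \<in> S. connected_in F s t)"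

definition vertex_cover :: "nat \<Rightarrow> nat set set \<Rightarrow> nat set \<Rightarrow> bool" where
  "vertex_cover n E C \<longleftrightarrow> C \<subseteq> {0..<n} \<and> (\<forall>e \<in> E. e \<inter> C \<noteq> {})"

definition vc_number :: "nat \<Rightarrow> nat set set \<Rightarrow> nat" where
  "vc_number n E = Min {card C | C. vertex_cover n E C}"

fun pairs :: "nat list \<Rightarrow> (nat \<times> nat) list" where
  "pairs (a # b # r) = (a, b) # pairs r"
| "pairs _ = []"

text \<open>Encoding: [n, m, u1, v1, ..., um, vm, p, s1, t1, ..., sp, tp, k].
  Returns (n, E, S, k) for a well-formed encoding, None otherwise.\<close>
definition decode :: "nat list \<Rightarrow> (nat \<times> nat set set \<times> (nat \<times> nat) set \<times> nat) option" where
  "decode xs =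
     (case xs of
        n # m # rest \<Rightarrow>
          (let es = take (2 * m) rest; rest2 = drop (2 * m) rest in
           if length rest < 2 * m then None else
           (case rest2 of
              p # rest3 \<Rightarrow>
                if length rest3 = 2 * p + 1 then
                  (let ts = take (2 * p) rest3; k = last rest3 in
                   if (\<forall>(u, v) \<in> set (pairs es). u < n \<and> v < n \<and> u \<noteq> v)
                      \<and> (\<forall>(s, t) \<in> set (pairs ts). s < n \<and> t < n)
                   then Some (n, {{u, v} | u v. (u, v) \<in> set (pairs es)}, set (pairs ts), k)
                   else None)
                else None
            | [] \<Rightarrow> None))
      | _ \<Rightarrow> None)"

definition SF_lang :: "nat list set" where
  "SF_lang = {xs. \<exists>n E S k. decode xs = Some (n, E, S, k) \<and>
                      (\<exists>F. steiner_forest E S F \<and> card F \<le> k)}"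

definition vc_param :: "nat list \<Rightarrow> nat" where
  "vc_param xs = (case decode xs of Some (n, E, S, k) \<Rightarrow> vc_number n E | None \<Rightarrow> 0)"

datatype instr =
    Const nat nat
  | Add nat nat nat
  | Sub nat nat nat      (* R[r] := R[a] - R[b] (truncated) *)
  | Load nat nat
  | Store nat nat
  | Jz nat nat
  | Halt

type_synonym config = "nat \<times> (nat \<Rightarrow> nat)"

definition step :: "instr list \<Rightarrow> config \<Rightarrow> config" where
  "step P c = (case c of (pc, R) \<Rightarrow>
     if pc < length P then
       (case P ! pc of
          Const r k \<Rightarrow> (pc + 1, R(r := k))
        | Add r a b \<Rightarrow> (pc + 1, R(r := R a + R b))
        | Sub r a b \<Rightarrow> (pc + 1, R(r := R a - R b))
        | Load r a \<Rightarrow> (pc + 1, R(r := R (R a)))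
        | Store a r \<Rightarrow> (pc + 1, R(R a := R r))
        | Jz r l \<Rightarrow> (if R r = 0 then l else pc + 1, R)
        | Halt \<Rightarrow> (pc, R))
     else (pc, R))"

definition halted :: "instr list \<Rightarrow> config \<Rightarrow> bool" where
  "halted P c \<longleftrightarrow> fst c \<ge> length P \<or> P ! fst c = Halt"

definition init :: "nat list \<Rightarrow> config" where
  "init xs = (0, \<lambda>i. if i = 0 then length xs else if i \<le> length xs then xs ! (i - 1) else 0)"

definition run :: "instr list \<Rightarrow> nat \<Rightarrow> nat list \<Rightarrow> config" where
  "run P t xs = (step P ^^ t) (init xs)"

definition halts_with :: "instr list \<Rightarrow> nat list \<Rightarrow> nat \<Rightarrow> nat \<Rightarrow> bool" where
  "halts_with P xs t out \<longleftrightarrow> halted P (run P t xs) \<and> snd (run P t xs) 0 = out"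

definition decides_in_time :: "instr list \<Rightarrow> nat list set \<Rightarrow> (nat list \<Rightarrow> nat) \<Rightarrow> bool" where
  "decides_in_time P L T \<longleftrightarrow>
     (\<forall>xs. \<exists>t \<le> T xs. halts_with P xs t (if xs \<in> L then 1 else 0))"

definition computable :: "(nat \<Rightarrow> nat) \<Rightarrow> bool" where
  "computable f \<longleftrightarrow> (\<exists>Q. \<forall>x. \<exists>t. halts_with Q [x] t (f x))"

fun bitlen :: "nat \<Rightarrow> nat" where
  "bitlen 0 = 0"
| "bitlen n = Suc (bitlen (n div 2))"

definition enc_size :: "nat list \<Rightarrow> nat" where
  "enc_size xs = length xs + sum_list (map bitlen xs)"

definition FPT :: "nat list set \<Rightarrow> (nat list \<Rightarrow> nat) \<Rightarrow> bool" where
  "FPT L \<kappa> \<longleftrightarrow> (\<exists>P f c. computable f \<and>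
       decides_in_time P L (\<lambda>xs. f (\<kappa> xs) * (Suc (enc_size xs)) ^ c))"

end

theory Submission
  imports Defs "HOL-Library.Disjoint_Sets"
begin

text \<open>The endpoints of a greedy maximal matching form a vertex cover of size \<open>c\<close>, at most twice the
  optimum. All edges join a vertex to the cover, so a forest is a choice, for every vertex, of
  cover vertices to which it is joined. Guess the partition of the cover into the components of
  the final forest, and process the vertices one after the other, ordered by the connected components
  of the demand graph, keeping track only of the partition of the cover that is connected so far. A vertex
  with a demand must be joined to the part that was guessed for its demand component. This is a dynamic
  program over a number of states that depends only on \<open>c\<close>.

  It is implemented in a small language with bounded loops, which is compiled to the register
  machine. If all loops that are entered have at most \<open>B\<close> iterations, the running time is
  polynomial in \<open>B\<close>; here \<open>B\<close> is a function of the parameter plus a linear function of the input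
  length.\<close>

subsection \<open>A structured language\<close>

text \<open>The number \<open>n\<close> of vertices and the budget \<open>k\<close> are single input
  words, so both may be exponential in the encoding size and neither may bound a loop. Vertices are
  therefore taken from \<open>set xs\<close>, the words that occur in the input; a word that is
  neither an endpoint nor a terminal merely acts as an isolated vertex without demands. Budgets are
  only added and compared, which takes the machine one step each. All demands of one demand
  component end in one component of the forest. With the vertices ordered by demand components, a
  single digit \<open>goal\<close>, chosen anew whenever a group begins, therefore replaces one
  entry per group and keeps the state small. The machine cannot multiply or divide. Products are
  sums, and digits of a state are found by counting, in loops as long as the state number itself;
  this is why \<open>B\<close> has to dominate the number of states. Since \<open>c\<close> is at
  most twice the vertex cover number, that number is at most \<open>num_states (2 * x)\<close> for
  the parameter \<open>x\<close>. \<open>FPT\<close> also asks for a computable bound, which is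
  shown with a second program of the same language.\<close>

type_synonym store = "(nat \<Rightarrow> nat) \<times> (nat \<Rightarrow> nat \<Rightarrow> nat)"

definition set_var :: "nat \<Rightarrow> nat \<Rightarrow> store \<Rightarrow> store" where
  "set_var x k s = ((fst s)(x := k), snd s)"

definition set_cell :: "nat \<Rightarrow> nat \<Rightarrow> nat \<Rightarrow> store \<Rightarrow> store" where
  "set_cell a j k s = (fst s, (snd s)(a := (snd s a)(j := k)))"

lemma set_var_simps [simp]:
  "fst (set_var x k s) = (fst s)(x := k)" "snd (set_var x k s) = snd s"
  by (simp_all add: set_var_def)

lemma set_cell_simps [simp]:
  "fst (set_cell a j k s) = fst s" "snd (set_cell a j k s) = (snd s)(a := (snd s a)(j := k))"
  by (simp_all add: set_cell_def)

text \<open>Products and comparisons are no machine instructions. \<open>Sum\<close> supplies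
  multiplication (a sum of equal terms) and bounded quantifiers (a sum of truth values); truncated
  \<open>Minus\<close> supplies comparison and negation.\<close>

datatype exp =
    Num nat
  | Var nat
  | Idx nat exp
  | Plus exp exp
  | Minus exp exp
  | Sum nat exp exp

fun ev :: "exp \<Rightarrow> store \<Rightarrow> nat" where
  "ev (Num k) s = k"
| "ev (Var x) s = fst s x"
| "ev (Idx a e) s = snd s a (ev e s)"
| "ev (Plus a b) s = ev a s + ev b s"
| "ev (Minus a b) s = ev a s - ev b s"
| "ev (Sum i a e) s = (\<Sum>j<ev a s. ev e (set_var i j s))"

datatype com =
    Skip
  | Assign nat exp
  | Write nat exp exp
  | Seq com com
  | Cond exp com com
  | For nat exp com

text \<open>The bound of a \<open>For\<close> is evaluated once, before the first iteration. Hence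
  every command terminates and \<open>ex\<close> can be a total function.\<close>

fun ex :: "com \<Rightarrow> store \<Rightarrow> store" where
  "ex Skip s = s"
| "ex (Assign x e) s = set_var x (ev e s) s"
| "ex (Write a e1 e2) s = set_cell a (ev e1 s) (ev e2 s) s"
| "ex (Seq c1 c2) s = ex c2 (ex c1 s)"
| "ex (Cond e c1 c2) s = (if ev e s \<noteq> 0 then ex c1 s else ex c2 s)"
| "ex (For i e c) s = fold (\<lambda>j s. ex c (set_var i j s)) [0..<ev e s] s"

text \<open>All loops that are entered perform at most \<open>B\<close> iterations.\<close>

fun ok_exp :: "nat \<Rightarrow> exp \<Rightarrow> store \<Rightarrow> bool" where
  "ok_exp B (Num k) s = True"
| "ok_exp B (Var x) s = True"
| "ok_exp B (Idx a e) s = ok_exp B e s"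
| "ok_exp B (Plus a b) s = (ok_exp B a s \<and> ok_exp B b s)"
| "ok_exp B (Minus a b) s = (ok_exp B a s \<and> ok_exp B b s)"
| "ok_exp B (Sum i a e) s =
     (ok_exp B a s \<and> ev a s \<le> B \<and> (\<forall>j<ev a s. ok_exp B e (set_var i j s)))"

fun ok_com :: "nat \<Rightarrow> com \<Rightarrow> store \<Rightarrow> bool" where
  "ok_com B Skip s = True"
| "ok_com B (Assign x e) s = ok_exp B e s"
| "ok_com B (Write a e1 e2) s = (ok_exp B e1 s \<and> ok_exp B e2 s)"
| "ok_com B (Seq c1 c2) s = (ok_com B c1 s \<and> ok_com B c2 (ex c1 s))"
| "ok_com B (Cond e c1 c2) s =
     (ok_exp B e s \<and> (if ev e s \<noteq> 0 then ok_com B c1 s else ok_com B c2 s))"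
| "ok_com B (For i e c) s =
     (ok_exp B e s \<and> ev e s \<le> B \<and>
      (\<forall>j<ev e s. ok_com B c (set_var i j (fold (\<lambda>j s. ex c (set_var i j s)) [0..<j] s))))"

text \<open>Executed instructions, with \<open>B\<close> in place of every loop length, hence
  independent of the store. In \<open>Sum\<close>, 10 is the prologue (4), the last test (2) and the
  epilogue (4), and 9 is the overhead of one iteration. The 13 of \<open>Idx\<close> is the address
  computation (12) and the access.\<close>

fun time_exp :: "nat \<Rightarrow> exp \<Rightarrow> nat" where
  "time_exp B (Num k) = 1"
| "time_exp B (Var x) = 2"
| "time_exp B (Idx a e) = time_exp B e + 13"
| "time_exp B (Plus a b) = time_exp B a + time_exp B b + 1"
| "time_exp B (Minus a b) = time_exp B a + time_exp B b + 1"
| "time_exp B (Sum i a e) = time_exp B a + 10 + B * (time_exp B e + 9)"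

fun time_com :: "nat \<Rightarrow> com \<Rightarrow> nat" where
  "time_com B Skip = 0"
| "time_com B (Assign x e) = time_exp B e + 2"
| "time_com B (Write a e1 e2) = time_exp B e1 + time_exp B e2 + 13"
| "time_com B (Seq c1 c2) = time_com B c1 + time_com B c2"
| "time_com B (Cond e c1 c2) = time_exp B e + time_com B c1 + time_com B c2 + 3"
| "time_com B (For i e c) = time_exp B e + 3 + B * (time_com B c + 8)"

section \<open>Polynomial bounds on the running time\<close>

lemma poly_mono:
  assumes "t \<le> A * Suc B ^ d" "A \<le> A'" "d \<le> d'"
  shows "t \<le> A' * Suc B ^ d'"
proof -
  have "Suc B ^ d \<le> Suc B ^ d'" using assms(3) by (intro power_increasing) simp_all
  then show ?thesis using assms(1,2) by (meson le_trans mult_le_mono)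
qed

lemma poly_add:
  assumes "\<exists>A d. \<forall>B. f B \<le> A * Suc B ^ d" "\<exists>A d. \<forall>B. g B \<le> A * Suc B ^ d"
  shows "\<exists>A d. \<forall>B. f B + g B \<le> A * Suc B ^ d"
proof -
  obtain A d A' d' where f: "\<forall>B. f B \<le> A * Suc B ^ d" and g: "\<forall>B. g B \<le> A' * Suc B ^ d'"
    using assms by blast
  have "f B + g B \<le> (A + A') * Suc B ^ (d + d')" for B
    using poly_mono[OF f[rule_format, of B] order.refl, of "d + d'"]
      poly_mono[OF g[rule_format, of B] order.refl, of "d + d'"]
    by (simp add: distrib_right)
  then show ?thesis by blast
qed

lemma poly_const: "\<exists>A d. \<forall>B. (k::nat) \<le> A * Suc B ^ d"
  by (rule exI[of _ k], rule exI[of _ 0]) simp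

lemma poly_times:
  assumes "\<exists>A d. \<forall>B. f B \<le> A * Suc B ^ d"
  shows "\<exists>A d. \<forall>B. B * f B \<le> A * Suc B ^ d"
proof -
  obtain A d where f: "\<forall>B. f B \<le> A * Suc B ^ d" using assms by blast
  have "B * f B \<le> A * Suc B ^ Suc d" for B
  proof -
    have "B * f B \<le> Suc B * (A * Suc B ^ d)" using f by (intro mult_le_mono) auto
    then show ?thesis by (simp add: ac_simps)
  qed
  then show ?thesis by blast
qed

lemma time_exp_poly: "\<exists>A d. \<forall>B. time_exp B e \<le> A * Suc B ^ d"
  by (induction e) (simp_all only: time_exp.simps, (intro poly_add poly_times poly_const | assumption)+)

text \<open>The exponent depends on the program text alone. The constant exponent required by
  \<open>FPT\<close> originates here.\<close>

lemma time_com_poly: "\<exists>A d. \<forall>B. time_com B c \<le> A * Suc B ^ d"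
  by (induction c)
    (simp_all only: time_com.simps, (intro poly_add poly_times poly_const time_exp_poly | assumption)+)

subsection \<open>Compilation\<close>

text \<open>Variable \<open>x < 64\<close> lives in register \<open>x\<close>, registers 64 to 255 hold temporaries, and the
  cell \<open>j\<close> of array \<open>a < 256\<close> lives in register \<open>256 * (j + 1) + a\<close>: interleaving keeps unboundedly
  many unbounded arrays apart without any allocation.\<close>

definition address_code :: "nat \<Rightarrow> nat \<Rightarrow> instr list" where
  "address_code a r =
     [Const (r+1) 1, Add r r (r+1),
      Add r r r, Add r r r, Add r r r, Add r r r, Add r r r, Add r r r, Add r r r, Add r r r,
      Const (r+1) a, Add r r (r+1)]"

lemma length_address_code [simp]: "length (address_code a r) = 12"
  by (simp add: address_code_def)

text \<open>The result is left in \<open>r\<close>, and only temporaries from \<open>r\<close> on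
  are changed for good. Jump targets are absolute, hence the argument \<open>pc\<close>. The machine
  lacks a move and an unconditional jump: \<open>Const r 0, Add r r x\<close> copies, and a
  \<open>Jz\<close> on a register just set to 0 always jumps. \<open>Sum\<close> keeps bound,
  counter, accumulator and the old value of \<open>i\<close> in \<open>r\<close> to
  \<open>r+3\<close> and restores \<open>i\<close>, so expressions have no side effects on
  variables.\<close>

fun comp_exp :: "exp \<Rightarrow> nat \<Rightarrow> nat \<Rightarrow> instr list" where
  "comp_exp (Num k) r pc = [Const r k]"
| "comp_exp (Var x) r pc = [Const r 0, Add r r x]"
| "comp_exp (Idx a e) r pc = comp_exp e r pc @ address_code a r @ [Load r r]"
| "comp_exp (Plus a b) r pc =
     (let ca = comp_exp a r pc in ca @ comp_exp b (r+1) (pc + length ca) @ [Add r r (r+1)])"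
| "comp_exp (Minus a b) r pc =
     (let ca = comp_exp a r pc in ca @ comp_exp b (r+1) (pc + length ca) @ [Sub r r (r+1)])"
| "comp_exp (Sum i a e) r pc =
     (let ca = comp_exp a r pc; loop = pc + length ca + 4; ce = comp_exp e (r+4) (loop + 4) in
      ca @ [Const (r+1) 0, Const (r+2) 0, Const (r+3) 0, Add (r+3) (r+3) i]
      @ [Sub (r+4) r (r+1), Jz (r+4) (loop + 9 + length ce), Const i 0, Add i i (r+1)]
      @ ce @ [Add (r+2) (r+2) (r+4), Const (r+4) 1, Add (r+1) (r+1) (r+4), Const (r+4) 0]
      @ [Jz (r+4) loop] @ [Const i 0, Add i i (r+3), Const r 0, Add r r (r+2)])"

fun comp_com :: "com \<Rightarrow> nat \<Rightarrow> nat \<Rightarrow> instr list" where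
  "comp_com Skip r pc = []"
| "comp_com (Assign x e) r pc = comp_exp e r pc @ [Const x 0, Add x x r]"
| "comp_com (Write a e1 e2) r pc =
     (let c1 = comp_exp e1 r pc; c2 = comp_exp e2 (r+2) (pc + length c1 + 12) in
      c1 @ address_code a r @ c2 @ [Store r (r+2)])"
| "comp_com (Seq c1 c2) r pc =
     (let k1 = comp_com c1 r pc in k1 @ comp_com c2 r (pc + length k1))"
| "comp_com (Cond e c1 c2) r pc =
     (let ce = comp_exp e r pc; p1 = pc + length ce + 1; k1 = comp_com c1 r p1;
          p2 = p1 + length k1 + 2; k2 = comp_com c2 r p2 in
      ce @ [Jz r p2] @ k1 @ [Const r 0] @ [Jz r (p2 + length k2)] @ k2)"
| "comp_com (For i e c) r pc =
     (let ce = comp_exp e r pc; loop = pc + length ce + 1; k = comp_com c (r+2) (loop + 4) in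
      ce @ [Const (r+1) 0]
      @ [Sub (r+2) r (r+1), Jz (r+2) (loop + 8 + length k), Const i 0, Add i i (r+1)]
      @ k @ [Const (r+2) 1, Add (r+1) (r+1) (r+2), Const (r+2) 0] @ [Jz (r+2) loop])"

text \<open>Nesting must not push the temporaries to register 256 and beyond, where the arrays
  live.\<close>

fun fits_exp :: "exp \<Rightarrow> nat \<Rightarrow> bool" where
  "fits_exp (Num k) r = (r < 256)"
| "fits_exp (Var x) r = (x < 64 \<and> r < 256)"
| "fits_exp (Idx a e) r = (a < 256 \<and> r + 1 < 256 \<and> fits_exp e r)"
| "fits_exp (Plus a b) r = (fits_exp a r \<and> fits_exp b (r+1))"
| "fits_exp (Minus a b) r = (fits_exp a r \<and> fits_exp b (r+1))"
| "fits_exp (Sum i a e) r = (i < 64 \<and> r + 4 < 256 \<and> fits_exp a r \<and> fits_exp e (r+4))"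

fun fits_com :: "com \<Rightarrow> nat \<Rightarrow> bool" where
  "fits_com Skip r = True"
| "fits_com (Assign x e) r = (x < 64 \<and> fits_exp e r)"
| "fits_com (Write a e1 e2) r = (a < 256 \<and> r + 2 < 256 \<and> fits_exp e1 r \<and> fits_exp e2 (r+2))"
| "fits_com (Seq c1 c2) r = (fits_com c1 r \<and> fits_com c2 r)"
| "fits_com (Cond e c1 c2) r = (r < 256 \<and> fits_exp e r \<and> fits_com c1 r \<and> fits_com c2 r)"
| "fits_com (For i e c) r = (i < 64 \<and> r + 2 < 256 \<and> fits_exp e r \<and> fits_com c (r+2))"

section \<open>Code fragments and their execution\<close>

definition code_at :: "instr list \<Rightarrow> nat \<Rightarrow> instr list \<Rightarrow> bool" where
  "code_at P pc is \<longleftrightarrow> (\<exists>xs ys. P = xs @ is @ ys \<and> length xs = pc)"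

lemma code_at_append:
  "code_at P pc (is @ js) \<longleftrightarrow> code_at P pc is \<and> code_at P (pc + length is) js"
proof
  assume "code_at P pc (is @ js)"
  then obtain xs ys where "P = xs @ (is @ js) @ ys" "length xs = pc"
    unfolding code_at_def by blast
  then have "P = xs @ is @ (js @ ys)" "P = (xs @ is) @ js @ ys" "length (xs @ is) = pc + length is"
    by simp_all
  then show "code_at P pc is \<and> code_at P (pc + length is) js"
    unfolding code_at_def using \<open>length xs = pc\<close> by blast
next
  assume "code_at P pc is \<and> code_at P (pc + length is) js"
  then obtain xs ys xs' ys' where *: "P = xs @ is @ ys" "length xs = pc"
    "P = xs' @ js @ ys'" "length xs' = pc + length is"
    unfolding code_at_def by blast
  then have "xs' = xs @ is"
    by (metis append.assoc append_eq_append_conv length_append)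
  with * have "P = xs @ (is @ js) @ ys'" by simp
  with * show "code_at P pc (is @ js)" unfolding code_at_def by blast
qed

lemma code_at_Nil: "code_at P pc [] \<longleftrightarrow> pc \<le> length P"
proof
  assume "pc \<le> length P"
  then have "P = take pc P @ [] @ drop pc P" "length (take pc P) = pc" by simp_all
  then show "code_at P pc []" unfolding code_at_def by blast
qed (auto simp: code_at_def)

lemma code_at_Cons:
  "code_at P pc (i # is) \<longleftrightarrow> pc < length P \<and> P ! pc = i \<and> code_at P (Suc pc) is"
proof -
  have "code_at P pc [i] \<longleftrightarrow> pc < length P \<and> P ! pc = i"
  proof
    assume "pc < length P \<and> P ! pc = i"
    then have "P = take pc P @ [i] @ drop (Suc pc) P" "length (take pc P) = pc"
      using id_take_nth_drop[of pc P] by auto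
    then show "code_at P pc [i]" unfolding code_at_def by blast
  qed (auto simp: code_at_def nth_append)
  then show ?thesis using code_at_append[of P pc "[i]" "is"] by simp
qed

definition steps :: "instr list \<Rightarrow> nat \<Rightarrow> config \<Rightarrow> config \<Rightarrow> bool" where
  "steps P t c c' \<longleftrightarrow> (\<exists>t'\<le>t. (step P ^^ t') c = c')"

lemma steps_refl: "steps P t c c"
  unfolding steps_def by (metis funpow_0 le0)

lemma steps_trans: "steps P t c c' \<Longrightarrow> steps P u c' c'' \<Longrightarrow> t + u \<le> v \<Longrightarrow> steps P v c c''"
proof -
  assume "steps P t c c'" "steps P u c' c''" "t + u \<le> v"
  then obtain t' u' where "t' \<le> t" "(step P ^^ t') c = c'" "u' \<le> u" "(step P ^^ u') c' = c''"
    unfolding steps_def by blast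
  then have "(step P ^^ (u' + t')) c = c''" "u' + t' \<le> v"
    using \<open>t + u \<le> v\<close> by (simp_all add: funpow_add)
  then show ?thesis unfolding steps_def by blast
qed

lemma steps_one: "step P c = c' \<Longrightarrow> steps P 1 c c'"
  unfolding steps_def by (rule exI[of _ 1]) simp

text \<open>Symbolic execution of jump-free code, in a form that the simplifier can compute. Proofs
  about machine code are cut at the jumps, where \<open>straight\<close> yields
  \<open>None\<close>.\<close>

fun straight :: "instr list \<Rightarrow> (nat \<Rightarrow> nat) \<Rightarrow> (nat \<Rightarrow> nat) option" where
  "straight [] R = Some R"
| "straight (Const r k # is) R = straight is (R(r := k))"
| "straight (Add r a b # is) R = straight is (R(r := R a + R b))"
| "straight (Sub r a b # is) R = straight is (R(r := R a - R b))"
| "straight (Load r a # is) R = straight is (R(r := R (R a)))"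
| "straight (Store a r # is) R = straight is (R(R a := R r))"
| "straight (Jz r l # is) R = None"
| "straight (Halt # is) R = None"

lemma steps_straight:
  "straight is R = Some R' \<Longrightarrow> code_at P pc is \<Longrightarrow> n = length is \<Longrightarrow> pc' = pc + n \<Longrightarrow>
    steps P n (pc, R) (pc', R')"
proof (induction "is" arbitrary: R pc n)
  case Nil
  then show ?case by (simp add: steps_refl)
next
  case (Cons i "is")
  have at: "pc < length P" "P ! pc = i" "code_at P (Suc pc) is"
    using Cons.prems(2) by (simp_all add: code_at_Cons)
  obtain R1 where R1: "step P (pc, R) = (Suc pc, R1)" "straight is R1 = Some R'"
    using Cons.prems(1) at(1,2) by (cases i) (auto simp: step_def)
  have "steps P (length is) (Suc pc, R1) (pc', R')"
    by (rule Cons.IH[OF R1(2) at(3) refl]) (use Cons.prems in simp)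
  then show ?case
    by (rule steps_trans[OF steps_one[OF R1(1)]]) (use Cons.prems in simp)
qed

lemma steps_jump:
  "code_at P pc [Jz r l] \<Longrightarrow> pc' = (if R r = 0 then l else pc + 1) \<Longrightarrow> steps P 1 (pc, R) (pc', R)"
  by (rule steps_one) (auto simp: code_at_Cons step_def)

text \<open>Registers 64 to 255 are left open, so compiled code can use them without disturbing the
  relation.\<close>

definition matches :: "store \<Rightarrow> (nat \<Rightarrow> nat) \<Rightarrow> bool" where
  "matches s R \<longleftrightarrow> (\<forall>x<64. R x = fst s x) \<and> (\<forall>a<256. \<forall>j. R (256 * (j + 1) + a) = snd s a j)"

lemma matches_temp: "matches s R \<Longrightarrow> 64 \<le> q \<Longrightarrow> q < 256 \<Longrightarrow> matches s (R(q := k))"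
  by (auto simp: matches_def)

lemma matches_set_var: "matches s R \<Longrightarrow> x < 64 \<Longrightarrow> matches (set_var x k s) (R(x := k))"
  by (auto simp: matches_def)

text \<open>The array number is the residue of the address modulo 256, and the quotient gives the
  cell, so distinct cells never share a register.\<close>

lemma matches_set_cell:
  assumes "matches s R" "a < 256"
  shows "matches (set_cell a j k s) (R(256 * (j + 1) + a := k))"
proof -
  have "(256 * (j' + 1) + a' = 256 * (j + 1) + a) \<longleftrightarrow> j' = j \<and> a' = a" if "a' < 256" for j' a'
    using assms(2) that by (cases j' j rule: linorder_cases) auto
  then show ?thesis using assms by (auto simp: matches_def)
qed

lemma matches_var: "matches s R \<Longrightarrow> x < 64 \<Longrightarrow> R x = fst s x"
  by (auto simp: matches_def)

lemma matches_cell: "matches s R \<Longrightarrow> a < 256 \<Longrightarrow> R (256 * (j + 1) + a) = snd s a j"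
  by (auto simp: matches_def)

lemma set_var_twice [simp]: "set_var x k (set_var x k' s) = set_var x k s"
  by (simp add: set_var_def)

lemma set_var_same [simp]: "set_var x (fst s x) s = s"
  by (simp add: set_var_def)

lemma steps_address:
  assumes "code_at P pc (address_code a r)" "matches s R" "64 \<le> r" "r + 1 < 256" "R r = j"
  shows "\<exists>R'. steps P 12 (pc, R) (pc + 12, R') \<and> matches s R' \<and> R' r = 256 * (j + 1) + a \<and>
    (\<forall>q. q \<noteq> r \<and> q \<noteq> r + 1 \<longrightarrow> R' q = R q)"
proof -
  define R' where "R' = R(r := 256 * (j + 1) + a, r + 1 := a)"
  have "straight (address_code a r) R = Some R'"
    unfolding R'_def assms(5)[symmetric] by (simp add: address_code_def fun_eq_iff)
  then have "steps P 12 (pc, R) (pc + 12, R')"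
    by (rule steps_straight[OF _ assms(1)]) simp_all
  moreover have "matches s R'"
    unfolding R'_def using assms(2-4) by (intro matches_temp) simp_all
  ultimately show ?thesis unfolding R'_def by (intro exI[of _ R']) (auto simp: R'_def)
qed

text \<open>The clause on the registers below \<open>r\<close> keeps a first operand alive while the
  second one is evaluated, and likewise the loop registers of an enclosing loop during its
  body.\<close>

lemma comp_exp_correct:
  assumes "code_at P pc (comp_exp e r pc)" "fits_exp e r" "64 \<le> r" "matches s R" "ok_exp B e s"
  shows "\<exists>R'. steps P (time_exp B e) (pc, R) (pc + length (comp_exp e r pc), R') \<and>
    matches s R' \<and> R' r = ev e s \<and> (\<forall>q. 64 \<le> q \<and> q < r \<longrightarrow> R' q = R q)"
  using assms
proof (induction e arbitrary: r pc s R)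
  case (Num k)
  define R1 where "R1 = R(r := k)"
  have "steps P 1 (pc, R) (pc + 1, R1)"
    by (rule steps_straight[of "[Const r k]"]) (use Num in \<open>simp_all add: R1_def\<close>)
  moreover have "matches s R1" unfolding R1_def using Num by (intro matches_temp) simp_all
  moreover have "R1 r = k" "\<forall>q. 64 \<le> q \<and> q < r \<longrightarrow> R1 q = R q" by (simp_all add: R1_def)
  ultimately show ?case by auto
next
  case (Var x)
  define R1 where "R1 = R(r := fst s x)"
  have "steps P 2 (pc, R) (pc + 2, R1)"
    by (rule steps_straight[of "[Const r 0, Add r r x]"])
      (use Var in \<open>auto simp: matches_var R1_def\<close>)
  moreover have "matches s R1" unfolding R1_def using Var by (intro matches_temp) simp_all
  moreover have "R1 r = fst s x" "\<forall>q. 64 \<le> q \<and> q < r \<longrightarrow> R1 q = R q"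
    by (simp_all add: R1_def)
  ultimately show ?case by auto
next
  case (Idx a e)
  let ?l = "length (comp_exp e r pc)"
  have code: "code_at P pc (comp_exp e r pc)" "code_at P (pc + ?l) (address_code a r)"
    "code_at P (pc + ?l + 12) [Load r r]"
    using Idx.prems(1) unfolding comp_exp.simps code_at_append by simp_all
  obtain R1 where R1: "steps P (time_exp B e) (pc, R) (pc + ?l, R1)" "matches s R1"
    "R1 r = ev e s" "\<forall>q. 64 \<le> q \<and> q < r \<longrightarrow> R1 q = R q"
    using Idx.IH[OF code(1), where s = s and R = R] Idx.prems by auto
  obtain R2 where R2: "steps P 12 (pc + ?l, R1) (pc + ?l + 12, R2)" "matches s R2"
    "R2 r = 256 * (ev e s + 1) + a" "\<forall>q. q \<noteq> r \<and> q \<noteq> r + 1 \<longrightarrow> R2 q = R1 q"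
    using steps_address[OF code(2) R1(2) _ _ R1(3)] Idx.prems by auto
  define R3 where "R3 = R2(r := snd s a (ev e s))"
  have R3: "steps P 1 (pc + ?l + 12, R2) (pc + ?l + 13, R3)"
    by (rule steps_straight[OF _ code(3)])
      (use R2 Idx.prems matches_cell[OF R2(2)] in \<open>auto simp: R3_def\<close>)
  have "steps P (time_exp B e + 13) (pc, R) (pc + ?l + 13, R3)"
    by (rule steps_trans[OF R1(1) steps_trans[OF R2(1) R3 order.refl]]) simp
  moreover have "matches s R3"
    unfolding R3_def using R2 Idx.prems by (intro matches_temp) simp_all
  moreover have "R3 r = snd s a (ev e s)" "\<forall>q. 64 \<le> q \<and> q < r \<longrightarrow> R3 q = R q"
    using R1 R2 Idx.prems by (auto simp: R3_def)
  ultimately show ?case by (auto simp: add.assoc)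
next
  case (Plus a b)
  let ?la = "length (comp_exp a r pc)"
  let ?lb = "length (comp_exp b (r+1) (pc + ?la))"
  have code: "code_at P pc (comp_exp a r pc)" "code_at P (pc + ?la) (comp_exp b (r+1) (pc + ?la))"
    "code_at P (pc + ?la + ?lb) [Add r r (r+1)]"
    using Plus.prems(1) unfolding comp_exp.simps Let_def code_at_append by simp_all
  obtain R1 where R1: "steps P (time_exp B a) (pc, R) (pc + ?la, R1)" "matches s R1"
    "R1 r = ev a s" "\<forall>q. 64 \<le> q \<and> q < r \<longrightarrow> R1 q = R q"
    using Plus.IH(1)[OF code(1), where s = s and R = R] Plus.prems by auto
  obtain R2 where R2: "steps P (time_exp B b) (pc + ?la, R1) (pc + ?la + ?lb, R2)" "matches s R2"
    "R2 (r+1) = ev b s" "\<forall>q. 64 \<le> q \<and> q < r+1 \<longrightarrow> R2 q = R1 q"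
    using Plus.IH(2)[OF code(2) _ _ R1(2)] Plus.prems by auto
  define R3 where "R3 = R2(r := ev a s + ev b s)"
  have R3: "steps P 1 (pc + ?la + ?lb, R2) (pc + ?la + ?lb + 1, R3)"
    by (rule steps_straight[OF _ code(3)]) (use R1 R2 Plus.prems in \<open>auto simp: R3_def\<close>)
  have r: "r < 256" using Plus.prems(2) by (induction a) auto
  have "steps P (time_exp B a + time_exp B b + 1) (pc, R) (pc + ?la + ?lb + 1, R3)"
    by (rule steps_trans[OF R1(1) steps_trans[OF R2(1) R3 order.refl]]) simp
  moreover have "matches s R3"
    unfolding R3_def using R2 r Plus.prems by (intro matches_temp) simp_all
  moreover have "R3 r = ev a s + ev b s" "\<forall>q. 64 \<le> q \<and> q < r \<longrightarrow> R3 q = R q"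
    using R1 R2 by (auto simp: R3_def)
  ultimately show ?case by (auto simp: add.assoc Let_def)
next
  case (Minus a b)
  let ?la = "length (comp_exp a r pc)"
  let ?lb = "length (comp_exp b (r+1) (pc + ?la))"
  have code: "code_at P pc (comp_exp a r pc)" "code_at P (pc + ?la) (comp_exp b (r+1) (pc + ?la))"
    "code_at P (pc + ?la + ?lb) [Sub r r (r+1)]"
    using Minus.prems(1) unfolding comp_exp.simps Let_def code_at_append by simp_all
  obtain R1 where R1: "steps P (time_exp B a) (pc, R) (pc + ?la, R1)" "matches s R1"
    "R1 r = ev a s" "\<forall>q. 64 \<le> q \<and> q < r \<longrightarrow> R1 q = R q"
    using Minus.IH(1)[OF code(1), where s = s and R = R] Minus.prems by auto
  obtain R2 where R2: "steps P (time_exp B b) (pc + ?la, R1) (pc + ?la + ?lb, R2)" "matches s R2"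
    "R2 (r+1) = ev b s" "\<forall>q. 64 \<le> q \<and> q < r+1 \<longrightarrow> R2 q = R1 q"
    using Minus.IH(2)[OF code(2) _ _ R1(2)] Minus.prems by auto
  define R3 where "R3 = R2(r := ev a s - ev b s)"
  have R3: "steps P 1 (pc + ?la + ?lb, R2) (pc + ?la + ?lb + 1, R3)"
    by (rule steps_straight[OF _ code(3)]) (use R1 R2 Minus.prems in \<open>auto simp: R3_def\<close>)
  have r: "r < 256" using Minus.prems(2) by (induction a) auto
  have "steps P (time_exp B a + time_exp B b + 1) (pc, R) (pc + ?la + ?lb + 1, R3)"
    by (rule steps_trans[OF R1(1) steps_trans[OF R2(1) R3 order.refl]]) simp
  moreover have "matches s R3"
    unfolding R3_def using R2 r Minus.prems by (intro matches_temp) simp_all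
  moreover have "R3 r = ev a s - ev b s" "\<forall>q. 64 \<le> q \<and> q < r \<longrightarrow> R3 q = R q"
    using R1 R2 by (auto simp: R3_def)
  ultimately show ?case by (auto simp: add.assoc Let_def)
next
  case (Sum i a e)
  let ?la = "length (comp_exp a r pc)"
  let ?loop = "pc + ?la + 4"
  let ?le = "length (comp_exp e (r+4) (?loop + 4))"
  let ?n = "ev a s"
  let ?sum = "\<lambda>k. \<Sum>j<k. ev e (set_var i j s)"
  have code: "code_at P pc (comp_exp a r pc)"
    "code_at P (pc + ?la) [Const (r+1) 0, Const (r+2) 0, Const (r+3) 0, Add (r+3) (r+3) i]"
    "code_at P ?loop [Sub (r+4) r (r+1)]"
    "code_at P (?loop + 1) [Jz (r+4) (?loop + 9 + ?le)]"
    "code_at P (?loop + 2) [Const i 0, Add i i (r+1)]"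
    "code_at P (?loop + 4) (comp_exp e (r+4) (?loop + 4))"
    "code_at P (?loop + 4 + ?le)
       [Add (r+2) (r+2) (r+4), Const (r+4) 1, Add (r+1) (r+1) (r+4), Const (r+4) 0]"
    "code_at P (?loop + 8 + ?le) [Jz (r+4) ?loop]"
    "code_at P (?loop + 9 + ?le) [Const i 0, Add i i (r+3), Const r 0, Add r r (r+2)]"
    using Sum.prems(1) unfolding comp_exp.simps Let_def code_at_append
    by (simp_all add: code_at_Cons code_at_Nil ac_simps numeral_eq_Suc)
  have fit: "i < 64" "r + 4 < 256" "64 \<le> r" using Sum.prems by auto
  obtain R1 where R1: "steps P (time_exp B a) (pc, R) (pc + ?la, R1)" "matches s R1"
    "R1 r = ?n" "\<forall>q. 64 \<le> q \<and> q < r \<longrightarrow> R1 q = R q"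
    using Sum.IH(1)[OF code(1), where s = s and R = R] Sum.prems by auto
  define R2 where "R2 = R1(r+1 := 0, r+2 := 0, r+3 := fst s i)"
  have R2: "steps P 4 (pc + ?la, R1) (?loop, R2)"
    by (rule steps_straight[OF _ code(2)])
      (use R1 fit in \<open>auto simp: R2_def matches_var fun_eq_iff\<close>)
  \<comment> \<open>Induction on the number \<open>d\<close> of iterations still to come. Within the
    loop the memory represents \<open>s\<close> only up to the current value \<open>w\<close> of the
    summation variable.\<close>
  have loop: "\<exists>R'. steps P (2 + d * (time_exp B e + 9)) (?loop, Q) (?loop + 9 + ?le, R') \<and>
      (\<exists>w. matches (set_var i w s) R') \<and> R' (r+2) = ?sum ?n \<and> R' (r+3) = fst s i \<and>
      (\<forall>q. 64 \<le> q \<and> q < r \<longrightarrow> R' q = Q q)"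
    if "k + d = ?n" "matches (set_var i w s) Q" "Q r = ?n" "Q (r+1) = k" "Q (r+2) = ?sum k"
      "Q (r+3) = fst s i" for d k w Q
    using that
  proof (induction d arbitrary: k w Q)
    case 0
    define Q1 where "Q1 = Q(r+4 := 0)"
    have "steps P 1 (?loop, Q) (?loop + 1, Q1)"
      by (rule steps_straight[OF _ code(3)]) (use 0 in \<open>auto simp: Q1_def\<close>)
    moreover have "steps P 1 (?loop + 1, Q1) (?loop + 9 + ?le, Q1)"
      by (rule steps_jump[OF code(4)]) (simp add: Q1_def)
    ultimately have "steps P 2 (?loop, Q) (?loop + 9 + ?le, Q1)"
      by (rule steps_trans) simp
    moreover have "matches (set_var i w s) Q1"
      unfolding Q1_def using 0 fit by (intro matches_temp) auto
    moreover have "Q1 (r+2) = ?sum ?n" "Q1 (r+3) = fst s i"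
      "\<forall>q. 64 \<le> q \<and> q < r \<longrightarrow> Q1 q = Q q"
      using 0 by (auto simp: Q1_def)
    ultimately show ?case by auto
  next
    case (Suc d)
    have k: "k < ?n" using Suc.prems by simp
    define Q1 where "Q1 = Q(r+4 := ?n - k)"
    have "steps P 1 (?loop, Q) (?loop + 1, Q1)"
      by (rule steps_straight[OF _ code(3)]) (use Suc in \<open>auto simp: Q1_def\<close>)
    moreover have "steps P 1 (?loop + 1, Q1) (?loop + 2, Q1)"
      by (rule steps_jump[OF code(4)]) (use k in \<open>simp add: Q1_def\<close>)
    ultimately have 1: "steps P 2 (?loop, Q) (?loop + 2, Q1)"
      by (rule steps_trans) simp
    define Q2 where "Q2 = Q1(i := k)"
    have 2: "steps P 2 (?loop + 2, Q1) (?loop + 4, Q2)"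
      by (rule steps_straight[OF _ code(5)])
        (use Suc fit in \<open>auto simp: Q2_def Q1_def\<close>)
    have m2: "matches (set_var i k s) Q2"
    proof -
      have "matches (set_var i w s) Q1"
        unfolding Q1_def using Suc fit by (intro matches_temp) auto
      then have "matches (set_var i k (set_var i w s)) Q2"
        unfolding Q2_def using fit by (intro matches_set_var)
      then show ?thesis by simp
    qed
    obtain Q3 where Q3: "steps P (time_exp B e) (?loop + 4, Q2) (?loop + 4 + ?le, Q3)"
      "matches (set_var i k s) Q3" "Q3 (r+4) = ev e (set_var i k s)"
      "\<forall>q. 64 \<le> q \<and> q < r + 4 \<longrightarrow> Q3 q = Q2 q"
      using Sum.IH(2)[OF code(6) _ _ m2] Sum.prems k by auto
    define Q4 where "Q4 = Q3(r+2 := ?sum (Suc k), r+1 := Suc k, r+4 := 0)"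
    have q3: "Q3 r = ?n" "Q3 (r+1) = k" "Q3 (r+2) = ?sum k" "Q3 (r+3) = fst s i"
      "\<forall>q. 64 \<le> q \<and> q < r \<longrightarrow> Q3 q = Q q"
      using Q3(4) Suc.prems fit by (auto simp: Q2_def Q1_def)
    have 4: "steps P 4 (?loop + 4 + ?le, Q3) (?loop + 8 + ?le, Q4)"
      by (rule steps_straight[OF _ code(7)])
        (use Q3(3) q3 in \<open>auto simp: Q4_def fun_eq_iff\<close>)
    have 5: "steps P 1 (?loop + 8 + ?le, Q4) (?loop, Q4)"
      by (rule steps_jump[OF code(8)]) (simp add: Q4_def)
    have m4: "matches (set_var i k s) Q4"
      unfolding Q4_def using Q3(2) fit by (intro matches_temp) auto
    have "Suc k + d = ?n" using Suc.prems by simp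
    moreover have "Q4 r = ?n" "Q4 (r+1) = Suc k" "Q4 (r+2) = ?sum (Suc k)" "Q4 (r+3) = fst s i"
      using q3 by (simp_all add: Q4_def)
    ultimately obtain R' where
      R': "steps P (2 + d * (time_exp B e + 9)) (?loop, Q4) (?loop + 9 + ?le, R')"
      "\<exists>w. matches (set_var i w s) R'" "R' (r+2) = ?sum ?n" "R' (r+3) = fst s i"
      "\<forall>q. 64 \<le> q \<and> q < r \<longrightarrow> R' q = Q4 q"
      using Suc.IH[OF _ m4] by blast
    have "steps P (2 + Suc d * (time_exp B e + 9)) (?loop, Q) (?loop + 9 + ?le, R')"
      by (rule steps_trans[OF 1 steps_trans[OF 2 steps_trans[OF Q3(1)
          steps_trans[OF 4 steps_trans[OF 5 R'(1) order.refl] order.refl] order.refl]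
          order.refl]]) simp
    moreover have "\<forall>q. 64 \<le> q \<and> q < r \<longrightarrow> Q4 q = Q q"
      using q3 fit by (auto simp: Q4_def)
    ultimately show ?case using R' by auto
  qed
  have m2: "matches (set_var i (fst s i) s) R2"
    unfolding R2_def using R1 fit by (simp add: matches_temp)
  have q2: "R2 r = ?n" "R2 (r+1) = 0" "R2 (r+2) = ?sum 0" "R2 (r+3) = fst s i"
    using R1 by (simp_all add: R2_def)
  obtain R3 w where
    R3: "steps P (2 + ?n * (time_exp B e + 9)) (?loop, R2) (?loop + 9 + ?le, R3)"
      "matches (set_var i w s) R3" "R3 (r+2) = ?sum ?n" "R3 (r+3) = fst s i"
      "\<forall>q. 64 \<le> q \<and> q < r \<longrightarrow> R3 q = R2 q"
    using loop[OF add_0 m2 q2] by blast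
  define R4 where "R4 = R3(i := fst s i, r := ?sum ?n)"
  have R4: "steps P 4 (?loop + 9 + ?le, R3) (?loop + 13 + ?le, R4)"
    by (rule steps_straight[OF _ code(9)]) (use R3 fit in \<open>auto simp: R4_def\<close>)
  \<comment> \<open>\<open>ok_exp\<close> bounds the actual number of iterations by
    \<open>B\<close>; this turns the exact count into \<open>time_exp\<close>.\<close>
  have "?n * (time_exp B e + 9) \<le> B * (time_exp B e + 9)"
    using Sum.prems by (intro mult_le_mono) auto
  then have "steps P (time_exp B (exp.Sum i a e)) (pc, R) (?loop + 13 + ?le, R4)"
    by (intro steps_trans[OF R1(1) steps_trans[OF R2 steps_trans[OF R3(1) R4 order.refl]
          order.refl]]) simp
  moreover have "matches s R4"
  proof -
    have "matches (set_var i (fst s i) (set_var i w s)) (R3(i := fst s i))"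
      using R3(2) fit by (intro matches_set_var)
    then have "matches s (R3(i := fst s i))" by simp
    then show ?thesis unfolding R4_def by (rule matches_temp) (use fit in simp_all)
  qed
  moreover have "R4 r = ?sum ?n" "\<forall>q. 64 \<le> q \<and> q < r \<longrightarrow> R4 q = R q"
    using R1 R3 fit by (auto simp: R4_def R2_def)
  moreover have "?loop + 13 + ?le = pc + length (comp_exp (exp.Sum i a e) r pc)"
    by (simp add: Let_def)
  ultimately show ?case unfolding ev.simps by metis
qed

lemma comp_com_correct:
  assumes "code_at P pc (comp_com c r pc)" "fits_com c r" "64 \<le> r" "matches s R" "ok_com B c s"
  shows "\<exists>R'. steps P (time_com B c) (pc, R) (pc + length (comp_com c r pc), R') \<and>
    matches (ex c s) R' \<and> (\<forall>q. 64 \<le> q \<and> q < r \<longrightarrow> R' q = R q)"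
  using assms
proof (induction c arbitrary: r pc s R)
  case Skip
  then show ?case by (auto intro: steps_refl)
next
  case (Assign x e)
  let ?l = "length (comp_exp e r pc)"
  have code: "code_at P pc (comp_exp e r pc)" "code_at P (pc + ?l) [Const x 0, Add x x r]"
    using Assign.prems(1) unfolding comp_com.simps code_at_append by simp_all
  obtain R1 where R1: "steps P (time_exp B e) (pc, R) (pc + ?l, R1)" "matches s R1"
    "R1 r = ev e s" "\<forall>q. 64 \<le> q \<and> q < r \<longrightarrow> R1 q = R q"
    using comp_exp_correct[OF code(1), where s = s and R = R and B = B] Assign.prems by auto
  define R2 where "R2 = R1(x := ev e s)"
  have "steps P 2 (pc + ?l, R1) (pc + ?l + 2, R2)"
    by (rule steps_straight[OF _ code(2)]) (use R1 Assign.prems in \<open>auto simp: R2_def\<close>)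
  then have "steps P (time_exp B e + 2) (pc, R) (pc + ?l + 2, R2)"
    by (rule steps_trans[OF R1(1)]) simp
  moreover have "matches (ex (Assign x e) s) R2"
    unfolding R2_def ex.simps using R1 Assign.prems by (intro matches_set_var) simp_all
  moreover have "\<forall>q. 64 \<le> q \<and> q < r \<longrightarrow> R2 q = R q"
    using R1 Assign.prems by (auto simp: R2_def)
  ultimately show ?case by (auto simp: add.assoc)
next
  case (Write a e1 e2)
  let ?l = "length (comp_exp e1 r pc)"
  let ?l2 = "length (comp_exp e2 (r+2) (pc + ?l + 12))"
  have code: "code_at P pc (comp_exp e1 r pc)" "code_at P (pc + ?l) (address_code a r)"
    "code_at P (pc + ?l + 12) (comp_exp e2 (r+2) (pc + ?l + 12))"
    "code_at P (pc + ?l + 12 + ?l2) [Store r (r+2)]"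
    using Write.prems(1) unfolding comp_com.simps Let_def code_at_append by simp_all
  obtain R1 where R1: "steps P (time_exp B e1) (pc, R) (pc + ?l, R1)" "matches s R1"
    "R1 r = ev e1 s" "\<forall>q. 64 \<le> q \<and> q < r \<longrightarrow> R1 q = R q"
    using comp_exp_correct[OF code(1), where s = s and R = R and B = B] Write.prems by auto
  obtain R2 where R2: "steps P 12 (pc + ?l, R1) (pc + ?l + 12, R2)" "matches s R2"
    "R2 r = 256 * (ev e1 s + 1) + a" "\<forall>q. q \<noteq> r \<and> q \<noteq> r + 1 \<longrightarrow> R2 q = R1 q"
    using steps_address[OF code(2) R1(2) _ _ R1(3)] Write.prems by auto
  obtain R3 where R3: "steps P (time_exp B e2) (pc + ?l + 12, R2) (pc + ?l + 12 + ?l2, R3)"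
    "matches s R3" "R3 (r+2) = ev e2 s" "\<forall>q. 64 \<le> q \<and> q < r + 2 \<longrightarrow> R3 q = R2 q"
    using comp_exp_correct[OF code(3) _ _ R2(2)] Write.prems by auto
  define R4 where "R4 = R3(256 * (ev e1 s + 1) + a := ev e2 s)"
  have R4: "steps P 1 (pc + ?l + 12 + ?l2, R3) (pc + ?l + 13 + ?l2, R4)"
    by (rule steps_straight[OF _ code(4)]) (use R2 R3 Write.prems in \<open>auto simp: R4_def\<close>)
  have "steps P (time_com B (Write a e1 e2)) (pc, R) (pc + ?l + 13 + ?l2, R4)"
    by (rule steps_trans[OF R1(1) steps_trans[OF R2(1) steps_trans[OF R3(1) R4 order.refl]
          order.refl]]) simp
  moreover have "matches (ex (Write a e1 e2) s) R4"
    unfolding R4_def ex.simps using R3(2) Write.prems by (intro matches_set_cell) auto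
  moreover have "\<forall>q. 64 \<le> q \<and> q < r \<longrightarrow> R4 q = R q"
    using R1 R2 R3 Write.prems by (auto simp: R4_def)
  ultimately show ?case by (intro exI[of _ R4]) (auto simp: Let_def ac_simps)
next
  case (Seq c1 c2)
  let ?l = "length (comp_com c1 r pc)"
  have code: "code_at P pc (comp_com c1 r pc)" "code_at P (pc + ?l) (comp_com c2 r (pc + ?l))"
    using Seq.prems(1) unfolding comp_com.simps Let_def code_at_append by simp_all
  obtain R1 where R1: "steps P (time_com B c1) (pc, R) (pc + ?l, R1)" "matches (ex c1 s) R1"
    "\<forall>q. 64 \<le> q \<and> q < r \<longrightarrow> R1 q = R q"
    using Seq.IH(1)[OF code(1), where s = s and R = R] Seq.prems by auto
  obtain R2 where R2: "steps P (time_com B c2) (pc + ?l, R1)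
      (pc + ?l + length (comp_com c2 r (pc + ?l)), R2)" "matches (ex c2 (ex c1 s)) R2"
    "\<forall>q. 64 \<le> q \<and> q < r \<longrightarrow> R2 q = R1 q"
    using Seq.IH(2)[OF code(2) _ _ R1(2)] Seq.prems by auto
  show ?case
    using steps_trans[OF R1(1) R2(1) order.refl] R1 R2
    by (intro exI[of _ R2]) (auto simp: Let_def ac_simps)
next
  case (Cond e c1 c2)
  let ?le = "length (comp_exp e r pc)"
  let ?p1 = "pc + ?le + 1"
  let ?l1 = "length (comp_com c1 r ?p1)"
  let ?p2 = "?p1 + ?l1 + 2"
  let ?l2 = "length (comp_com c2 r ?p2)"
  have code: "code_at P pc (comp_exp e r pc)" "code_at P (pc + ?le) [Jz r ?p2]"
    "code_at P ?p1 (comp_com c1 r ?p1)" "code_at P (?p1 + ?l1) [Const r 0]"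
    "code_at P (?p1 + ?l1 + 1) [Jz r (?p2 + ?l2)]" "code_at P ?p2 (comp_com c2 r ?p2)"
    using Cond.prems(1) unfolding comp_com.simps Let_def code_at_append
    by (simp_all add: code_at_Cons)
  obtain R1 where R1: "steps P (time_exp B e) (pc, R) (pc + ?le, R1)" "matches s R1"
    "R1 r = ev e s" "\<forall>q. 64 \<le> q \<and> q < r \<longrightarrow> R1 q = R q"
    using comp_exp_correct[OF code(1), where s = s and R = R and B = B] Cond.prems by auto
  show ?case
  proof (cases "ev e s = 0")
    case True
    have J: "steps P 1 (pc + ?le, R1) (?p2, R1)"
      by (rule steps_jump[OF code(2)]) (use True R1 in simp)
    obtain R2 where R2: "steps P (time_com B c2) (?p2, R1) (?p2 + ?l2, R2)" "matches (ex c2 s) R2"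
      "\<forall>q. 64 \<le> q \<and> q < r \<longrightarrow> R2 q = R1 q"
      using Cond.IH(2)[OF code(6) _ _ R1(2)] Cond.prems True by auto
    have "steps P (time_com B (Cond e c1 c2)) (pc, R) (?p2 + ?l2, R2)"
      by (rule steps_trans[OF R1(1) steps_trans[OF J R2(1) order.refl]]) simp
    then show ?thesis
      using R1 R2 True by (intro exI[of _ R2]) (auto simp: Let_def ac_simps)
  next
    case False
    have J: "steps P 1 (pc + ?le, R1) (?p1, R1)"
      by (rule steps_jump[OF code(2)]) (use False R1 in simp)
    obtain R2 where R2: "steps P (time_com B c1) (?p1, R1) (?p1 + ?l1, R2)" "matches (ex c1 s) R2"
      "\<forall>q. 64 \<le> q \<and> q < r \<longrightarrow> R2 q = R1 q"
      using Cond.IH(1)[OF code(3) _ _ R1(2)] Cond.prems False by auto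
    define R3 where "R3 = R2(r := 0)"
    have R3: "steps P 1 (?p1 + ?l1, R2) (?p1 + ?l1 + 1, R3)"
      by (rule steps_straight[OF _ code(4)]) (simp_all add: R3_def)
    have J': "steps P 1 (?p1 + ?l1 + 1, R3) (?p2 + ?l2, R3)"
      by (rule steps_jump[OF code(5)]) (simp add: R3_def)
    have "steps P (time_com B (Cond e c1 c2)) (pc, R) (?p2 + ?l2, R3)"
      by (rule steps_trans[OF R1(1) steps_trans[OF J steps_trans[OF R2(1)
              steps_trans[OF R3 J' order.refl] order.refl] order.refl]]) simp
    moreover have "matches (ex c1 s) R3"
      unfolding R3_def using R2(2) Cond.prems by (intro matches_temp) auto
    moreover have "\<forall>q. 64 \<le> q \<and> q < r \<longrightarrow> R3 q = R q"
      using R1 R2 by (auto simp: R3_def)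
    ultimately show ?thesis using False by (auto simp: Let_def ac_simps)
  qed
next
  case (For i e c)
  let ?le = "length (comp_exp e r pc)"
  let ?loop = "pc + ?le + 1"
  let ?l = "length (comp_com c (r+2) (?loop + 4))"
  let ?n = "ev e s"
  let ?it = "\<lambda>k. fold (\<lambda>j s. ex c (set_var i j s)) [0..<k] s"
  have code: "code_at P pc (comp_exp e r pc)"
    "code_at P (pc + ?le) [Const (r+1) 0]"
    "code_at P ?loop [Sub (r+2) r (r+1)]"
    "code_at P (?loop + 1) [Jz (r+2) (?loop + 8 + ?l)]"
    "code_at P (?loop + 2) [Const i 0, Add i i (r+1)]"
    "code_at P (?loop + 4) (comp_com c (r+2) (?loop + 4))"
    "code_at P (?loop + 4 + ?l) [Const (r+2) 1, Add (r+1) (r+1) (r+2), Const (r+2) 0]"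
    "code_at P (?loop + 7 + ?l) [Jz (r+2) ?loop]"
    using For.prems(1) unfolding comp_com.simps Let_def code_at_append
    by (simp_all add: code_at_Cons code_at_Nil ac_simps numeral_eq_Suc)
  have fit: "i < 64" "r + 2 < 256" "64 \<le> r" using For.prems by auto
  obtain R1 where R1: "steps P (time_exp B e) (pc, R) (pc + ?le, R1)" "matches s R1"
    "R1 r = ?n" "\<forall>q. 64 \<le> q \<and> q < r \<longrightarrow> R1 q = R q"
    using comp_exp_correct[OF code(1), where s = s and R = R and B = B] For.prems by auto
  define R2 where "R2 = R1(r+1 := 0)"
  have R2: "steps P 1 (pc + ?le, R1) (?loop, R2)"
    by (rule steps_straight[OF _ code(2)]) (simp_all add: R2_def)
  have m2: "matches s R2"
    unfolding R2_def using R1 fit by (intro matches_temp) auto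
  \<comment> \<open>Again induction on the iterations still to come; the memory represents the store
    reached after the first \<open>k\<close> of them.\<close>
  have loop: "\<exists>R'. steps P (2 + d * (time_com B c + 8)) (?loop, Q) (?loop + 8 + ?l, R') \<and>
      matches (?it ?n) R' \<and> (\<forall>q. 64 \<le> q \<and> q < r \<longrightarrow> R' q = Q q)"
    if "k + d = ?n" "matches (?it k) Q" "Q r = ?n" "Q (r+1) = k" for d k Q
    using that
  proof (induction d arbitrary: k Q)
    case 0
    define Q1 where "Q1 = Q(r+2 := 0)"
    have "steps P 1 (?loop, Q) (?loop + 1, Q1)"
      by (rule steps_straight[OF _ code(3)]) (use 0 in \<open>auto simp: Q1_def\<close>)
    moreover have "steps P 1 (?loop + 1, Q1) (?loop + 8 + ?l, Q1)"
      by (rule steps_jump[OF code(4)]) (simp add: Q1_def)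
    ultimately have "steps P 2 (?loop, Q) (?loop + 8 + ?l, Q1)"
      by (rule steps_trans) simp
    moreover have "matches (?it ?n) Q1"
      unfolding Q1_def using 0 fit by (intro matches_temp) auto
    moreover have "\<forall>q. 64 \<le> q \<and> q < r \<longrightarrow> Q1 q = Q q"
      by (auto simp: Q1_def)
    ultimately show ?case by auto
  next
    case (Suc d)
    have k: "k < ?n" using Suc.prems by simp
    define Q1 where "Q1 = Q(r+2 := ?n - k)"
    have "steps P 1 (?loop, Q) (?loop + 1, Q1)"
      by (rule steps_straight[OF _ code(3)]) (use Suc in \<open>auto simp: Q1_def\<close>)
    moreover have "steps P 1 (?loop + 1, Q1) (?loop + 2, Q1)"
      by (rule steps_jump[OF code(4)]) (use k in \<open>simp add: Q1_def\<close>)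
    ultimately have 1: "steps P 2 (?loop, Q) (?loop + 2, Q1)"
      by (rule steps_trans) simp
    define Q2 where "Q2 = Q1(i := k)"
    have 2: "steps P 2 (?loop + 2, Q1) (?loop + 4, Q2)"
      by (rule steps_straight[OF _ code(5)])
        (use Suc fit in \<open>auto simp: Q2_def Q1_def\<close>)
    have m2: "matches (set_var i k (?it k)) Q2"
      unfolding Q2_def Q1_def using Suc fit by (intro matches_set_var matches_temp) auto
    obtain Q3 where Q3: "steps P (time_com B c) (?loop + 4, Q2) (?loop + 4 + ?l, Q3)"
      "matches (?it (Suc k)) Q3" "\<forall>q. 64 \<le> q \<and> q < r + 2 \<longrightarrow> Q3 q = Q2 q"
      using For.IH[OF code(6) _ _ m2] For.prems k by auto
    define Q4 where "Q4 = Q3(r+1 := Suc k, r+2 := 0)"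
    have q3: "Q3 r = ?n" "Q3 (r+1) = k" "\<forall>q. 64 \<le> q \<and> q < r \<longrightarrow> Q3 q = Q q"
      using Q3(3) Suc.prems fit by (auto simp: Q2_def Q1_def)
    have 4: "steps P 3 (?loop + 4 + ?l, Q3) (?loop + 7 + ?l, Q4)"
      by (rule steps_straight[OF _ code(7)])
        (use q3 in \<open>auto simp: Q4_def fun_eq_iff\<close>)
    have 5: "steps P 1 (?loop + 7 + ?l, Q4) (?loop, Q4)"
      by (rule steps_jump[OF code(8)]) (simp add: Q4_def)
    have m4: "matches (?it (Suc k)) Q4"
      unfolding Q4_def using Q3(2) fit by (intro matches_temp) auto
    have "Suc k + d = ?n" using Suc.prems by simp
    moreover have "Q4 r = ?n" "Q4 (r+1) = Suc k" using q3 by (simp_all add: Q4_def)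
    ultimately obtain R' where
      R': "steps P (2 + d * (time_com B c + 8)) (?loop, Q4) (?loop + 8 + ?l, R')"
      "matches (?it ?n) R'" "\<forall>q. 64 \<le> q \<and> q < r \<longrightarrow> R' q = Q4 q"
      using Suc.IH[OF _ m4] by blast
    have "steps P (2 + Suc d * (time_com B c + 8)) (?loop, Q) (?loop + 8 + ?l, R')"
      by (rule steps_trans[OF 1 steps_trans[OF 2 steps_trans[OF Q3(1)
          steps_trans[OF 4 steps_trans[OF 5 R'(1) order.refl] order.refl] order.refl]
          order.refl]]) simp
    moreover have "\<forall>q. 64 \<le> q \<and> q < r \<longrightarrow> Q4 q = Q q"
      using q3 fit by (auto simp: Q4_def)
    ultimately show ?case using R' by auto
  qed
  have m2: "matches (?it 0) R2" using m2 by simp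
  have q2: "R2 r = ?n" "R2 (r+1) = 0" using R1 by (simp_all add: R2_def)
  obtain R3 where
    R3: "steps P (2 + ?n * (time_com B c + 8)) (?loop, R2) (?loop + 8 + ?l, R3)"
      "matches (?it ?n) R3" "\<forall>q. 64 \<le> q \<and> q < r \<longrightarrow> R3 q = R2 q"
    using loop[OF add_0 m2 q2] by blast
  have "?n * (time_com B c + 8) \<le> B * (time_com B c + 8)"
    using For.prems by (intro mult_le_mono) auto
  then have "steps P (time_com B (For i e c)) (pc, R) (?loop + 8 + ?l, R3)"
    by (intro steps_trans[OF R1(1) steps_trans[OF R2 R3(1) order.refl]]) simp
  moreover have "\<forall>q. 64 \<le> q \<and> q < r \<longrightarrow> R3 q = R q"
    using R1 R3 by (auto simp: R2_def)
  moreover have "?loop + 8 + ?l = pc + length (comp_com (For i e c) r pc)"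
    by (simp add: Let_def)
  ultimately show ?case using R3 unfolding ex.simps by metis
qed

subsection \<open>Moving the input into an array\<close>

text \<open>Initially the input occupies the registers 1 to \<open>L\<close>, and only register 0, holding \<open>L\<close>, is
  available. Input words 1 to 6 are parked at \<open>512 * L\<close>, beyond everything that is touched
  before they are fetched again; this frees registers 1 to 6. Word \<open>r\<close> is then moved to
  \<open>256 * r\<close>, for decreasing \<open>r\<close>, so that no word is overwritten before it has been moved.\<close>

definition doubling :: "nat \<Rightarrow> nat \<Rightarrow> instr list" where
  "doubling n r = replicate n (Add r r r)"

lemma length_doubling [simp]: "length (doubling n r) = n"
  by (simp add: doubling_def)

lemma straight_doubling [simp]:
  "straight (doubling n r @ is) R = straight is (R(r := 2 ^ n * R r))"
  by (induction n arbitrary: R) (simp_all add: doubling_def mult_2 distrib_left distrib_right)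

lemma straight_doubling_end [simp]: "straight (doubling n r) R = Some (R(r := 2 ^ n * R r))"
  using straight_doubling[of n r "[]" R] by simp

definition boot_save_word :: "nat \<Rightarrow> instr list" where
  "boot_save_word k = [Store 0 k, Add 0 0 1]"

definition boot_save :: "instr list" where
  "boot_save = doubling 9 0 @ [Store 0 1, Const 1 1, Add 0 0 1]
     @ concat (map boot_save_word [2..<7]) @ [Const 2 6, Sub 0 0 2, Const 2 0, Const 3 512]"

definition boot_move :: "instr list" where
  "boot_move = [Load 5 4, Const 6 0, Add 6 6 4] @ doubling 8 6 @ [Store 6 5, Sub 4 4 1, Const 5 0]"

definition boot_fetch :: "instr list" where
  "boot_fetch = [Const 3 0, Add 3 3 2] @ doubling 9 3"

definition boot_fetch_word :: "nat \<Rightarrow> instr list" where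
  "boot_fetch_word i = [Load 5 3, Const 6 (256 * Suc i), Store 6 5, Add 3 3 1]"

text \<open>The code sits at address 0, so its jump targets are fixed numbers: 27 and 32 are head
  and exit of a counting loop, 34 and 52 those of the moving loop; the compiled command starts at
  87. Parking the words destroys the only copy of \<open>L\<close>: register 0 then holds
  \<open>512 * L\<close>, and the counting loop recovers \<open>L\<close> by subtracting 512
  repeatedly. On empty input there is nothing to move and the code jumps to
  \<open>end\<close>.\<close>

definition boot :: "nat \<Rightarrow> instr list" where
  "boot end = [Jz 0 end] @ boot_save
     @ [Jz 0 32] @ [Sub 0 0 3, Add 2 2 1, Const 4 0] @ [Jz 4 27]
     @ [Const 4 0, Add 4 4 2]
     @ [Const 5 6, Sub 5 4 5] @ [Jz 5 52] @ boot_move @ [Jz 5 34]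
     @ boot_fetch @ concat (map boot_fetch_word [0..<6])"

lemma length_boot_word [simp]: "length (boot_save_word k) = 2" "length (boot_fetch_word k) = 4"
  by (simp_all add: boot_save_word_def boot_fetch_word_def)

lemma length_boot_words [simp]:
  "length (concat (map boot_save_word [2..<7])) = 10"
  "length (concat (map boot_fetch_word [0..<6])) = 24"
  by (simp_all add: upt_rec)

lemma length_boot_parts [simp]:
  "length boot_save = 26" "length boot_move = 14" "length boot_fetch = 11"
  by (simp_all add: boot_save_def boot_move_def boot_fetch_def)

lemma length_boot: "length (boot l) = 87"
  by (simp add: boot_def)

lemma straight_append:
  "straight is R = Some R' \<Longrightarrow> straight (is @ js) R = straight js R'"
  by (induction "is" R rule: straight.induct) simp_all

text \<open>Six words are parked even if the input is shorter, so registers up to 6 are tracked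
  besides those up to \<open>L\<close>. All target addresses exceed both bounds, so no unread word
  is hit.\<close>

lemma boot_save_words_correct:
  assumes "k \<le> 7" "R 1 = 1" "R 0 = A + k - 1" "A > L" "A > 6" "k \<ge> 2"
    and "\<forall>i<k - 1. R (A + i) = X (Suc i)" "\<forall>j. k \<le> j \<and> (j \<le> 6 \<or> j \<le> L) \<longrightarrow> R j = X j"
  shows "\<exists>R'. straight (concat (map boot_save_word [k..<7])) R = Some R' \<and>
    R' 0 = A + 6 \<and> R' 1 = 1 \<and> (\<forall>i<6. R' (A + i) = X (Suc i)) \<and>
    (\<forall>j. 7 \<le> j \<and> j \<le> L \<longrightarrow> R' j = X j)"
  using assms
proof (induction "7 - k" arbitrary: k R)
  case 0
  then have "k = 7" by simp
  then show ?case using 0 by auto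
next
  case (Suc d)
  have k: "k < 7" using Suc.hyps(2) by simp
  define R1 where "R1 = R(A + (k - 1) := X k, 0 := A + k)"
  have "straight (boot_save_word k) R = Some R1"
    using Suc.prems k by (auto simp: boot_save_word_def R1_def fun_eq_iff)
  then have "straight (concat (map boot_save_word [k..<7])) R
      = straight (concat (map boot_save_word [Suc k..<7])) R1"
    using upt_conv_Cons[OF k] by (simp add: straight_append)
  moreover have "\<exists>R'. straight (concat (map boot_save_word [Suc k..<7])) R1 = Some R' \<and>
    R' 0 = A + 6 \<and> R' 1 = 1 \<and> (\<forall>i<6. R' (A + i) = X (Suc i)) \<and>
    (\<forall>j. 7 \<le> j \<and> j \<le> L \<longrightarrow> R' j = X j)"
  proof (rule Suc.hyps(1))
    show "\<forall>i<Suc k - 1. R1 (A + i) = X (Suc i)"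
    proof (intro allI impI)
      fix i assume i: "i < Suc k - 1"
      show "R1 (A + i) = X (Suc i)"
      proof (cases "i = k - 1")
        case True
        then show ?thesis using Suc.prems by (simp add: R1_def)
      next
        case False
        then have "A + i \<noteq> A + (k - 1)" by simp
        then show ?thesis using Suc.prems False i by (simp add: R1_def)
      qed
    qed
  qed (use Suc.prems Suc.hyps(2) k in \<open>auto simp: R1_def\<close>)
  ultimately show ?case by simp
qed

lemma boot_save_correct:
  assumes "R 0 = L" "L > 0"
  shows "\<exists>R'. straight boot_save R = Some R' \<and> R' 0 = 512 * L \<and> R' 1 = 1 \<and> R' 2 = 0 \<and> R' 3 = 512 \<and>
    (\<forall>i<6. R' (512 * L + i) = R (Suc i)) \<and> (\<forall>j. 7 \<le> j \<and> j \<le> L \<longrightarrow> R' j = R j)"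
proof -
  define R1 where "R1 = R(512 * L := R 1, 1 := 1, 0 := 512 * L + 1)"
  have "straight (doubling 9 0 @ [Store 0 1, Const 1 1, Add 0 0 1]) R = Some R1"
    using assms by (simp add: R1_def fun_eq_iff)
  moreover obtain R2 where R2: "straight (concat (map boot_save_word [2..<7])) R1 = Some R2"
    "R2 0 = 512 * L + 6" "R2 1 = 1" "\<forall>i<6. R2 (512 * L + i) = R (Suc i)"
    "\<forall>j. 7 \<le> j \<and> j \<le> L \<longrightarrow> R2 j = R j"
  proof -
    have "\<exists>R'. straight (concat (map boot_save_word [2..<7])) R1 = Some R' \<and>
      R' 0 = 512 * L + 6 \<and> R' 1 = 1 \<and> (\<forall>i<6. R' (512 * L + i) = R (Suc i)) \<and>
      (\<forall>j. 7 \<le> j \<and> j \<le> L \<longrightarrow> R' j = R j)"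
      by (rule boot_save_words_correct) (use assms in \<open>auto simp: R1_def\<close>)
    then show ?thesis using that by blast
  qed
  moreover define R3 where "R3 = R2(0 := 512 * L, 2 := 0, 3 := 512)"
  moreover have "straight [Const 2 6, Sub 0 0 2, Const 2 0, Const 3 512] R2 = Some R3"
    using R2(2) by (simp add: R3_def fun_eq_iff)
  ultimately have "straight boot_save R = Some R3"
    unfolding boot_save_def by (metis append_assoc straight_append)
  moreover have "\<forall>i<6. R3 (512 * L + i) = R (Suc i)" "\<forall>j. 7 \<le> j \<and> j \<le> L \<longrightarrow> R3 j = R j"
    using R2(4,5) assms by (auto simp: R3_def)
  moreover have "R3 0 = 512 * L" "R3 1 = 1" "R3 2 = 0" "R3 3 = 512"
    using R2(3) by (simp_all add: R3_def)
  ultimately show ?thesis by blast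
qed

text \<open>Division by 512 through repeated subtraction, five instructions per round.\<close>

lemma boot_count_correct:
  assumes code: "code_at P 27 [Jz 0 32]" "code_at P 28 [Sub 0 0 3, Add 2 2 1, Const 4 0]"
    "code_at P 31 [Jz 4 27]"
    and "R 1 = 1" "R 3 = 512" "R 0 = 512 * d"
  shows "\<exists>R'. steps P (Suc (d * 5)) (27, R) (32, R') \<and> R' 2 = R 2 + d \<and>
    (\<forall>q. q \<noteq> 0 \<and> q \<noteq> 2 \<and> q \<noteq> 4 \<longrightarrow> R' q = R q)"
  using assms(4-)
proof (induction d arbitrary: R)
  case 0
  have "steps P 1 (27, R) (32, R)" by (rule steps_jump[OF code(1)]) (use 0 in simp)
  then show ?case by auto
next
  case (Suc d)
  have 1: "steps P 1 (27, R) (28, R)" by (rule steps_jump[OF code(1)]) (use Suc in simp)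
  define R1 where "R1 = R(0 := 512 * d, 2 := Suc (R 2), 4 := 0)"
  have 2: "steps P 3 (28, R) (31, R1)"
    by (rule steps_straight[OF _ code(2)]) (use Suc in \<open>simp_all add: R1_def\<close>)
  have 3: "steps P 1 (31, R1) (27, R1)" by (rule steps_jump[OF code(3)]) (simp add: R1_def)
  have "R1 1 = 1" "R1 3 = 512" "R1 0 = 512 * d" using Suc.prems by (simp_all add: R1_def)
  from Suc.IH[OF this] obtain R' where R': "steps P (Suc (d * 5)) (27, R1) (32, R')"
    "R' 2 = R1 2 + d" "\<forall>q. q \<noteq> 0 \<and> q \<noteq> 2 \<and> q \<noteq> 4 \<longrightarrow> R' q = R1 q" by blast
  have "steps P (Suc (Suc d * 5)) (27, R) (32, R')"
    by (rule steps_trans[OF 1 steps_trans[OF 2 steps_trans[OF 3 R'(1) order.refl] order.refl]]) simp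
  moreover have "R' 2 = R 2 + Suc d" "\<forall>q. q \<noteq> 0 \<and> q \<noteq> 2 \<and> q \<noteq> 4 \<longrightarrow> R' q = R q"
    using R'(2,3) by (auto simp: R1_def)
  ultimately show ?case by blast
qed

text \<open>The target \<open>256 * r\<close> lies above every word that is still to be moved and
  below the parked words, which start at \<open>512 * L\<close>. Each round executes 18
  instructions.\<close>

lemma boot_move_correct:
  assumes code: "code_at P 34 [Const 5 6, Sub 5 4 5]" "code_at P 36 [Jz 5 52]"
    "code_at P 37 boot_move" "code_at P 51 [Jz 5 34]"
    and "L > 0" and "R 1 = 1" "R 2 = L" "R 4 = r" "r \<le> L"
    and "\<forall>i<6. R (512 * L + i) = X (Suc i)" "\<forall>j. 7 \<le> j \<and> j \<le> r \<longrightarrow> R j = X j"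
    and "\<forall>j. 7 \<le> j \<and> r < j \<and> j \<le> L \<longrightarrow> R (256 * j) = X j"
  shows "\<exists>R'. steps P (3 + r * 18) (34, R) (52, R') \<and> R' 1 = 1 \<and> R' 2 = L \<and>
    (\<forall>i<6. R' (512 * L + i) = X (Suc i)) \<and> (\<forall>j. 7 \<le> j \<and> j \<le> L \<longrightarrow> R' (256 * j) = X j)"
  using assms(6-)
proof (induction r arbitrary: R rule: less_induct)
  case (less r)
  define R1 where "R1 = R(5 := r - 6)"
  have 1: "steps P 2 (34, R) (36, R1)"
    by (rule steps_straight[OF _ code(1)]) (use less in \<open>simp_all add: R1_def\<close>)
  show ?case
  proof (cases "r \<le> 6")
    case True
    have 2: "steps P 1 (36, R1) (52, R1)"
      by (rule steps_jump[OF code(2)]) (use True in \<open>simp add: R1_def\<close>)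
    have "steps P (3 + r * 18) (34, R) (52, R1)"
      by (rule steps_trans[OF 1 2]) simp
    moreover have "\<forall>i<6. R1 (512 * L + i) = X (Suc i)"
      using less.prems(5) \<open>L > 0\<close> by (simp add: R1_def)
    moreover have "R1 1 = 1" "R1 2 = L" "\<forall>j. 7 \<le> j \<and> j \<le> L \<longrightarrow> R1 (256 * j) = X j"
      using less.prems True by (auto simp: R1_def)
    ultimately show ?thesis by blast
  next
    case False
    have 2: "steps P 1 (36, R1) (37, R1)"
      by (rule steps_jump[OF code(2)]) (use False in \<open>simp add: R1_def\<close>)
    define R2 where "R2 = R1(5 := 0, 6 := 256 * r, 256 * r := X r, 4 := r - 1)"
    have Rr: "R r = X r" using less.prems False by auto
    have 3: "steps P 14 (37, R1) (51, R2)"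
      by (rule steps_straight[OF _ code(3)])
        (use less.prems False Rr in \<open>auto simp: R1_def R2_def boot_move_def fun_eq_iff\<close>)
    have 4: "steps P 1 (51, R2) (34, R2)"
      by (rule steps_jump[OF code(4)]) (use False in \<open>simp add: R2_def\<close>)
    have "\<exists>R'. steps P (3 + (r - 1) * 18) (34, R2) (52, R') \<and> R' 1 = 1 \<and> R' 2 = L \<and>
      (\<forall>i<6. R' (512 * L + i) = X (Suc i)) \<and> (\<forall>j. 7 \<le> j \<and> j \<le> L \<longrightarrow> R' (256 * j) = X j)"
    proof (rule less.IH)
      show "\<forall>i<6. R2 (512 * L + i) = X (Suc i)"
      proof (intro allI impI)
        fix i :: nat assume "i < 6"
        moreover have "512 * L + i \<noteq> 256 * r" "512 * L + i > 6" using False less.prems by auto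
        ultimately show "R2 (512 * L + i) = X (Suc i)"
          using less.prems(5) by (simp add: R2_def R1_def)
      qed
      show "\<forall>j. 7 \<le> j \<and> r - 1 < j \<and> j \<le> L \<longrightarrow> R2 (256 * j) = X j"
      proof (intro allI impI)
        fix j :: nat assume j: "7 \<le> j \<and> r - 1 < j \<and> j \<le> L"
        show "R2 (256 * j) = X j"
        proof (cases "j = r")
          case True
          then show ?thesis using False by (simp add: R2_def)
        next
          case False
          then have "r < j" "256 * j \<noteq> 256 * r" "256 * j > 6" using j by auto
          then show ?thesis using less.prems(7) j by (simp add: R2_def R1_def)
        qed
      qed
    qed (use less.prems False in \<open>auto simp: R1_def R2_def\<close>)
    then obtain R' where R': "steps P (3 + (r - 1) * 18) (34, R2) (52, R')" "R' 1 = 1" "R' 2 = L"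
      "\<forall>i<6. R' (512 * L + i) = X (Suc i)" "\<forall>j. 7 \<le> j \<and> j \<le> L \<longrightarrow> R' (256 * j) = X j"
      by blast
    have "steps P (3 + r * 18) (34, R) (52, R')"
      by (rule steps_trans[OF 1 steps_trans[OF 2 steps_trans[OF 3 steps_trans[OF 4 R'(1)
          order.refl] order.refl] order.refl]]) (use False in simp)
    with R' show ?thesis by blast
  qed
qed

lemma boot_fetch_word_correct:
  assumes "code_at P pc (concat (map boot_fetch_word [k..<6]))" "k \<le> 6" "pc' = pc + 4 * (6 - k)"
    and "R 1 = 1" "R 2 = L" "R 3 = 512 * L + k" "L > 0"
    and "\<forall>i. k \<le> i \<and> i < 6 \<longrightarrow> R (512 * L + i) = X (Suc i)"
    and "\<forall>j. 1 \<le> j \<and> j \<le> L \<and> (j \<le> k \<or> 7 \<le> j) \<longrightarrow> R (256 * j) = X j"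
  shows "\<exists>R'. steps P (4 * (6 - k)) (pc, R) (pc', R') \<and> R' 2 = L \<and>
    (\<forall>j. 1 \<le> j \<and> j \<le> L \<longrightarrow> R' (256 * j) = X j)"
  using assms
proof (induction "6 - k" arbitrary: k R pc)
  case 0
  then have "\<forall>j. 1 \<le> j \<and> j \<le> L \<longrightarrow> R (256 * j) = X j" by auto
  then show ?case using 0 by (intro exI[of _ R]) (auto intro: steps_refl)
next
  case (Suc d)
  have k: "k < 6" using Suc.hyps(2) by simp
  have code: "code_at P pc (boot_fetch_word k)"
    "code_at P (pc + 4) (concat (map boot_fetch_word [Suc k..<6]))"
    using Suc.prems(1) unfolding upt_conv_Cons[OF k] list.map concat.simps code_at_append by simp_all
  define R1 where "R1 = R(5 := X (Suc k), 6 := 256 * Suc k, 256 * Suc k := X (Suc k),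
    3 := 512 * L + Suc k)"
  have Rk: "R (512 * L + k) = X (Suc k)" using Suc.prems k by auto
  have 1: "steps P 4 (pc, R) (pc + 4, R1)"
    by (rule steps_straight[OF _ code(1)])
      (use Suc.prems(4-7) Rk in \<open>simp_all add: R1_def boot_fetch_word_def fun_eq_iff\<close>)
  have "\<exists>R'. steps P (4 * (6 - Suc k)) (pc + 4, R1) (pc', R') \<and> R' 2 = L \<and>
    (\<forall>j. 1 \<le> j \<and> j \<le> L \<longrightarrow> R' (256 * j) = X j)"
  proof (rule Suc.hyps(1)[OF _ code(2)])
    show "\<forall>i. Suc k \<le> i \<and> i < 6 \<longrightarrow> R1 (512 * L + i) = X (Suc i)"
    proof (intro allI impI)
      fix i assume i: "Suc k \<le> i \<and> i < 6"
      \<comment> \<open>The two sides could agree modulo 256 only for \<open>i = 0\<close>, but the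
        words that are still parked have \<open>i \<ge> Suc k\<close>.\<close>
      have "512 * L + i \<noteq> 256 * Suc k"
      proof
        assume "512 * L + i = 256 * Suc k"
        then have "i = 256 * (Suc k - 2 * L)" by (simp add: diff_mult_distrib2)
        then show False using i by (cases "Suc k - 2 * L") auto
      qed
      moreover have "512 * L + i > 6" using Suc.prems by auto
      ultimately show "R1 (512 * L + i) = X (Suc i)" using Suc.prems(8) i by (simp add: R1_def)
    qed
    show "\<forall>j. 1 \<le> j \<and> j \<le> L \<and> (j \<le> Suc k \<or> 7 \<le> j) \<longrightarrow> R1 (256 * j) = X j"
    proof (intro allI impI)
      fix j assume j: "1 \<le> j \<and> j \<le> L \<and> (j \<le> Suc k \<or> 7 \<le> j)"
      show "R1 (256 * j) = X j"
      proof (cases "j = Suc k")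
        case True
        then show ?thesis by (simp add: R1_def)
      next
        case False
        then have "256 * j \<noteq> 256 * Suc k" "256 * j > 6" "j \<le> k \<or> 7 \<le> j" using j by auto
        then show ?thesis using Suc.prems(9) j False by (simp add: R1_def)
      qed
    qed
  qed (use Suc.prems(3-7) Suc.hyps(2) k in \<open>auto simp: R1_def\<close>)
  then obtain R' where R': "steps P (4 * (6 - Suc k)) (pc + 4, R1) (pc', R')" "R' 2 = L"
    "\<forall>j. 1 \<le> j \<and> j \<le> L \<longrightarrow> R' (256 * j) = X j" by blast
  have "steps P (4 * (6 - k)) (pc, R) (pc', R')"
    by (rule steps_trans[OF 1 R'(1)]) (use k in simp)
  then show ?case using R' by blast
qed

text \<open>Apart from the length and the input itself the initial store is arbitrary.\<close>

definition input_store :: "nat list \<Rightarrow> store \<Rightarrow> bool" where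
  "input_store xs s \<longleftrightarrow> fst s 2 = length xs \<and> (\<forall>j<length xs. snd s 0 j = xs ! j)"

lemma boot_correct:
  assumes "xs \<noteq> []" "P = boot l @ C"
  shows "\<exists>R s. steps P (81 + 23 * length xs) (init xs) (87, R) \<and> matches s R \<and> input_store xs s"
proof -
  let ?L = "length xs"
  define R where "R = snd (init xs)"
  have R: "init xs = (0, R)" "R 0 = ?L" "\<And>j. 1 \<le> j \<Longrightarrow> j \<le> ?L \<Longrightarrow> R j = xs ! (j - 1)"
    by (simp_all add: R_def init_def)
  have L: "?L > 0" using assms by simp
  have "code_at P 0 (boot l)" using assms(2) unfolding code_at_def by auto
  then have code: "code_at P 0 [Jz 0 l]" "code_at P 1 boot_save" "code_at P 27 [Jz 0 32]"
    "code_at P 28 [Sub 0 0 3, Add 2 2 1, Const 4 0]" "code_at P 31 [Jz 4 27]"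
    "code_at P 32 [Const 4 0, Add 4 4 2]"
    "code_at P 34 [Const 5 6, Sub 5 4 5]" "code_at P 36 [Jz 5 52]" "code_at P 37 boot_move"
    "code_at P 51 [Jz 5 34]" "code_at P 52 boot_fetch"
    "code_at P 63 (concat (map boot_fetch_word [0..<6]))"
  proof -
    assume "code_at P 0 (boot l)"
    then show "code_at P 0 [Jz 0 l]" "code_at P 1 boot_save" "code_at P 27 [Jz 0 32]"
      "code_at P 28 [Sub 0 0 3, Add 2 2 1, Const 4 0]" "code_at P 31 [Jz 4 27]"
      "code_at P 32 [Const 4 0, Add 4 4 2]"
      "code_at P 34 [Const 5 6, Sub 5 4 5]" "code_at P 36 [Jz 5 52]" "code_at P 37 boot_move"
      "code_at P 51 [Jz 5 34]" "code_at P 52 boot_fetch"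
      "code_at P 63 (concat (map boot_fetch_word [0..<6]))"
      unfolding boot_def code_at_append by (simp_all del: upt.simps upt_rec_numeral)
  qed
  have 0: "steps P 1 (0, R) (1, R)" by (rule steps_jump[OF code(1)]) (use R L in simp)
  obtain R1 where R1: "straight boot_save R = Some R1" "R1 0 = 512 * ?L" "R1 1 = 1" "R1 2 = 0"
    "R1 3 = 512" "\<forall>i<6. R1 (512 * ?L + i) = R (Suc i)" "\<forall>j. 7 \<le> j \<and> j \<le> ?L \<longrightarrow> R1 j = R j"
    using boot_save_correct[of R, OF R(2) L] by blast
  have 1: "steps P 26 (1, R) (27, R1)"
    by (rule steps_straight[OF R1(1) code(2)]) (simp_all add: boot_save_def)
  obtain R2 where R2: "steps P (Suc (?L * 5)) (27, R1) (32, R2)" "R2 2 = R1 2 + ?L"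
    "\<forall>q. q \<noteq> 0 \<and> q \<noteq> 2 \<and> q \<noteq> 4 \<longrightarrow> R2 q = R1 q"
    using boot_count_correct[OF code(3-5) R1(3,5,2)] by blast
  define R3 where "R3 = R2(4 := ?L)"
  have 3: "steps P 2 (32, R2) (34, R3)"
    by (rule steps_straight[OF _ code(6)]) (use R2 R1 in \<open>simp_all add: R3_def\<close>)
  have "\<exists>R'. steps P (3 + ?L * 18) (34, R3) (52, R') \<and> R' 1 = 1 \<and> R' 2 = ?L \<and>
    (\<forall>i<6. R' (512 * ?L + i) = R (Suc i)) \<and> (\<forall>j. 7 \<le> j \<and> j \<le> ?L \<longrightarrow> R' (256 * j) = R j)"
  proof (rule boot_move_correct[OF code(7-10) L])
    show "\<forall>i<6. R3 (512 * ?L + i) = R (Suc i)"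
    proof (intro allI impI)
      fix i :: nat assume "i < 6"
      moreover have far: "512 * ?L + i > 6" using L by linarith
      then have "R2 (512 * ?L + i) = R1 (512 * ?L + i)" 
        by (intro R2(3)[rule_format] conjI; linarith)
      ultimately show "R3 (512 * ?L + i) = R (Suc i)"
        using R1(6) far by (simp add: R3_def)
    qed
  qed (use R1 R2 L in \<open>auto simp: R3_def\<close>)
  then obtain R4 where R4: "steps P (3 + ?L * 18) (34, R3) (52, R4)" "R4 1 = 1" "R4 2 = ?L"
    "\<forall>i<6. R4 (512 * ?L + i) = R (Suc i)" "\<forall>j. 7 \<le> j \<and> j \<le> ?L \<longrightarrow> R4 (256 * j) = R j"
    by blast
  define R5 where "R5 = R4(3 := 512 * ?L)"
  have 5: "steps P 11 (52, R4) (63, R5)"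
    by (rule steps_straight[OF _ code(11)])
      (use R4(3) in \<open>simp_all add: R5_def boot_fetch_def\<close>)
  have "\<exists>R'. steps P (4 * (6 - 0)) (63, R5) (87, R') \<and> R' 2 = ?L \<and>
    (\<forall>j. 1 \<le> j \<and> j \<le> ?L \<longrightarrow> R' (256 * j) = R j)"
  proof (rule boot_fetch_word_correct[OF code(12)])
    show "\<forall>i. 0 \<le> i \<and> i < 6 \<longrightarrow> R5 (512 * ?L + i) = R (Suc i)"
    proof (intro allI impI)
      fix i :: nat assume "0 \<le> i \<and> i < 6"
      moreover have "512 * ?L + i > 6" using L by linarith
      ultimately show "R5 (512 * ?L + i) = R (Suc i)" using R4(4) by (simp add: R5_def)
    qed
  qed (use R4 L in \<open>auto simp: R5_def\<close>)
  then obtain R6 where R6: "steps P 24 (63, R5) (87, R6)" "R6 2 = ?L"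
    "\<forall>j. 1 \<le> j \<and> j \<le> ?L \<longrightarrow> R6 (256 * j) = R j" by auto
  have "steps P (81 + 23 * ?L) (0, R) (87, R6)"
    by (rule steps_trans[OF 0 steps_trans[OF 1 steps_trans[OF R2(1) steps_trans[OF 3
        steps_trans[OF R4(1) steps_trans[OF 5 R6(1) order.refl] order.refl] order.refl]
        order.refl] order.refl]]) simp
  \<comment> \<open>Every register content represents the store read off from it. Of that store only
    the length and the input array are known.\<close>
  moreover define s where "s = (R6, \<lambda>a j. R6 (256 * (j + 1) + a))"
  have "matches s R6" by (simp add: matches_def s_def)
  moreover have "input_store xs s"
  proof -
    have "R6 (256 * (j + 1)) = xs ! j" if "j < ?L" for j
      using R6(3) R(3)[of "j + 1"] that by (simp del: mult_Suc_right)
    then show ?thesis using R6(2) by (simp add: input_store_def s_def)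
  qed
  ultimately show ?thesis unfolding R(1) by blast
qed

section \<open>From commands to decision procedures and computable functions\<close>

lemma decides_intro:
  assumes fits: "fits_com c 64" and empty: "[] \<notin> A"
    and correct: "\<And>xs s. xs \<noteq> [] \<Longrightarrow> input_store xs s \<Longrightarrow>
      ok_com (B xs) c s \<and> fst (ex c s) 0 = (if xs \<in> A then 1 else 0)"
    and time: "\<And>xs. 81 + 23 * length xs + time_com (B xs) c \<le> T xs" and "\<And>xs. T xs \<ge> 1"
  shows "\<exists>P. decides_in_time P A T"
proof -
  define C where "C = comp_com c 64 87"
  define P where "P = boot (87 + length C) @ C"
  have lenP: "length P = 87 + length C" by (simp add: P_def length_boot)
  have "\<exists>t\<le>T xs. halts_with P xs t (if xs \<in> A then 1 else 0)" for xs
  proof (cases "xs = []")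
    \<comment> \<open>On empty input the first instruction jumps behind the code. Register 0 holds
      the length 0, which is also the right answer.\<close>
    case True
    have "run P 1 xs = (length P, snd (init xs))"
      using True by (simp add: run_def init_def step_def P_def boot_def length_boot)
    then have "halts_with P xs 1 0" by (simp add: halts_with_def halted_def init_def True)
    then show ?thesis using True empty assms(5)[of xs] by auto
  next
    case False
    obtain R s where R: "steps P (81 + 23 * length xs) (init xs) (87, R)" "matches s R"
      "input_store xs s" using boot_correct[OF False P_def] by blast
    have "code_at P 87 (comp_com c 64 87)"
      unfolding code_at_def P_def C_def using length_boot by (metis append_Nil2)
    from comp_com_correct[OF this fits _ R(2)] correct[OF False R(3)] obtain R' where
      R': "steps P (time_com (B xs) c) (87, R) (length P, R')" "matches (ex c s) R'"
      unfolding lenP C_def by (metis order.refl)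
    have "steps P (T xs) (init xs) (length P, R')"
      by (rule steps_trans[OF R(1) R'(1) time])
    then obtain t where "t \<le> T xs" "run P t xs = (length P, R')"
      unfolding steps_def run_def by blast
    moreover have "R' 0 = (if xs \<in> A then 1 else 0)"
      using correct[OF False R(3)] R'(2) by (simp add: matches_var)
    ultimately show ?thesis by (auto simp: halts_with_def halted_def)
  qed
  then show ?thesis unfolding decides_in_time_def by blast
qed

text \<open>For a one-word input register 1 already is variable 1, so the command can run without
  the boot code. Computability asks for no time bound, so \<open>B\<close> may depend on
  \<open>x\<close>.\<close>

lemma computable_intro:
  assumes fits: "fits_com c 64"
    and correct: "\<And>x s. fst s 0 = 1 \<Longrightarrow> fst s 1 = x \<Longrightarrow>
      (\<exists>B. ok_com B c s) \<and> fst (ex c s) 0 = f x"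
  shows "computable f"
proof -
  define P where "P = comp_com c 64 0"
  have "\<exists>t. halts_with P [x] t (f x)" for x
  proof -
    define R where "R = snd (init [x])"
    define s where "s = (R, \<lambda>a j. R (256 * (j + 1) + a))"
    have s: "fst s 0 = 1" "fst s 1 = x" by (simp_all add: s_def R_def init_def)
    obtain B where B: "ok_com B c s" "fst (ex c s) 0 = f x" using correct[OF s] by blast
    have "matches s R" by (simp add: matches_def s_def)
    moreover have "code_at P 0 (comp_com c 64 0)" by (auto simp: code_at_def P_def)
    ultimately obtain R' where
      R': "steps P (time_com B c) (0, R) (length P, R')" "matches (ex c s) R'"
      using comp_com_correct[OF _ fits, of P 0 s R B] B by (auto simp: P_def)
    then obtain t where "run P t [x] = (length P, R')"
      unfolding steps_def run_def by (auto simp: R_def init_def)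
    moreover have "R' 0 = f x" using B R' by (simp add: matches_var)
    ultimately have "halts_with P [x] t (f x)" by (simp add: halts_with_def halted_def)
    then show ?thesis by blast
  qed
  then show ?thesis unfolding computable_def by blast
qed

subsection \<open>The dynamic program\<close>

definition dig :: "nat \<Rightarrow> nat \<Rightarrow> nat \<Rightarrow> nat" where
  "dig b x i = x div b ^ i mod b"

text \<open>The new leading digit adds \<open>f n * b ^ n\<close>, a multiple of
  \<open>b ^ Suc i\<close> for every lower position \<open>i\<close>, and so leaves the lower digits
  alone.\<close>

lemma ex_digits:
  assumes "\<And>i. i < n \<Longrightarrow> f i < b"
  shows "\<exists>x<b ^ n. \<forall>i<n. dig b x i = f i"
  using assms
proof (induction n)
  case 0
  then show ?case by simp
next
  case (Suc n)
  then obtain x where x: "x < b ^ n" "\<forall>i<n. dig b x i = f i" by force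
  define y where "y = x + f n * b ^ n"
  have b: "b > 0" using Suc.prems[of n] by (cases b) auto
  have "y < (1 + f n) * b ^ n" using x by (simp add: y_def)
  also have "\<dots> \<le> b * b ^ n" using Suc.prems[of n] by (intro mult_le_mono) auto
  finally have "y < b ^ Suc n" by simp
  moreover have "dig b y i = f i" if "i < Suc n" for i
  proof (cases "i = n")
    case True
    then show ?thesis using x b Suc.prems[of n] by (simp add: dig_def y_def)
  next
    case False
    with that have i: "i < n" by simp
    then have "b ^ n = b ^ i * (b * b ^ (n - Suc i))"
      by (metis power_Suc power_add Suc_diff_Suc le_add_diff_inverse less_imp_le)
    then have "y = x + (f n * b ^ (n - Suc i) * b) * b ^ i" by (simp add: y_def ac_simps)
    then have "y div b ^ i = f n * b ^ (n - Suc i) * b + x div b ^ i" using b by simp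
    then have "dig b y i = dig b x i" by (simp add: dig_def)
    then show ?thesis using x i by simp
  qed
  ultimately show ?case by blast
qed

text \<open>The vertex cover has \<open>c\<close> vertices, and \<open>cix v\<close> is one plus the index of \<open>v\<close> in it, or 0.
  A state is a number whose digits in base \<open>c + 1\<close> encode a guessed partition \<open>part\<close> of the cover
  (the components of the final forest), the current partition \<open>label\<close> (the components of the edges chosen
  so far), the cover vertices joined to the last processed vertex, and the part into which the
  demands of the current group go.\<close>

definition part :: "nat \<Rightarrow> nat \<Rightarrow> nat \<Rightarrow> nat" where
  "part c x i = dig (c + 1) x i"

definition label :: "nat \<Rightarrow> nat \<Rightarrow> nat \<Rightarrow> nat" where
  "label c x i = dig (c + 1) x (c + i)"

definition joined :: "nat \<Rightarrow> nat \<Rightarrow> nat \<Rightarrow> bool" where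
  "joined c x i \<longleftrightarrow> dig (c + 1) x (2 * c + i) \<noteq> 0"

definition goal :: "nat \<Rightarrow> nat \<Rightarrow> nat" where
  "goal c x = dig (c + 1) x (3 * c)"

definition num_states :: "nat \<Rightarrow> nat" where
  "num_states c = (c + 1) ^ (3 * c + 1)"

text \<open>States are plain numbers. Completeness of the search needs every combination of
  components to be encoded by some number below \<open>num_states c\<close>.\<close>

lemma ex_state:
  assumes "\<And>i. i < c \<Longrightarrow> f i < c" "\<And>i. i < c \<Longrightarrow> g i < c" "p \<le> c"
  shows "\<exists>x<num_states c. (\<forall>i<c. part c x i = f i \<and> label c x i = g i \<and> (joined c x i \<longleftrightarrow> J i)) \<and>
    goal c x = p"
proof -
  define h where "h i = (if i < c then f i else if i < 2 * c then g (i - c)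
    else if i < 3 * c then of_bool (J (i - 2 * c)) else p)" for i
  have h: "h i < c + 1" if "i < 3 * c + 1" for i
  proof -
    consider "i < c" | "c \<le> i" "i < 2 * c" | "2 * c \<le> i" "i < 3 * c" | "i = 3 * c"
      using \<open>i < 3 * c + 1\<close> by linarith
    then show ?thesis
    proof cases
      case 1
      then show ?thesis using assms(1)[of i] by (simp add: h_def)
    next
      case 2
      then have "i - c < c" by simp
      then show ?thesis using 2 assms(2)[of "i - c"] by (simp add: h_def)
    next
      case 3
      then have "c > 0" by simp
      then show ?thesis using 3 by (simp add: h_def)
    next
      case 4
      then show ?thesis using assms(3) by (simp add: h_def)
    qed
  qed
  obtain x where
    x: "x < (c + 1) ^ (3 * c + 1)" "\<forall>i<3 * c + 1. dig (c + 1) x i = h i"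
    using ex_digits[of "3 * c + 1" h "c + 1"] h by blast
  have "part c x i = f i" "label c x i = g i" "joined c x i \<longleftrightarrow> J i" if "i < c" for i
  proof -
    have "dig (c + 1) x i = h i" "dig (c + 1) x (c + i) = h (c + i)"
      "dig (c + 1) x (2 * c + i) = h (2 * c + i)"
      using that by (intro x(2)[rule_format]; linarith)+
    moreover have "h i = f i" "h (c + i) = g i" "h (2 * c + i) = of_bool (J i)"
      using that by (simp_all add: h_def)
    ultimately show "part c x i = f i" "label c x i = g i" "joined c x i \<longleftrightarrow> J i"
      by (simp_all add: part_def label_def joined_def)
  qed
  moreover have "goal c x = p" using x(2) by (simp add: goal_def h_def)
  ultimately show ?thesis using x(1) by (auto simp: num_states_def)
qed

text \<open>A cover vertex counts as attached to itself, without an edge and hence without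
  cost.\<close>

definition attached :: "nat \<Rightarrow> (nat \<Rightarrow> nat) \<Rightarrow> nat \<Rightarrow> nat \<Rightarrow> nat \<Rightarrow> bool" where
  "attached c cix v y i \<longleftrightarrow> joined c y i \<or> cix v = Suc i"

definition touched :: "nat \<Rightarrow> (nat \<Rightarrow> nat) \<Rightarrow> nat \<Rightarrow> nat \<Rightarrow> nat \<Rightarrow> nat \<Rightarrow> bool" where
  "touched c cix v x y i \<longleftrightarrow> (\<exists>l<c. attached c cix v y l \<and> label c x l = label c x i)"

text \<open>Labels are constrained in one direction only: classes may merge if the new vertex
  touches both. A state may claim less connectivity than its edges provide but never more, which is
  what soundness relies on. The guess \<open>part\<close> is copied along, and \<open>goal\<close>
  can change only at the first vertex of a group.\<close>

definition trans_ok :: "nat \<Rightarrow> (nat \<Rightarrow> nat) \<Rightarrow> (nat \<Rightarrow> nat \<Rightarrow> bool) \<Rightarrow> (nat \<Rightarrow> bool) \<Rightarrow>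
    nat \<Rightarrow> bool \<Rightarrow> nat \<Rightarrow> nat \<Rightarrow> bool" where
  "trans_ok c cix adj act v first x y \<longleftrightarrow>
     (\<forall>i<c. part c y i = part c x i) \<and>
     (first \<or> goal c y = goal c x) \<and>
     (\<forall>i<c. joined c y i \<longrightarrow> adj v i) \<and>
     (act v \<longrightarrow> (\<exists>i<c. attached c cix v y i \<and> part c y i = goal c y)) \<and>
     (\<forall>i<c. \<forall>j<c. label c y i = label c y j \<longrightarrow>
        label c x i = label c x j \<or> touched c cix v x y i \<and> touched c cix v x y j)"

definition cost :: "nat \<Rightarrow> nat \<Rightarrow> nat" where
  "cost c y = card {i. i < c \<and> joined c y i}"

definition start :: "nat \<Rightarrow> nat \<Rightarrow> bool" where
  "start c x \<longleftrightarrow> (\<forall>i<c. label c x i = i)"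

text \<open>Here the guess is redeemed: cover vertices put into one part must have become connected.
  Different parts may be connected as well, which harms no demand.\<close>

definition final :: "nat \<Rightarrow> nat \<Rightarrow> bool" where
  "final c x \<longleftrightarrow> (\<forall>i<c. \<forall>j<c. part c x i = part c x j \<longrightarrow> label c x i = label c x j)"

text \<open>The vertices are processed from the end of the list to its head.\<close>

fun reach :: "nat \<Rightarrow> (nat \<Rightarrow> nat) \<Rightarrow> (nat \<Rightarrow> nat \<Rightarrow> bool) \<Rightarrow> (nat \<Rightarrow> bool) \<Rightarrow> (nat \<Rightarrow> nat) \<Rightarrow>
    nat list \<Rightarrow> nat \<Rightarrow> nat \<Rightarrow> bool" where
  "reach c cix adj act grp [] y q \<longleftrightarrow> start c y"
| "reach c cix adj act grp (v # vs) y q \<longleftrightarrow>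
     (\<exists>x<num_states c. \<exists>q'. reach c cix adj act grp vs x q' \<and>
        trans_ok c cix adj act v (grp v \<notin> grp ` set vs) x y \<and> q' + cost c y \<le> q)"

text \<open>A group that occurred before must be the group processed last. Hence groups are
  contiguous, and the single \<open>goal\<close> of a state always refers to the current
  group.\<close>

fun grouped :: "(nat \<Rightarrow> nat) \<Rightarrow> nat list \<Rightarrow> bool" where
  "grouped grp [] = True"
| "grouped grp (v # vs) \<longleftrightarrow> grouped grp vs \<and> (grp v \<in> grp ` set vs \<longrightarrow> grp v = grp (hd vs))"

definition decide :: "nat \<Rightarrow> (nat \<Rightarrow> nat) \<Rightarrow> (nat \<Rightarrow> nat \<Rightarrow> bool) \<Rightarrow> (nat \<Rightarrow> bool) \<Rightarrow> (nat \<Rightarrow> nat) \<Rightarrow>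
    nat list \<Rightarrow> nat \<Rightarrow> bool" where
  "decide c cix adj act grp vs k \<longleftrightarrow>
     (\<exists>x<num_states c. final c x \<and> reach c cix adj act grp vs x k)"

section \<open>Connectivity and the abstract instance\<close>

lemma connected_in_refl [simp]: "connected_in F u u"
  by (simp add: connected_in_def)

lemma connected_in_edge: "{u, v} \<in> F \<Longrightarrow> connected_in F u v"
  by (auto simp: connected_in_def)

lemma connected_in_trans: "connected_in F u v \<Longrightarrow> connected_in F v w \<Longrightarrow> connected_in F u w"
  by (auto simp: connected_in_def)

lemma connected_in_sym: "connected_in F u v \<Longrightarrow> connected_in F v u"
proof -
  have "sym {(u, v). {u, v} \<in> F}" by (auto simp: sym_def insert_commute)
  then have "sym ({(u, v). {u, v} \<in> F}\<^sup>*)" by (rule sym_rtrancl)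
  then show "connected_in F u v \<Longrightarrow> connected_in F v u" by (auto simp: connected_in_def sym_def)
qed

lemma connected_in_mono: "connected_in F u v \<Longrightarrow> F \<subseteq> F' \<Longrightarrow> connected_in F' u v"
proof -
  assume "F \<subseteq> F'"
  then have "{(u, v). {u, v} \<in> F}\<^sup>* \<subseteq> {(u, v). {u, v} \<in> F'}\<^sup>*" by (intro rtrancl_mono) auto
  then show "connected_in F u v \<Longrightarrow> connected_in F' u v" by (auto simp: connected_in_def)
qed

text \<open>The interface between the combinatorics and the program. \<open>V\<close> is any finite
  set with all endpoints and terminals, so that the input words can be used. Pairs with equal
  terminals demand nothing and make no vertex active.\<close>

locale covered_instance =
  fixes E :: "nat set set" and S :: "(nat \<times> nat) set" and V :: "nat set" and c :: nat
    and cix cov grp :: "nat \<Rightarrow> nat" and adj :: "nat \<Rightarrow> nat \<Rightarrow> bool" and act :: "nat \<Rightarrow> bool"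
  assumes fin_V: "finite V"
    and edges: "\<And>e. e \<in> E \<Longrightarrow> \<exists>u v. e = {u, v} \<and> u \<noteq> v \<and> u \<in> V \<and> v \<in> V"
    and covered: "\<And>u v. {u, v} \<in> E \<Longrightarrow> cix u \<noteq> 0 \<or> cix v \<noteq> 0"
    and cix_le: "\<And>v. v \<in> V \<Longrightarrow> cix v \<le> c"
    and cov: "\<And>i. i < c \<Longrightarrow> cov i \<in> V \<and> cix (cov i) = Suc i"
    and cov_cix: "\<And>v i. v \<in> V \<Longrightarrow> cix v = Suc i \<Longrightarrow> cov i = v"
    and terminals: "\<And>s t. (s, t) \<in> S \<Longrightarrow> s \<in> V \<and> t \<in> V"
    and act: "\<And>v. v \<in> V \<Longrightarrow> act v \<longleftrightarrow> (\<exists>(s, t)\<in>S. s \<noteq> t \<and> (v = s \<or> v = t))"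
    and grp_S: "\<And>s t. (s, t) \<in> S \<Longrightarrow> grp s = grp t"
    and grp_eq: "\<And>u v. u \<in> V \<Longrightarrow> v \<in> V \<Longrightarrow> grp u = grp v \<Longrightarrow> (u, v) \<in> (S \<union> S\<inverse>)\<^sup>*"
    and adj: "\<And>v i. v \<in> V \<Longrightarrow> i < c \<Longrightarrow> adj v i \<longleftrightarrow> {v, cov i} \<in> E"
begin

lemma fin_E: "finite E"
proof (rule finite_subset)
  show "E \<subseteq> Pow V" by (auto dest!: edges)
qed (use fin_V in simp)

section \<open>Soundness: an accepting run yields a Steiner forest\<close>

abbreviation reaches :: "nat list \<Rightarrow> nat \<Rightarrow> nat \<Rightarrow> bool" where
  "reaches \<equiv> reach c cix adj act grp"

text \<open>The forest is the union of the edges bought along the run. Equal labels certify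
  connections in it, and \<open>pg\<close> records the goal under which each group was processed; it
  is well defined because groups are contiguous.\<close>

lemma reach_sound:
  assumes "reaches vs y q" "set vs \<subseteq> V" "grouped grp vs"
  shows "\<exists>F\<subseteq>E. card F \<le> q \<and>
    (\<forall>i<c. \<forall>j<c. label c y i = label c y j \<longrightarrow> connected_in F (cov i) (cov j)) \<and>
    (\<exists>pg. (vs \<noteq> [] \<longrightarrow> pg (grp (hd vs)) = goal c y) \<and>
      (\<forall>v\<in>set vs. act v \<longrightarrow> (\<exists>i<c. connected_in F v (cov i) \<and> part c y i = pg (grp v))))"
  using assms
proof (induction vs arbitrary: y q)
  case Nil
  then show ?case by (intro exI[of _ "{}"]) (auto simp: start_def)
next
  case (Cons v vs)
  let ?first = "grp v \<notin> grp ` set vs"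
  obtain x q' where x: "reaches vs x q'" "q' + cost c y \<le> q"
    and tr: "trans_ok c cix adj act v ?first x y"
    using Cons.prems(1) by auto
  have v: "v \<in> V" "set vs \<subseteq> V" "grouped grp vs" using Cons.prems by auto
  from Cons.IH[OF x(1) v(2,3)] obtain F pg where F: "F \<subseteq> E" "card F \<le> q'"
    "\<And>i j. i < c \<Longrightarrow> j < c \<Longrightarrow> label c x i = label c x j \<Longrightarrow> connected_in F (cov i) (cov j)"
    and pg: "vs \<noteq> [] \<Longrightarrow> pg (grp (hd vs)) = goal c x"
    "\<And>v. v \<in> set vs \<Longrightarrow> act v \<Longrightarrow> \<exists>i<c. connected_in F v (cov i) \<and> part c x i = pg (grp v)"
    by blast
  define N where "N = {i. i < c \<and> joined c y i}"
  define F' where "F' = F \<union> (\<lambda>i. {v, cov i}) ` N"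
  have "{v, cov i} \<in> E" if "i \<in> N" for i
    using that tr adj[OF v(1)] by (simp add: N_def trans_ok_def)
  then have F'_E: "F' \<subseteq> E" using F(1) by (auto simp: F'_def)
  have card_F': "card F' \<le> q"
  proof -
    have "card F' \<le> card F + card ((\<lambda>i. {v, cov i}) ` N)" unfolding F'_def by (rule card_Un_le)
    moreover have "card ((\<lambda>i. {v, cov i}) ` N) \<le> card N" by (rule card_image_le) (simp add: N_def)
    moreover have "card N = cost c y" by (simp add: N_def cost_def)
    ultimately show ?thesis using F(2) x(2) by linarith
  qed
  have attached: "connected_in F' v (cov i)" if "i < c" "attached c cix v y i" for i
    using that cov_cix[OF v(1)]
    by (auto simp: attached_def F'_def N_def intro: connected_in_edge)
  have F_F': "connected_in F' u w" if "connected_in F u w" for u w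
    using connected_in_mono[OF that] by (simp add: F'_def)
  have touched: "connected_in F' v (cov i)" if "i < c" "touched c cix v x y i" for i
  proof -
    obtain l where l: "l < c" "attached c cix v y l" "label c x l = label c x i"
      using \<open>touched c cix v x y i\<close> by (auto simp: touched_def)
    show ?thesis
      by (rule connected_in_trans[OF attached[OF l(1,2)] F_F'[OF F(3)[OF l(1) \<open>i < c\<close> l(3)]]])
  qed
  have labels: "connected_in F' (cov i) (cov j)"
    if ij: "i < c" "j < c" "label c y i = label c y j" for i j
  proof (cases "label c x i = label c x j")
    case True
    then show ?thesis using F_F' F(3) ij by simp
  next
    case False
    then have "touched c cix v x y i" "touched c cix v x y j"
      using tr ij by (auto simp: trans_ok_def)
    then show ?thesis
      using connected_in_trans[OF connected_in_sym[OF touched[OF ij(1)]] touched[OF ij(2)]] by simp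
  qed
  define pg' where "pg' = pg(grp v := goal c y)"
  \<comment> \<open>If the group of \<open>v\<close> occurred before, it is the group of the
    previous vertex, whose goal the transition keeps. So the update changes nothing for earlier
    vertices.\<close>
  have pg': "pg' (grp w) = pg (grp w)" if "w \<in> set vs" for w
  proof (cases "grp w = grp v")
    case True
    with that have "\<not> ?first" by (metis imageI)
    then have "goal c y = goal c x" "grp v = grp (hd vs)" "vs \<noteq> []"
      using tr Cons.prems(3) by (auto simp: trans_ok_def)
    then show ?thesis using pg(1) True by (simp add: pg'_def)
  qed (simp add: pg'_def)
  have parts: "\<exists>i<c. connected_in F' w (cov i) \<and> part c y i = pg' (grp w)"
    if w: "w \<in> set (v # vs)" "act w" for w
  proof (cases "w \<in> set vs")
    case True
    then obtain i where i: "i < c" "connected_in F w (cov i)" "part c x i = pg (grp w)"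
      using pg(2)[of w] w(2) by blast
    then have "part c y i = pg' (grp w)" using tr pg'[OF True] by (simp add: trans_ok_def)
    then show ?thesis using F_F' i by blast
  next
    case False
    then have "w = v" using w by simp
    then obtain i where "i < c" "attached c cix v y i" "part c y i = goal c y"
      using w(2) tr by (auto simp: trans_ok_def)
    with \<open>w = v\<close> show ?thesis using attached by (auto simp: pg'_def)
  qed
  have "pg' (grp (hd (v # vs))) = goal c y" by (simp add: pg'_def)
  then have "\<exists>pg. (v # vs \<noteq> [] \<longrightarrow> pg (grp (hd (v # vs))) = goal c y) \<and>
      (\<forall>v\<in>set (v # vs). act v \<longrightarrow> (\<exists>i<c. connected_in F' v (cov i) \<and> part c y i = pg (grp v)))"
    using parts by (intro exI[of _ pg']) blast
  then show ?case using F'_E card_F' labels by (intro exI[of _ F'] conjI) auto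
qed

text \<open>Both terminals of a demand are connected to cover vertices in the part recorded for
  their common group, and \<open>final\<close> makes these cover vertices connected.\<close>

lemma decide_sound:
  assumes "decide c cix adj act grp vs k" "set vs = V" "grouped grp vs"
  shows "\<exists>F. steiner_forest E S F \<and> card F \<le> k"
proof -
  obtain x where x: "final c x" "reaches vs x k" using assms by (auto simp: decide_def)
  have "set vs \<subseteq> V" using assms(2) by simp
  from reach_sound[OF x(2) this assms(3)] obtain F pg where F: "F \<subseteq> E" "card F \<le> k"
    "\<And>i j. i < c \<Longrightarrow> j < c \<Longrightarrow> label c x i = label c x j \<Longrightarrow> connected_in F (cov i) (cov j)"
    "\<And>v. v \<in> V \<Longrightarrow> act v \<Longrightarrow> \<exists>i<c. connected_in F v (cov i) \<and> part c x i = pg (grp v)"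
    unfolding assms(2) by blast
  have "\<forall>(s, t)\<in>S. connected_in F s t"
  proof clarify
    fix s t assume st: "(s, t) \<in> S"
    show "connected_in F s t"
    proof (cases "s = t")
      case False
      have V: "s \<in> V" "t \<in> V" using terminals st by auto
      have "act s" "act t"
        using act[OF V(1)] act[OF V(2)] False by (auto intro!: bexI[OF _ st])
      obtain i where i: "i < c" "connected_in F s (cov i)" "part c x i = pg (grp s)"
        using F(4)[OF V(1) \<open>act s\<close>] by blast
      obtain j where j: "j < c" "connected_in F t (cov j)" "part c x j = pg (grp t)"
        using F(4)[OF V(2) \<open>act t\<close>] by blast
      have "part c x i = part c x j" using i(3) j(3) grp_S[OF st] by simp
      then have "label c x i = label c x j" using x(1) i(1) j(1) unfolding final_def by blast
      then show ?thesis
        using connected_in_trans[OF connected_in_trans[OF i(2) F(3)[OF i(1) j(1)]] connected_in_sym[OF j(2)]]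
        by simp
    qed simp
  qed
  then show ?thesis using F(1,2) by (auto simp: steiner_forest_def)
qed

section \<open>Completeness: a Steiner forest yields an accepting run\<close>

context
  fixes F :: "nat set set"
  assumes F: "steiner_forest E S F"
begin

text \<open>An edge inside the cover is charged to its larger endpoint, every other edge to its endpoint
  outside the cover.\<close>

definition star :: "nat \<Rightarrow> nat set" where
  "star v = {i. i < c \<and> {v, cov i} \<in> F \<and> (cix v = 0 \<or> cov i < v)}"

lemma F_E: "F \<subseteq> E" using F by (simp add: steiner_forest_def)

text \<open>No edge is charged twice: two charges could differ only by swapping the ends, both of
  which are then cover vertices, and the comparison in \<open>star\<close> excludes one
  orientation.\<close>

lemma sum_star_le: "distinct vs \<Longrightarrow> set vs \<subseteq> V \<Longrightarrow> (\<Sum>v\<leftarrow>vs. card (star v)) \<le> card F"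
proof -
  assume vs: "distinct vs" "set vs \<subseteq> V"
  have "(\<Sum>v\<leftarrow>vs. card (star v)) = (\<Sum>v\<in>set vs. card (star v))"
    using vs by (simp add: sum_list_distinct_conv_sum_set)
  also have "\<dots> = card (Sigma (set vs) star)" by (rule card_SigmaI[symmetric]) (simp_all add: star_def)
  also have "\<dots> = card ((\<lambda>(v, i). {v, cov i}) ` Sigma (set vs) star)"
  proof (rule card_image[symmetric], rule inj_onI, clarify)
    fix v i w j
    assume *: "v \<in> set vs" "i \<in> star v" "w \<in> set vs" "j \<in> star w" "{v, cov i} = {w, cov j}"
    have star: "i < c" "cix v = 0 \<or> cov i < v" "j < c" "cix w = 0 \<or> cov j < w"
      using *(2,4) by (simp_all add: star_def)
    have cov': "cix (cov i) = Suc i" "cix (cov j) = Suc j" using star cov by simp_all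
    show "v = w \<and> i = j"
    proof (cases "v = w")
      case True
      then have "cov i = cov j \<or> (w = cov j \<and> cov i = w)" using *(5) by (simp add: doubleton_eq_iff)
      then have "cov i = cov j" by (elim disjE conjE) (assumption, erule trans)
      then have "cix (cov i) = cix (cov j)" by (rule arg_cong)
      then show ?thesis using True unfolding cov' by simp
    next
      case False
      then have "v = cov j" "w = cov i" using *(5) by (simp_all add: doubleton_eq_iff)
      then show ?thesis using star cov' by simp
    qed
  qed
  also have "\<dots> \<le> card F"
  proof (rule card_mono)
    show "finite F" using F_E fin_E by (rule finite_subset)
    show "(\<lambda>(v, i). {v, cov i}) ` Sigma (set vs) star \<subseteq> F" by (auto simp: star_def)
  qed
  finally show ?thesis .
qed

text \<open>Connections among cover vertices through the stars of the processed vertices, by the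
  same recursion as the label condition of \<open>trans_ok\<close>; this makes the induction step of
  completeness direct. The comparison with connectivity in \<open>F\<close> waits until the list
  contains all vertices.\<close>

fun linked :: "nat list \<Rightarrow> nat \<Rightarrow> nat \<Rightarrow> bool" where
  "linked [] i j \<longleftrightarrow> i = j"
| "linked (v # vs) i j \<longleftrightarrow> linked vs i j \<or>
     (\<exists>l<c. (l \<in> star v \<or> cix v = Suc l) \<and> linked vs l i) \<and>
     (\<exists>l<c. (l \<in> star v \<or> cix v = Suc l) \<and> linked vs l j)"

lemma linked_refl [simp]: "linked vs i i"
  by (induction vs) auto

lemma linked_sym: "linked vs i j \<Longrightarrow> linked vs j i"
  by (induction vs arbitrary: i j) auto

lemma linked_trans: "linked vs i j \<Longrightarrow> linked vs j k \<Longrightarrow> linked vs i k"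
proof (induction vs arbitrary: i j k)
  case (Cons v vs)
  define T where "T a \<longleftrightarrow> (\<exists>l<c. (l \<in> star v \<or> cix v = Suc l) \<and> linked vs l a)" for a
  have linked: "linked (v # vs) a b \<longleftrightarrow> linked vs a b \<or> T a \<and> T b" for a b by (simp add: T_def)
  have T: "T a \<Longrightarrow> linked vs a b \<Longrightarrow> T b" for a b unfolding T_def using Cons.IH by blast
  show ?case
    using Cons.prems T[of j i] T[of j k] linked_sym[of vs i j] Cons.IH[of i j k]
    unfolding linked by blast
qed auto

text \<open>A class is named by its least member, which is at most \<open>i\<close> and therefore
  fits into a digit.\<close>

definition rep :: "nat list \<Rightarrow> nat \<Rightarrow> nat" where
  "rep vs i = (LEAST j. linked vs i j)"

lemma rep_le: "rep vs i \<le> i"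
  unfolding rep_def by (rule Least_le) simp

lemma linked_rep: "linked vs i (rep vs i)"
  unfolding rep_def by (rule LeastI[of _ i]) simp

lemma rep_eq_iff: "rep vs i = rep vs j \<longleftrightarrow> linked vs i j"
proof
  assume "rep vs i = rep vs j"
  then have "linked vs i (rep vs j)" using linked_rep[of vs i] by simp
  then show "linked vs i j" using linked_sym[OF linked_rep] by (rule linked_trans)
next
  assume "linked vs i j"
  then have "linked vs i l \<longleftrightarrow> linked vs j l" for l
    using linked_trans[of vs i j l] linked_trans[of vs j i l] linked_sym[of vs i j] by blast
  then show "rep vs i = rep vs j" by (simp add: rep_def)
qed

definition croot :: "nat \<Rightarrow> nat" where
  "croot i = (LEAST j. connected_in F (cov i) (cov j))"

lemma croot_le: "croot i \<le> i"
  unfolding croot_def by (rule Least_le) simp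

lemma croot_eq_iff: "croot i = croot j \<longleftrightarrow> connected_in F (cov i) (cov j)"
proof
  have *: "connected_in F (cov i) (cov (croot i))" for i
    unfolding croot_def by (rule LeastI[of _ i]) simp
  assume "croot i = croot j"
  then have "connected_in F (cov i) (cov (croot j))" using *[of i] by simp
  then show "connected_in F (cov i) (cov j)" using connected_in_sym[OF *] by (rule connected_in_trans)
next
  assume "connected_in F (cov i) (cov j)"
  then have "connected_in F (cov i) (cov l) \<longleftrightarrow> connected_in F (cov j) (cov l)" for l
    using connected_in_trans[of F "cov i" "cov j" "cov l"] connected_in_sym[of F "cov i" "cov j"]
      connected_in_trans[of F "cov j" "cov i" "cov l"] by blast
  then show "croot i = croot j" by (simp add: croot_def)
qed

text \<open>A component of the demand graph stays within one component of \<open>F\<close>;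
  therefore one part per group is enough.\<close>

lemma demand_connected: "(u, v) \<in> (S \<union> S\<inverse>)\<^sup>* \<Longrightarrow> connected_in F u v"
proof (induction rule: rtrancl_induct)
  case (step v w)
  then have "(v, w) \<in> S \<or> (w, v) \<in> S" by simp
  then have "connected_in F v w"
    using F connected_in_sym[of F w v] by (auto simp: steiner_forest_def)
  then show ?case using step.IH connected_in_trans by blast
qed simp

lemma cov_of:
  assumes "v \<in> V" "cix v \<noteq> 0"
  shows "\<exists>i<c. cix v = Suc i \<and> cov i = v"
proof -
  obtain i where "cix v = Suc i" using assms(2) by (cases "cix v") auto
  then show ?thesis using cix_le[OF assms(1)] cov_cix[OF assms(1)] by auto
qed

text \<open>An active vertex outside the cover has a partner different from itself, hence an edge of
  \<open>F\<close>, whose other end is in the cover. An active cover vertex is attached to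
  itself.\<close>

lemma active_near:
  assumes "v \<in> V" "act v"
  shows "\<exists>i<c. (i \<in> star v \<or> cix v = Suc i) \<and> connected_in F v (cov i)"
proof (cases "cix v = 0")
  case True
  obtain s t where st: "(s, t) \<in> S" "s \<noteq> t" "v = s \<or> v = t"
    using act[OF assms(1)] assms(2) by auto
  have "connected_in F s t" using F st(1) by (auto simp: steiner_forest_def)
  then have "\<exists>u. u \<noteq> v \<and> connected_in F v u"
    using st(2,3) connected_in_sym[of F s t] by auto
  then obtain u where u: "u \<noteq> v" "connected_in F v u" by blast
  obtain w where w: "{v, w} \<in> F"
    using u(2,1) unfolding connected_in_def by (cases rule: converse_rtranclE) auto
  then have vw: "{v, w} \<in> E" using F_E by blast
  obtain a b where "{v, w} = {a, b}" "a \<in> V" "b \<in> V" using edges[OF vw] by blast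
  then have "{v, w} \<subseteq> V" by simp
  then have "w \<in> V" by simp
  moreover have "cix w \<noteq> 0" using covered[OF vw] True by simp
  ultimately obtain i where i: "i < c" "cov i = w" using cov_of by blast
  then have "i \<in> star v" using w True by (simp add: star_def)
  moreover have "connected_in F v (cov i)" using w i(2) by (simp add: connected_in_edge)
  ultimately show ?thesis using i(1) by blast
next
  case False
  then obtain i where "i < c" "cix v = Suc i" "cov i = v" using cov_of[OF assms(1)] by blast
  then show ?thesis by (intro exI[of _ i]) simp
qed

text \<open>The component of \<open>F\<close> that contains the active vertices of group
  \<open>g\<close>, named by its root; 0 is a dummy for groups without active vertices. That the
  choice of \<open>i\<close> is irrelevant follows from \<open>demand_connected\<close>.\<close>

definition gpart :: "nat \<Rightarrow> nat" where
  "gpart g = (if \<exists>w\<in>V. act w \<and> grp w = g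
     then croot (SOME i. i < c \<and> (\<exists>w\<in>V. act w \<and> grp w = g \<and> connected_in F w (cov i))) else 0)"

lemma gpart:
  assumes "v \<in> V" "act v" "i < c" "connected_in F v (cov i)"
  shows "gpart (grp v) = croot i"
proof -
  let ?P = "\<lambda>i. i < c \<and> (\<exists>w\<in>V. act w \<and> grp w = grp v \<and> connected_in F w (cov i))"
  define i' where "i' = (SOME i. ?P i)"
  have "?P i" using assms by blast
  then have "?P i'" unfolding i'_def by (rule someI)
  then obtain w where w: "w \<in> V" "grp w = grp v" "connected_in F w (cov i')"
    by blast
  have "connected_in F w v" by (rule demand_connected[OF grp_eq[OF w(1) assms(1) w(2)]])
  then have "connected_in F w (cov i)" using assms(4) by (rule connected_in_trans)
  with connected_in_sym[OF w(3)] have "connected_in F (cov i') (cov i)" by (rule connected_in_trans)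
  then have "croot i' = croot i" by (simp add: croot_eq_iff)
  moreover have "\<exists>w\<in>V. act w \<and> grp w = grp v" using assms by blast
  ultimately show ?thesis unfolding gpart_def i'_def by simp
qed

lemma gpart_le: "gpart g \<le> c"
proof (cases "\<exists>w\<in>V. act w \<and> grp w = g")
  case True
  then obtain w where w: "w \<in> V" "act w" "grp w = g" by blast
  obtain i where i: "i < c" "connected_in F w (cov i)" using active_near[OF w(1,2)] by blast
  show ?thesis using gpart[OF w(1,2) i] croot_le[of i] i(1) w(3) by simp
next
  case False
  then have "gpart g = 0" unfolding gpart_def by (rule if_not_P)
  then show ?thesis by simp
qed

text \<open>The run that follows \<open>F\<close>: guess its components, buy the star of every
  vertex and merge all touched classes. For the empty list \<open>p\<close> is free, since the first
  vertex of a group may set the goal.\<close>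

lemma reach_complete:
  assumes "set vs \<subseteq> V" "grouped grp vs" "vs = [] \<or> p = gpart (grp (hd vs))" "p \<le> c"
  shows "\<exists>x<num_states c. reaches vs x (\<Sum>v\<leftarrow>vs. card (star v)) \<and>
    (\<forall>i<c. part c x i = croot i \<and> label c x i = rep vs i) \<and> goal c x = p"
  using assms
proof (induction vs arbitrary: p)
  case Nil
  have "\<exists>x<num_states c. (\<forall>i<c. part c x i = croot i \<and> label c x i = i \<and>
      (joined c x i \<longleftrightarrow> False)) \<and> goal c x = p"
    using croot_le Nil by (intro ex_state) (auto intro: le_less_trans)
  moreover have "rep [] i = i" for i by (simp add: rep_def Least_equality)
  ultimately show ?case by (auto simp: start_def)
next
  case (Cons v vs)
  have v: "v \<in> V" "set vs \<subseteq> V" "grouped grp vs" using Cons.prems by auto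
  have p: "p = gpart (grp v)" using Cons.prems by simp
  define p' where "p' = (if vs = [] then 0 else gpart (grp (hd vs)))"
  have "vs = [] \<or> p' = gpart (grp (hd vs))" "p' \<le> c" by (auto simp: p'_def gpart_le)
  from Cons.IH[OF v(2,3) this] obtain x where x: "x < num_states c"
    "reaches vs x (\<Sum>v\<leftarrow>vs. card (star v))" "\<And>i. i < c \<Longrightarrow> part c x i = croot i"
    "\<And>i. i < c \<Longrightarrow> label c x i = rep vs i" "goal c x = p'" by blast
  have "\<exists>y<num_states c. (\<forall>i<c. part c y i = croot i \<and> label c y i = rep (v # vs) i \<and>
      (joined c y i \<longleftrightarrow> i \<in> star v)) \<and> goal c y = p"
    using croot_le rep_le Cons.prems by (intro ex_state) (auto intro: le_less_trans)
  then obtain y where y: "y < num_states c" "\<And>i. i < c \<Longrightarrow> part c y i = croot i"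
    "\<And>i. i < c \<Longrightarrow> label c y i = rep (v # vs) i" "\<And>i. i < c \<Longrightarrow> joined c y i \<longleftrightarrow> i \<in> star v"
    "goal c y = p" by blast
  have cost: "cost c y = card (star v)"
    unfolding cost_def by (rule arg_cong[where f = card]) (auto simp: y(4) star_def)
  have tr: "trans_ok c cix adj act v (grp v \<notin> grp ` set vs) x y"
    unfolding trans_ok_def
  proof (intro conjI allI impI)
    show "grp v \<notin> grp ` set vs \<or> goal c y = goal c x"
    proof (cases "grp v \<in> grp ` set vs")
      case True
      then have "grp v = grp (hd vs)" "vs \<noteq> []" using Cons.prems(2) by auto
      then show ?thesis using x(5) y(5) p by (simp add: p'_def)
    qed simp
    show "adj v i" if "i < c" "joined c y i" for i
      using that y(4) adj[OF v(1)] F_E by (auto simp: star_def)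
    show "\<exists>i<c. attached c cix v y i \<and> part c y i = goal c y" if act_v: "act v"
    proof -
      obtain i where "i < c" "i \<in> star v \<or> cix v = Suc i" "connected_in F v (cov i)"
        using active_near[OF v(1) act_v] by blast
      then show ?thesis using gpart[OF v(1) act_v] y p by (auto simp: attached_def)
    qed
    fix i j assume ij: "i < c" "j < c" "label c y i = label c y j"
    have touched: "touched c cix v x y i" if "i < c" "l < c" "l \<in> star v \<or> cix v = Suc l"
      "linked vs l i" for i l
      using that x(4) y(4) by (auto simp: touched_def attached_def rep_eq_iff intro!: exI[of _ l])
    have "linked (v # vs) i j" using ij y(3) by (simp add: rep_eq_iff)
    then show "label c x i = label c x j \<or> touched c cix v x y i \<and> touched c cix v x y j"
      using ij x(4) touched by (auto simp: rep_eq_iff)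
  qed (use x y in simp)
  have "reaches (v # vs) y (\<Sum>v\<leftarrow>v # vs. card (star v))"
    unfolding reach.simps
    by (rule exI[of _ x], intro conjI x(1), rule exI[of _ "\<Sum>v\<leftarrow>vs. card (star v)"])
      (use x(2) tr in \<open>simp add: cost\<close>)
  then show ?case using y by blast
qed

lemma linked_in: "v \<in> set vs \<Longrightarrow> i < c \<Longrightarrow> j < c \<Longrightarrow> i \<in> star v \<or> cix v = Suc i \<Longrightarrow>
    j \<in> star v \<or> cix v = Suc j \<Longrightarrow> linked vs i j"
  by (induction vs) auto

text \<open>A path may leave the cover, where \<open>linked\<close> says nothing. The second
  conjunct bridges this: when the path stands at \<open>z\<close>, all cover neighbours of
  \<open>z\<close> are linked to \<open>i\<close>. Two consecutive vertices are never both outside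
  the cover.\<close>

lemma connected_linked:
  assumes "set vs = V" "i < c" "connected_in F (cov i) z"
  shows "(\<forall>j<c. z = cov j \<longrightarrow> linked vs i j) \<and> (\<forall>j<c. {z, cov j} \<in> F \<longrightarrow> linked vs i j)"
proof -
  \<comment> \<open>An edge inside the cover belongs to the star of its larger end, which is also
    attached to itself; so this vertex links both ends.\<close>
  have direct: "\<exists>v\<in>V. (a \<in> star v \<or> cix v = Suc a) \<and> (b \<in> star v \<or> cix v = Suc b)"
    if ab: "a < c" "b < c" "{cov a, cov b} \<in> F" for a b
  proof -
    have "cov a \<noteq> cov b"
    proof
      assume "cov a = cov b"
      then have "{cov b} \<in> E" using subsetD[OF F_E ab(3)] by simp
      from edges[OF this] obtain u v where uv: "{cov b} = {u, v}" "u \<noteq> v" by blast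
      then have "u \<in> {cov b}" "v \<in> {cov b}" by simp_all
      then show False using uv(2) by simp
    qed
    then consider "cov a < cov b" | "cov b < cov a" by linarith
    then show ?thesis
    proof cases
      case 1
      then have "a \<in> star (cov b)" using ab by (simp add: star_def insert_commute)
      then show ?thesis using cov[OF ab(2)] by blast
    next
      case 2
      then have "b \<in> star (cov a)" using ab by (simp add: star_def insert_commute)
      then show ?thesis using cov[OF ab(1)] by blast
    qed
  qed
  \<comment> \<open>All cover neighbours of a vertex outside the cover lie in its star.\<close>
  have via: "\<exists>v\<in>V. (a \<in> star v \<or> cix v = Suc a) \<and> (b \<in> star v \<or> cix v = Suc b)"
    if "a < c" "b < c" "{z, cov a} \<in> F" "{z, cov b} \<in> F" "cix z = 0" "z \<in> V" for a b z
    using that by (intro bexI[of _ z]) (simp_all add: star_def)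
  have V: "z \<in> V" if zw: "{z, w} \<in> F" for z w
  proof -
    obtain a b where "{z, w} = {a, b}" "a \<in> V" "b \<in> V" 
      using edges[OF subsetD[OF F_E zw]] by blast
    then have "{z, w} \<subseteq> V" by simp
    then show ?thesis by simp
  qed
  have link: "linked vs a b" if ab: "a < c" "b < c"
    "\<exists>v\<in>V. (a \<in> star v \<or> cix v = Suc a) \<and> (b \<in> star v \<or> cix v = Suc b)" for a b
  proof -
    obtain v where v: "v \<in> set vs" "a \<in> star v \<or> cix v = Suc a" "b \<in> star v \<or> cix v = Suc b"
      using ab(3) unfolding assms(1) by blast
    show ?thesis by (rule linked_in[OF v(1) ab(1,2) v(2,3)])
  qed
  from assms(3) have "(cov i, z) \<in> {(u, v). {u, v} \<in> F}\<^sup>*" by (simp add: connected_in_def)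
  then show ?thesis
  proof (induction rule: rtrancl_induct)
    case base
    have "linked vs i j" if "j < c" "cov i = cov j" for j
    proof -
      have "cix (cov i) = cix (cov j)" using that(2) by simp
      then show ?thesis using cov[OF assms(2)] cov[OF that(1)] by simp
    qed
    moreover have "linked vs i j" if "j < c" "{cov i, cov j} \<in> F" for j
      using link[OF assms(2) that(1)] direct[OF assms(2) that] by blast
    ultimately show ?case by blast
  next
    case (step y z)
    then have yz: "{y, z} \<in> F" by simp
    have zV: "z \<in> V" using V[of z y] yz by (simp add: insert_commute)
    have yV: "y \<in> V" using V yz by blast
    show ?case
    proof (cases "cix z = 0")
      case True
      then have "cix y \<noteq> 0" using covered[of y z] subsetD[OF F_E yz] by simp
      then obtain a where a: "a < c" "cov a = y" using cov_of yV by blast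
      then have ia: "linked vs i a" using step.IH by blast
      have "{z, cov a} \<in> F" using a(2) yz by (simp add: insert_commute)
      then have "linked vs a j" if "j < c" "{z, cov j} \<in> F" for j
        using link[OF a(1) that(1)] via[OF a(1) that(1) _ that(2) True zV] by blast
      then have "linked vs i j" if "j < c" "{z, cov j} \<in> F" for j
        using linked_trans[OF ia] that by blast
      moreover have "z \<noteq> cov j" if "j < c" for j using cov[OF that] True by auto
      ultimately show ?thesis by blast
    next
      case False
      then obtain a where a: "a < c" "cov a = z" using cov_of zV by blast
      then have ia: "linked vs i a" using step.IH yz by blast
      have "linked vs a j" if "j < c" "{z, cov j} \<in> F" for j
        using link[OF a(1) that(1)] direct[OF a(1) that(1)] a(2) that(2) by blast
      then have "linked vs i j" if "j < c" "{z, cov j} \<in> F" for j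
        using linked_trans[OF ia] that by blast
      moreover have "linked vs i j" if "j < c" "z = cov j" for j
      proof -
        have "cix (cov j) = cix (cov a)" using a(2) that(2) by simp
        then show ?thesis using cov[OF that(1)] cov[OF a(1)] ia by simp
      qed
      ultimately show ?thesis by blast
    qed
  qed
qed

lemma decide_complete:
  assumes "card F \<le> k" "set vs = V" "distinct vs" "grouped grp vs"
  shows "decide c cix adj act grp vs k"
proof -
  have mono: "reaches vs x q'" if "reaches vs x q" "q \<le> q'" for x q q'
    using that by (cases vs) (auto intro: le_trans)
  define p where "p = (if vs = [] then 0 else gpart (grp (hd vs)))"
  have "vs = [] \<or> p = gpart (grp (hd vs))" "p \<le> c" by (auto simp: p_def gpart_le)
  from reach_complete[OF _ assms(4) this] obtain x where x: "x < num_states c"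
    "reaches vs x (\<Sum>v\<leftarrow>vs. card (star v))" "\<And>i. i < c \<Longrightarrow> part c x i = croot i"
    "\<And>i. i < c \<Longrightarrow> label c x i = rep vs i" using assms(2) by blast
  have "reaches vs x k"
    using mono[OF x(2)] sum_star_le[of vs] assms by simp
  moreover have "final c x"
    using x connected_linked[OF assms(2)] by (auto simp: final_def croot_eq_iff rep_eq_iff)
  ultimately show ?thesis using x(1) by (auto simp: decide_def)
qed

end

theorem decide_correct:
  assumes "set vs = V" "distinct vs" "grouped grp vs"
  shows "decide c cix adj act grp vs k \<longleftrightarrow> (\<exists>F. steiner_forest E S F \<and> card F \<le> k)"
  using decide_sound[OF _ assms(1,3)] decide_complete[OF _ _ assms] by blast

end

subsection \<open>Reasoning about commands\<close>

fun written_vars :: "com \<Rightarrow> nat set" where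
  "written_vars Skip = {}"
| "written_vars (Assign x e) = {x}"
| "written_vars (Write a e1 e2) = {}"
| "written_vars (Seq c1 c2) = written_vars c1 \<union> written_vars c2"
| "written_vars (Cond e c1 c2) = written_vars c1 \<union> written_vars c2"
| "written_vars (For i e c) = insert i (written_vars c)"

fun written_arrays :: "com \<Rightarrow> nat set" where
  "written_arrays Skip = {}"
| "written_arrays (Assign x e) = {}"
| "written_arrays (Write a e1 e2) = {a}"
| "written_arrays (Seq c1 c2) = written_arrays c1 \<union> written_arrays c2"
| "written_arrays (Cond e c1 c2) = written_arrays c1 \<union> written_arrays c2"
| "written_arrays (For i e c) = written_arrays c"

lemma fold_invariant:
  assumes "P s" "\<And>j s. P s \<Longrightarrow> P (f j s)"
  shows "P (fold f js s)"
  using assms(1) by (induction js arbitrary: s) (simp_all add: assms(2))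

text \<open>A syntactic frame rule: the specification of a phase can stay silent about what the
  phase does not write.\<close>

lemma unwritten_var: "x \<notin> written_vars c \<Longrightarrow> fst (ex c s) x = fst s x"
proof (induction c arbitrary: s)
  case (For i e c)
  show ?case unfolding ex.simps
    by (rule fold_invariant[where P = "\<lambda>s'. fst s' x = fst s x"]) (use For in simp_all)
qed simp_all

lemma unwritten_array: "a \<notin> written_arrays c \<Longrightarrow> snd (ex c s) a = snd s a"
proof (induction c arbitrary: s)
  case (For i e c)
  show ?case unfolding ex.simps
    by (rule fold_invariant[where P = "\<lambda>s'. snd s' a = snd s a"]) (use For in simp_all)
qed simp_all

text \<open>Loop bounds and results are established together, since whether an iteration respects
  \<open>B\<close> depends on the store reached so far.\<close>

lemma For_rule:
  assumes "ok_exp B e s" "ev e s = n" "n \<le> B" "I 0 s"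
    and "\<And>j s. j < n \<Longrightarrow> I j s \<Longrightarrow> ok_com B c (set_var i j s) \<and> I (Suc j) (ex c (set_var i j s))"
  shows "ok_com B (For i e c) s \<and> I n (ex (For i e c) s)"
proof -
  let ?it = "\<lambda>k. fold (\<lambda>j s. ex c (set_var i j s)) [0..<k] s"
  have I: "k \<le> n \<Longrightarrow> I k (?it k)" for k
    by (induction k) (use assms(4,5) in simp_all)
  then show ?thesis using assms by simp
qed

fun exp_vars :: "exp \<Rightarrow> nat set" where
  "exp_vars (Num k) = {}"
| "exp_vars (Var x) = {x}"
| "exp_vars (Idx a e) = exp_vars e"
| "exp_vars (Plus a b) = exp_vars a \<union> exp_vars b"
| "exp_vars (Minus a b) = exp_vars a \<union> exp_vars b"
| "exp_vars (Sum i a e) = exp_vars a \<union> exp_vars e"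

lemma set_var_commute: "x \<noteq> y \<Longrightarrow> set_var x j (set_var y k s) = set_var y k (set_var x j s)"
  by (simp add: set_var_def fun_upd_twist)

lemma ev_unused: "x \<notin> exp_vars e \<Longrightarrow> ev e (set_var x k s) = ev e s"
proof (induction e arbitrary: s)
  case (Sum i a e)
  show ?case
  proof (cases "i = x")
    case False
    then show ?thesis using Sum by (simp add: set_var_commute[of i x])
  qed (use Sum in simp)
qed simp_all

definition holds :: "exp \<Rightarrow> store \<Rightarrow> bool" where
  "holds e s \<longleftrightarrow> ev e s \<noteq> 0"

text \<open>Nonzero means true. With truncated subtraction \<open>1 - a\<close> is negation and
  \<open>a - b = 0\<close> is comparison; conjunction uses De Morgan, as products are missing.
  \<open>BoolE\<close> normalises to 0 or 1 where truth values are counted or output.\<close>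

definition NotE :: "exp \<Rightarrow> exp" where "NotE a = Minus (Num 1) a"
definition BoolE :: "exp \<Rightarrow> exp" where "BoolE a = NotE (NotE a)"
definition OrE :: "exp \<Rightarrow> exp \<Rightarrow> exp" where "OrE a b = Plus a b"
definition AndE :: "exp \<Rightarrow> exp \<Rightarrow> exp" where "AndE a b = NotE (OrE (NotE a) (NotE b))"
definition ImpE :: "exp \<Rightarrow> exp \<Rightarrow> exp" where "ImpE a b = OrE (NotE a) b"
definition LeE :: "exp \<Rightarrow> exp \<Rightarrow> exp" where "LeE a b = NotE (Minus a b)"
definition LtE :: "exp \<Rightarrow> exp \<Rightarrow> exp" where "LtE a b = LeE (Plus a (Num 1)) b"
definition EqE :: "exp \<Rightarrow> exp \<Rightarrow> exp" where "EqE a b = AndE (LeE a b) (LeE b a)"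
definition ExE :: "nat \<Rightarrow> exp \<Rightarrow> exp \<Rightarrow> exp" where "ExE i n e = Sum i n e"
definition AllE :: "nat \<Rightarrow> exp \<Rightarrow> exp \<Rightarrow> exp" where "AllE i n e = NotE (Sum i n (NotE e))"

lemmas exp_defs = NotE_def BoolE_def OrE_def AndE_def ImpE_def LeE_def LtE_def EqE_def
  ExE_def AllE_def

lemma holds_Var: "holds (Var x) s \<longleftrightarrow> fst s x \<noteq> 0"
  by (simp add: holds_def)

lemma holds_Idx: "holds (Idx a e) s \<longleftrightarrow> snd s a (ev e s) \<noteq> 0"
  by (simp add: holds_def)

lemma holds_simps [simp]:
  "holds (NotE a) s \<longleftrightarrow> \<not> holds a s"
  "holds (BoolE a) s \<longleftrightarrow> holds a s"
  "holds (OrE a b) s \<longleftrightarrow> holds a s \<or> holds b s"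
  "holds (AndE a b) s \<longleftrightarrow> holds a s \<and> holds b s"
  "holds (ImpE a b) s \<longleftrightarrow> (holds a s \<longrightarrow> holds b s)"
  "holds (LeE a b) s \<longleftrightarrow> ev a s \<le> ev b s"
  "holds (LtE a b) s \<longleftrightarrow> ev a s < ev b s"
  "holds (EqE a b) s \<longleftrightarrow> ev a s = ev b s"
  "holds (ExE i n a) s \<longleftrightarrow> (\<exists>j<ev n s. holds a (set_var i j s))"
  "holds (AllE i n a) s \<longleftrightarrow> (\<forall>j<ev n s. holds a (set_var i j s))"
  by (auto simp: exp_defs holds_def Suc_le_eq)

lemma ev_BoolE [simp]: "ev (BoolE a) s = of_bool (holds a s)"
  by (auto simp: exp_defs holds_def)

lemma ev_LeE [simp]: "ev (LeE a b) s = of_bool (ev a s \<le> ev b s)"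
  by (auto simp: exp_defs)

lemma ok_exp_simps [simp]:
  "ok_exp B (NotE a) s \<longleftrightarrow> ok_exp B a s"
  "ok_exp B (BoolE a) s \<longleftrightarrow> ok_exp B a s"
  "ok_exp B (OrE a b) s \<longleftrightarrow> ok_exp B a s \<and> ok_exp B b s"
  "ok_exp B (AndE a b) s \<longleftrightarrow> ok_exp B a s \<and> ok_exp B b s"
  "ok_exp B (ImpE a b) s \<longleftrightarrow> ok_exp B a s \<and> ok_exp B b s"
  "ok_exp B (LeE a b) s \<longleftrightarrow> ok_exp B a s \<and> ok_exp B b s"
  "ok_exp B (LtE a b) s \<longleftrightarrow> ok_exp B a s \<and> ok_exp B b s"
  "ok_exp B (EqE a b) s \<longleftrightarrow> ok_exp B a s \<and> ok_exp B b s"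
  "ok_exp B (ExE i n a) s \<longleftrightarrow>
     ok_exp B n s \<and> ev n s \<le> B \<and> (\<forall>j<ev n s. ok_exp B a (set_var i j s))"
  "ok_exp B (AllE i n a) s \<longleftrightarrow>
     ok_exp B n s \<and> ev n s \<le> B \<and> (\<forall>j<ev n s. ok_exp B a (set_var i j s))"
  by (auto simp: exp_defs)

lemma ex_Cond: "ex (Cond e c1 c2) s = (if holds e s then ex c1 s else ex c2 s)"
  by (simp add: holds_def)

lemma ok_com_Cond:
  "ok_com B (Cond e c1 c2) s \<longleftrightarrow> ok_exp B e s \<and> (if holds e s then ok_com B c1 s else ok_com B c2 s)"
  by (simp add: holds_def)

declare ex.simps(5) [simp del] ok_com.simps(5) [simp del]
declare ex_Cond [simp] ok_com_Cond [simp]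
declare ex.simps(6) [simp del] ok_com.simps(6) [simp del]

subsection \<open>The program\<close>

text \<open>Variables 0 and 2 are prescribed as the output and the length of the input. Variables 17 and 18
  are used only inside of \<open>QuotE\<close> and \<open>DigE\<close>.\<close>

abbreviation (input) "vOut \<equiv> 0 :: nat"
abbreviation (input) "vL \<equiv> 2 :: nat"
abbreviation (input) "vm \<equiv> 3 :: nat"
abbreviation (input) "vp \<equiv> 4 :: nat"
abbreviation (input) "vk \<equiv> 5 :: nat"
abbreviation (input) "vc \<equiv> 6 :: nat"
abbreviation (input) "vM \<equiv> 7 :: nat"
abbreviation (input) "vf \<equiv> 8 :: nat"
abbreviation (input) "vn \<equiv> 9 :: nat"
abbreviation (input) "vx \<equiv> 10 :: nat"
abbreviation (input) "vy \<equiv> 11 :: nat"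
abbreviation (input) "vi \<equiv> 12 :: nat"
abbreviation (input) "vj \<equiv> 13 :: nat"
abbreviation (input) "vl \<equiv> 14 :: nat"
abbreviation (input) "vg \<equiv> 15 :: nat"
abbreviation (input) "ve \<equiv> 16 :: nat"
abbreviation (input) "vz \<equiv> 17 :: nat"
abbreviation (input) "vq \<equiv> 18 :: nat"
abbreviation (input) "va \<equiv> 19 :: nat"
abbreviation (input) "vb \<equiv> 20 :: nat"
abbreviation (input) "vv \<equiv> 21 :: nat"

abbreviation (input) "aX \<equiv> 0 :: nat"
abbreviation (input) "aPos \<equiv> 1 :: nat"
abbreviation (input) "aCix \<equiv> 2 :: nat"
abbreviation (input) "aGrp \<equiv> 3 :: nat"
abbreviation (input) "aAct \<equiv> 4 :: nat"
abbreviation (input) "aPow \<equiv> 5 :: nat"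
abbreviation (input) "aDp \<equiv> 6 :: nat"
abbreviation (input) "aNew \<equiv> 7 :: nat"
abbreviation (input) "aAdj \<equiv> 8 :: nat"

text \<open>Division by counting the \<open>q < x\<close> with \<open>(q + 1) * e \<le> x\<close>,
  where the product is a sum of \<open>q + 1\<close> copies of \<open>e\<close>.\<close>

definition QuotE :: "nat \<Rightarrow> exp \<Rightarrow> exp" where
  "QuotE x e = Sum vq (Var x) (LeE (Sum vz (Plus (Var vq) (Num 1)) e) (Var x))"

text \<open>With \<open>a = x div b ^ i\<close> the digit is \<open>a - b * (a div b)\<close>, and
  the product is a sum of \<open>b = c + 1\<close> copies.\<close>

definition DigE :: "nat \<Rightarrow> exp \<Rightarrow> exp" where
  "DigE x i = Minus (QuotE x (Idx aPow i))
     (Sum vz (Plus (Var vc) (Num 1)) (QuotE x (Idx aPow (Plus i (Num 1)))))"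

text \<open>The condition holds exactly for \<open>q < x div d\<close>, and the range of the sum is
  long enough because \<open>x div d \<le> x\<close>.\<close>

lemma div_eq_sum:
  assumes "0 < (d::nat)"
  shows "(\<Sum>q<x. of_bool (Suc q * d \<le> x)) = x div d"
proof -
  have iff: "Suc q * d \<le> x \<longleftrightarrow> q < x div d" for q
    using less_eq_div_iff_mult_less_eq[OF assms, of "Suc q" x] by (simp only: Suc_le_eq)
  have "x div d \<le> x" by simp
  then have "{..<x} \<inter> {q. q < x div d} = {..<x div d}" by (auto intro: less_le_trans)
  then show ?thesis unfolding iff by (simp only: sum_of_bool_eq finite_lessThan card_lessThan of_nat_id)
qed

text \<open>The leading digit has position \<open>3 * c\<close>; one further power is stored because
  the digit at \<open>i\<close> uses the powers at \<open>i\<close> and \<open>i + 1\<close>. That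
  last power is also the number of states.\<close>

definition powers_ok :: "nat \<Rightarrow> store \<Rightarrow> bool" where
  "powers_ok c s \<longleftrightarrow> fst s vc = c \<and> (\<forall>i\<le>3 * c + 1. snd s aPow i = (c + 1) ^ i)"

lemma powers_ok_set_var [simp]: "i \<noteq> vc \<Longrightarrow> powers_ok c (set_var i j s) = powers_ok c s"
  by (simp add: powers_ok_def)

lemma ev_QuotE:
  assumes "x \<notin> {vq, vz}" "vq \<notin> exp_vars e" "vz \<notin> exp_vars e" "ev e s > 0"
  shows "ev (QuotE x e) s = fst s x div ev e s"
  using assms div_eq_sum[of "ev e s" "fst s x"] by (simp add: QuotE_def ev_unused)

lemma ev_DigE:
  assumes "powers_ok c s" "x \<notin> {vq, vz}" "vq \<notin> exp_vars i" "vz \<notin> exp_vars i" "ev i s \<le> 3 * c"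
  shows "ev (DigE x i) s = dig (c + 1) (fst s x) (ev i s)"
proof -
  define x' b e where "x' = fst s x" and "b = c + 1" and "e = ev i s"
  have pow: "snd s aPow e = b ^ e" "snd s aPow (Suc e) = b ^ e * b" "b > 0"
    using assms by (simp_all add: powers_ok_def b_def e_def)
  have 1: "ev (QuotE x (Idx aPow i)) s = x' div b ^ e"
    using assms by (subst ev_QuotE) (simp_all add: pow x'_def flip: e_def)
  have 2: "ev (QuotE x (Idx aPow (Plus i (Num 1)))) (set_var vz z s) = x' div b ^ e div b" for z
    using assms
    by (subst ev_QuotE) (simp_all add: pow ev_unused x'_def div_mult2_eq flip: e_def)
  have "ev (Plus (Var vc) (Num 1)) s = b" using assms(1) by (simp add: b_def powers_ok_def)
  then have "ev (DigE x i) s = x' div b ^ e - b * (x' div b ^ e div b)"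
    unfolding DigE_def ev.simps(5,6) 1 2 by simp
  then show ?thesis unfolding dig_def x'_def b_def e_def by (simp only: minus_mult_div_eq_mod)
qed

fun sum_free :: "exp \<Rightarrow> bool" where
  "sum_free (Num k) = True"
| "sum_free (Var x) = True"
| "sum_free (Idx a e) = sum_free e"
| "sum_free (Plus a b) = (sum_free a \<and> sum_free b)"
| "sum_free (Minus a b) = (sum_free a \<and> sum_free b)"
| "sum_free (Sum i a e) = False"

lemma ok_exp_sum_free: "sum_free e \<Longrightarrow> ok_exp B e s"
  by (induction e) simp_all

text \<open>The counting loops run up to the value of \<open>x\<close>, which is a state number, and
  up to \<open>c + 1\<close>.\<close>

lemma ok_exp_DigE:
  assumes "x \<notin> {vq, vz}" "sum_free i" "fst s x \<le> B" "fst s vc < B"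
  shows "ok_exp B (DigE x i) s"
  using assms by (auto simp: DigE_def QuotE_def ok_exp_sum_free)

definition PartE :: "nat \<Rightarrow> nat \<Rightarrow> exp" where
  "PartE x i = DigE x (Var i)"

definition LabelE :: "nat \<Rightarrow> nat \<Rightarrow> exp" where
  "LabelE x i = DigE x (Plus (Var vc) (Var i))"

definition JoinedE :: "nat \<Rightarrow> nat \<Rightarrow> exp" where
  "JoinedE x i = DigE x (Plus (Plus (Var vc) (Var vc)) (Var i))"

definition GoalE :: "nat \<Rightarrow> exp" where
  "GoalE x = DigE x (Plus (Plus (Var vc) (Var vc)) (Var vc))"

lemma ev_state [simp]:
  assumes "powers_ok c s" "x \<notin> {vq, vz}"
  shows "i \<notin> {vq, vz} \<Longrightarrow> fst s i < c \<Longrightarrow> ev (PartE x i) s = part c (fst s x) (fst s i)"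
    and "i \<notin> {vq, vz} \<Longrightarrow> fst s i < c \<Longrightarrow> ev (LabelE x i) s = label c (fst s x) (fst s i)"
    and "i \<notin> {vq, vz} \<Longrightarrow> fst s i < c \<Longrightarrow> holds (JoinedE x i) s = joined c (fst s x) (fst s i)"
    and "ev (GoalE x) s = goal c (fst s x)"
proof -
  have c: "fst s vc = c" using assms by (simp add: powers_ok_def)
  show "ev (PartE x i) s = part c (fst s x) (fst s i)" if "i \<notin> {vq, vz}" "fst s i < c"
    unfolding PartE_def by (subst ev_DigE[OF assms]) (use that in \<open>simp_all add: part_def\<close>)
  show "ev (LabelE x i) s = label c (fst s x) (fst s i)" if "i \<notin> {vq, vz}" "fst s i < c"
    unfolding LabelE_def by (subst ev_DigE[OF assms]) (use that in \<open>simp_all add: label_def c\<close>)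
  show "holds (JoinedE x i) s = joined c (fst s x) (fst s i)" if "i \<notin> {vq, vz}" "fst s i < c"
    unfolding JoinedE_def holds_def
    by (subst ev_DigE[OF assms]) (use that in \<open>simp_all add: joined_def c mult_2\<close>)
  show "ev (GoalE x) s = goal c (fst s x)"
  proof -
    have eq: "c + c + c = 3 * c" by simp
    then show ?thesis
      unfolding GoalE_def by (subst ev_DigE[OF assms]) (simp_all add: goal_def c eq)
  qed
qed

lemma ok_state [simp]:
  assumes "x \<notin> {vq, vz}" "fst s x \<le> B" "fst s vc < B"
  shows "ok_exp B (PartE x i) s" "ok_exp B (LabelE x i) s" "ok_exp B (JoinedE x i) s"
    "ok_exp B (GoalE x) s"
  using assms by (simp_all add: PartE_def LabelE_def JoinedE_def GoalE_def ok_exp_DigE)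

definition AttachedE :: "nat \<Rightarrow> exp" where
  "AttachedE i = OrE (JoinedE vy i) (EqE (Idx aCix (Var vv)) (Plus (Var i) (Num 1)))"

definition TouchedE :: "nat \<Rightarrow> exp" where
  "TouchedE i = ExE vl (Var vc) (AndE (AttachedE vl) (EqE (LabelE vx vl) (LabelE vx i)))"

definition TransE :: exp where
  "TransE =
     AndE (AllE vi (Var vc) (EqE (PartE vy vi) (PartE vx vi)))
    (AndE (OrE (Var vf) (EqE (GoalE vy) (GoalE vx)))
    (AndE (AllE vi (Var vc) (ImpE (JoinedE vy vi) (Idx aAdj (Var vi))))
    (AndE (ImpE (Idx aAct (Var vv))
        (ExE vi (Var vc) (AndE (AttachedE vi) (EqE (PartE vy vi) (GoalE vy)))))
      (AllE vi (Var vc) (AllE vj (Var vc) (ImpE (EqE (LabelE vy vi) (LabelE vy vj))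
        (OrE (EqE (LabelE vx vi) (LabelE vx vj)) (AndE (TouchedE vi) (TouchedE vj)))))))))"

lemma powers_ok_vc: "powers_ok c s \<Longrightarrow> fst s vc = c"
  by (simp add: powers_ok_def)

lemma holds_AttachedE:
  assumes "powers_ok c s" "i \<notin> {vq, vz}" "fst s i < c"
  shows "holds (AttachedE i) s \<longleftrightarrow> attached c (snd s aCix) (fst s vv) (fst s vy) (fst s i)"
  using assms by (simp add: AttachedE_def attached_def)

lemma holds_TouchedE:
  assumes "powers_ok c s" "i \<notin> {vq, vz, vl}" "fst s i < c"
  shows "holds (TouchedE i) s \<longleftrightarrow> touched c (snd s aCix) (fst s vv) (fst s vx) (fst s vy) (fst s i)"
  using assms by (simp add: TouchedE_def touched_def holds_AttachedE powers_ok_vc conj_ac cong: conj_cong)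

lemma holds_TransE:
  assumes "powers_ok c s"
  shows "holds TransE s \<longleftrightarrow>
    trans_ok c (snd s aCix) (\<lambda>_ i. snd s aAdj i \<noteq> 0) (\<lambda>v. snd s aAct v \<noteq> 0) (fst s vv)
      (fst s vf \<noteq> 0) (fst s vx) (fst s vy)"
  using assms
  by (simp add: TransE_def trans_ok_def holds_AttachedE holds_TouchedE powers_ok_vc holds_Var holds_Idx
      cong: conj_cong imp_cong)

lemma ok_TransE:
  assumes "fst s vc < B" "fst s vx \<le> B" "fst s vy \<le> B"
  shows "ok_exp B TransE s"
  using assms by (simp add: TransE_def AttachedE_def TouchedE_def)

definition CostE :: exp where
  "CostE = Sum vi (Var vc) (BoolE (JoinedE vy vi))"

lemma ev_CostE:
  assumes "powers_ok c s"
  shows "ev CostE s = cost c (fst s vy)"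
proof -
  have "ev CostE s = (\<Sum>i<c. of_bool (joined c (fst s vy) i))"
    using assms by (simp add: CostE_def powers_ok_vc)
  also have "\<dots> = card {i. i < c \<and> joined c (fst s vy) i}"
    by (simp add: sum_of_bool_eq Int_def)
  finally show ?thesis by (simp add: cost_def)
qed

lemma ok_CostE: "fst s vc < B \<Longrightarrow> fst s vy \<le> B \<Longrightarrow> ok_exp B CostE s"
  by (simp add: CostE_def)

text \<open>Offsets in the encoding: \<open>n\<close> and \<open>m\<close> come first, so edge
  \<open>e\<close> starts at position \<open>2 + 2 * e\<close>; then \<open>p\<close> follows, so
  pair \<open>e\<close> starts at \<open>3 + 2 * m + 2 * e\<close>.\<close>

definition UE :: exp where "UE = Idx aX (Plus (Num 2) (Plus (Var ve) (Var ve)))"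
definition WE :: exp where "WE = Idx aX (Plus (Num 3) (Plus (Var ve) (Var ve)))"
definition SE :: exp where
  "SE = Idx aX (Plus (Num 3) (Plus (Plus (Var vm) (Var vm)) (Plus (Var ve) (Var ve))))"
definition TE :: exp where
  "TE = Idx aX (Plus (Num 4) (Plus (Plus (Var vm) (Var vm)) (Plus (Var ve) (Var ve))))"
definition XE :: "nat \<Rightarrow> exp" where "XE i = Idx aX (Var i)"

lemmas input_exps = UE_def WE_def SE_def TE_def XE_def

text \<open>Array cells are arbitrary at the start, so those of the input words are set explicitly.
  \<open>aPos\<close> ends up with the last position of each word; the positions that equal the
  \<open>aPos\<close> of their own word then enumerate the distinct words.\<close>

definition init_com :: com where
  "init_com = For vj (Var vL)
     (Seq (Write aPos (XE vj) (Var vj))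
     (Seq (Write aCix (XE vj) (Num 0))
     (Seq (Write aGrp (XE vj) (XE vj))
          (Write aAct (XE vj) (Num 0)))))"

definition cover_com :: com where
  "cover_com = Seq (Assign vc (Num 0))
     (For ve (Var vm)
       (Cond (AndE (EqE (Idx aCix UE) (Num 0)) (EqE (Idx aCix WE) (Num 0)))
         (Seq (Write aCix UE (Plus (Var vc) (Num 1)))
         (Seq (Write aCix WE (Plus (Var vc) (Num 2)))
              (Assign vc (Plus (Var vc) (Num 2)))))
         Skip))"

text \<open>Union of two classes by relabelling. Both labels are copied first, since the loop
  overwrites the array they are read from.\<close>

definition merge_com :: com where
  "merge_com = Seq (Assign va (Idx aGrp SE)) (Seq (Assign vb (Idx aGrp TE))
     (For vj (Var vL) (Cond (EqE (Idx aGrp (XE vj)) (Var vb)) (Write aGrp (XE vj) (Var va)) Skip)))"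

text \<open>A pair with equal terminals is skipped: the empty forest satisfies it, and it must not
  force a vertex to be attached to the cover.\<close>

definition groups_com :: com where
  "groups_com = For ve (Var vp)
     (Cond (EqE SE TE) Skip
       (Seq (Write aAct SE (Num 1)) (Seq (Write aAct TE (Num 1)) merge_com)))"

definition powers_com :: com where
  "powers_com = Seq (Write aPow (Num 0) (Num 1))
     (Seq (For vi (Plus (Plus (Plus (Var vc) (Var vc)) (Var vc)) (Num 1))
       (Write aPow (Plus (Var vi) (Num 1)) (Sum vz (Plus (Var vc) (Num 1)) (Idx aPow (Var vi)))))
     (Assign vM (Idx aPow (Plus (Plus (Plus (Var vc) (Var vc)) (Var vc)) (Num 1)))))"

text \<open>\<open>k + 1\<close> stands for infinity, as costs above the budget need not be told
  apart.\<close>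

definition start_com :: com where
  "start_com = For vx (Var vM)
     (Cond (AllE vi (Var vc) (EqE (LabelE vx vi) (Var vi)))
       (Write aDp (Var vx) (Num 0)) (Write aDp (Var vx) (Plus (Var vk) (Num 1))))"

definition adj_com :: com where
  "adj_com = For vi (Var vc) (Write aAdj (Var vi) (ExE ve (Var vm)
     (OrE (AndE (EqE UE (Var vv)) (EqE (Idx aCix WE) (Plus (Var vi) (Num 1))))
          (AndE (EqE WE (Var vv)) (EqE (Idx aCix UE) (Plus (Var vi) (Num 1)))))))"

text \<open>The new table goes to a second array, because every new entry depends on all old
  ones.\<close>

definition relax_com :: com where
  "relax_com = For vy (Var vM) (Seq (Write aNew (Var vy) (Plus (Var vk) (Num 1)))
     (For vx (Var vM) (Cond
       (AndE TransE (LtE (Plus (Idx aDp (Var vx)) CostE) (Idx aNew (Var vy))))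
       (Write aNew (Var vy) (Plus (Idx aDp (Var vx)) CostE)) Skip)))"

definition copy_com :: com where
  "copy_com = For vy (Var vM) (Write aDp (Var vy) (Idx aNew (Var vy)))"

definition step_com :: com where
  "step_com = Seq adj_com (Seq relax_com copy_com)"

definition group_com :: com where
  "group_com = Seq (Assign vf (Num 1)) (For vj (Var vL)
     (Cond (AndE (EqE (Idx aPos (XE vj)) (Var vj)) (EqE (Idx aGrp (XE vj)) (XE vg)))
       (Seq (Assign vv (XE vj)) (Seq step_com (Assign vf (Num 0)))) Skip))"

text \<open>Nested scans replace sorting: the outer one offers every distinct word as a group label,
  the inner one collects the vertices with that label. Words that label no group contribute
  nothing.\<close>

definition loop_com :: com where
  "loop_com = For vg (Var vL) (Cond (EqE (Idx aPos (XE vg)) (Var vg)) group_com Skip)"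

definition final_com :: com where
  "final_com = Assign vOut (BoolE (ExE vx (Var vM) (AndE (LeE (Idx aDp (Var vx)) (Var vk))
     (AllE vi (Var vc) (AllE vj (Var vc)
       (ImpE (EqE (PartE vx vi) (PartE vx vj)) (EqE (LabelE vx vi) (LabelE vx vj))))))))"

definition main_com :: com where
  "main_com = Seq init_com (Seq cover_com (Seq groups_com (Seq powers_com (Seq start_com
     (Seq loop_com final_com)))))"

definition read_com :: com where
  "read_com = Seq (Assign vn (Idx aX (Num 0))) (Seq (Assign vm (Idx aX (Num 1)))
     (Seq (Assign vp (Idx aX (Plus (Num 2) (Plus (Var vm) (Var vm)))))
          (Assign vk (Idx aX (Minus (Var vL) (Num 1))))))"

definition valid_exp :: exp where
  "valid_exp = AndE
     (AllE ve (Var vm) (AndE (LtE UE (Var vn)) (AndE (LtE WE (Var vn)) (NotE (EqE UE WE)))))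
     (AllE ve (Var vp) (AndE (LtE SE (Var vn)) (LtE TE (Var vn))))"

text \<open>The length test is free of loops and comes first: \<open>vm\<close> and
  \<open>vp\<close> may be arbitrary numbers until the test bounds them by the input length. If it
  succeeds, all positions read so far lie inside the input.\<close>

definition program :: com where
  "program = Seq read_com
     (Cond (EqE (Var vL) (Plus (Num 4) (Plus (Plus (Var vm) (Var vm)) (Plus (Var vp) (Var vp)))))
       (Cond valid_exp main_com (Assign vOut (Num 0))) (Assign vOut (Num 0)))"

lemma fits_program: "fits_com program 64"
  by (simp add: program_def read_com_def valid_exp_def main_com_def init_com_def cover_com_def
      groups_com_def merge_com_def powers_com_def start_com_def loop_com_def group_com_def step_com_def
      adj_com_def relax_com_def copy_com_def final_com_def input_exps TransE_def CostE_def
      TouchedE_def AttachedE_def PartE_def LabelE_def JoinedE_def GoalE_def DigE_def QuotE_def exp_defs)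

text \<open>Only the length is assumed to fit. This makes every access valid, so the test of the
  entries themselves can be analysed here.\<close>

locale word =
  fixes xs :: "nat list" and n m p k B :: nat
  assumes len: "length xs = 2 * m + 2 * p + 4"
    and B: "length xs \<le> B"
    and n: "n = xs ! 0" and m: "m = xs ! 1" and p: "p = xs ! (2 + 2 * m)"
    and k: "k = last xs"
begin

abbreviation "L \<equiv> length xs"
abbreviation "V \<equiv> set xs"

definition u where "u e = xs ! (2 + (e + e))"
definition w where "w e = xs ! (3 + (e + e))"
definition s where "s e = xs ! (3 + ((m + m) + (e + e)))"
definition t where "t e = xs ! (4 + ((m + m) + (e + e)))"

definition edges where "edges = {{u e, w e} | e. e < m}"
definition demands where "demands = {(s e, t e) | e. e < p}"

definition base :: "store \<Rightarrow> bool" where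
  "base \<sigma> \<longleftrightarrow> fst \<sigma> vL = L \<and> fst \<sigma> vn = n \<and> fst \<sigma> vm = m \<and> fst \<sigma> vp = p \<and> fst \<sigma> vk = k \<and>
     (\<forall>j<L. snd \<sigma> aX j = xs ! j)"

lemma base_set_var [simp]: "i \<notin> {vL, vn, vm, vp, vk} \<Longrightarrow> base (set_var i j \<sigma>) = base \<sigma>"
  by (simp add: base_def)

lemma base_set_cell [simp]: "a \<noteq> aX \<Longrightarrow> base (set_cell a i j \<sigma>) = base \<sigma>"
  by (simp add: base_def)

lemma base_vars:
  assumes "base \<sigma>"
  shows "fst \<sigma> vL = L" "fst \<sigma> vn = n" "fst \<sigma> vm = m" "fst \<sigma> vp = p" "fst \<sigma> vk = k"
    and "\<And>j. j < L \<Longrightarrow> snd \<sigma> aX j = xs ! j"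
  using assms unfolding base_def by blast+

lemma ev_input [simp]:
  assumes "base \<sigma>"
  shows "fst \<sigma> i < L \<Longrightarrow> ev (XE i) \<sigma> = xs ! fst \<sigma> i"
    and "fst \<sigma> ve < m \<Longrightarrow> ev UE \<sigma> = u (fst \<sigma> ve)"
    and "fst \<sigma> ve < m \<Longrightarrow> ev WE \<sigma> = w (fst \<sigma> ve)"
    and "fst \<sigma> ve < p \<Longrightarrow> ev SE \<sigma> = s (fst \<sigma> ve)"
    and "fst \<sigma> ve < p \<Longrightarrow> ev TE \<sigma> = t (fst \<sigma> ve)"
proof -
  let ?e = "fst \<sigma> ve"
  have X: "j < L \<Longrightarrow> snd \<sigma> aX j = xs ! j" for j by (rule base_vars(6)[OF assms])
  have [simp]: "fst \<sigma> vm = m" by (rule base_vars(3)[OF assms])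
  show "ev (XE i) \<sigma> = xs ! fst \<sigma> i" if "fst \<sigma> i < L" using X[OF that] by (simp add: XE_def)
  show "ev UE \<sigma> = u ?e" if "?e < m"
  proof -
    have "2 + (?e + ?e) < L" using that len by linarith
    from X[OF this] show ?thesis by (simp add: UE_def u_def)
  qed
  show "ev WE \<sigma> = w ?e" if "?e < m"
  proof -
    have "3 + (?e + ?e) < L" using that len by linarith
    from X[OF this] show ?thesis by (simp add: WE_def w_def)
  qed
  show "ev SE \<sigma> = s ?e" if "?e < p"
  proof -
    have "3 + ((m + m) + (?e + ?e)) < L" using that len by linarith
    from X[OF this] show ?thesis by (simp add: SE_def s_def)
  qed
  show "ev TE \<sigma> = t ?e" if "?e < p"
  proof -
    have "4 + ((m + m) + (?e + ?e)) < L" using that len by linarith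
    from X[OF this] show ?thesis by (simp add: TE_def t_def)
  qed
qed

lemma ok_input [simp]:
  "ok_exp B (XE i) \<sigma>" "ok_exp B UE \<sigma>" "ok_exp B WE \<sigma>" "ok_exp B SE \<sigma>" "ok_exp B TE \<sigma>"
  by (simp_all add: input_exps)

lemma input_in_V:
  "e < m \<Longrightarrow> u e \<in> V" "e < m \<Longrightarrow> w e \<in> V" "e < p \<Longrightarrow> s e \<in> V" "e < p \<Longrightarrow> t e \<in> V"
  unfolding u_def w_def s_def t_def using len by (intro nth_mem; linarith)+

lemma m_p_le: "m \<le> B" "p \<le> B" "2 * m \<le> L"
  using len B by simp_all

section \<open>Initialisation and the greedy cover\<close>

definition init_ok :: "store \<Rightarrow> bool" where
  "init_ok \<sigma> \<longleftrightarrow> (\<forall>v\<in>V. snd \<sigma> aPos v < L \<and> xs ! snd \<sigma> aPos v = v \<and> snd \<sigma> aCix v = 0 \<and>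
     snd \<sigma> aGrp v = v \<and> snd \<sigma> aAct v = 0)"

lemma init_com:
  assumes "base \<sigma>"
  shows "ok_com B init_com \<sigma> \<and> base (ex init_com \<sigma>) \<and> init_ok (ex init_com \<sigma>)"
proof -
  define ok where "ok v \<sigma> \<longleftrightarrow> snd \<sigma> aPos v < L \<and> xs ! snd \<sigma> aPos v = v \<and> snd \<sigma> aCix v = 0 \<and>
    snd \<sigma> aGrp v = v \<and> snd \<sigma> aAct v = 0" for v and \<sigma> :: store
  define I where "I j \<sigma> \<longleftrightarrow> base \<sigma> \<and> (\<forall>v\<in>set (take j xs). ok v \<sigma>)" for j \<sigma>
  have "ok_com B init_com \<sigma> \<and> I L (ex init_com \<sigma>)"
    unfolding init_com_def
  proof (rule For_rule)
    fix j \<sigma> assume j: "j < L" and I: "I j \<sigma>"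
    let ?c = "Seq (Write aPos (XE vj) (Var vj)) (Seq (Write aCix (XE vj) (Num 0))
         (Seq (Write aGrp (XE vj) (XE vj)) (Write aAct (XE vj) (Num 0))))"
    let ?\<sigma>' = "ex ?c (set_var vj j \<sigma>)"
    have b: "base \<sigma>" using I by (simp add: I_def)
    have "ok_com B ?c (set_var vj j \<sigma>)" by simp
    moreover have "base ?\<sigma>'" using b by simp
    moreover have "snd ?\<sigma>' = (snd \<sigma>)(aPos := (snd \<sigma> aPos)(xs ! j := j), aCix := (snd \<sigma> aCix)(xs ! j := 0),
        aGrp := (snd \<sigma> aGrp)(xs ! j := xs ! j), aAct := (snd \<sigma> aAct)(xs ! j := 0))"
      using b j by simp
    then have "ok v ?\<sigma>'" if "v \<in> insert (xs ! j) (set (take j xs))" for v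
      using that I j by (cases "v = xs ! j") (simp_all add: ok_def I_def del: ex.simps)
    then have "\<forall>v\<in>set (take (Suc j) xs). ok v ?\<sigma>'"
      using j by (simp add: take_Suc_conv_app_nth del: ex.simps)
    ultimately show "ok_com B ?c (set_var vj j \<sigma>) \<and> I (Suc j) ?\<sigma>'"
      unfolding I_def by blast
  qed (use assms B in \<open>simp_all add: I_def base_vars\<close>)
  then show ?thesis unfolding I_def init_ok_def ok_def by simp
qed

text \<open>\<open>A\<close> is the greedy matching, whose size will bound \<open>c\<close> by the
  vertex cover number. The clause \<open>c \<le> 2 * e\<close> bounds \<open>c\<close> by the input
  length and thereby keeps the loop over the powers within \<open>B\<close>.\<close>

definition cover_inv :: "nat \<Rightarrow> nat \<Rightarrow> (nat \<Rightarrow> nat) \<Rightarrow> bool" where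
  "cover_inv e c cix \<longleftrightarrow> c \<le> 2 * e \<and> (\<forall>v\<in>V. cix v \<le> c) \<and>
     (\<forall>i<c. \<exists>v\<in>V. cix v = Suc i) \<and> inj_on cix {v \<in> V. cix v \<noteq> 0} \<and>
     (\<forall>i<e. cix (u i) \<noteq> 0 \<or> cix (w i) \<noteq> 0) \<and>
     (\<exists>A\<subseteq>edges. finite A \<and> 2 * card A = c \<and> disjoint A \<and> (\<forall>a\<in>A. \<forall>v\<in>a. cix v \<noteq> 0))"

lemma cover_inv_skip:
  "cover_inv e c cix \<Longrightarrow> cix (u e) \<noteq> 0 \<or> cix (w e) \<noteq> 0 \<Longrightarrow> cover_inv (Suc e) c cix"
  unfolding cover_inv_def less_Suc_eq by fastforce

text \<open>Old indices are at most \<open>c\<close>, so the two new ones are fresh. Both ends have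
  index 0 whereas matched vertices have nonzero indices, so the edge is disjoint from the
  matching.\<close>

lemma cover_inv_add:
  assumes inv: "cover_inv e c cix" and e: "e < m" "u e \<noteq> w e" "cix (u e) = 0" "cix (w e) = 0"
  shows "cover_inv (Suc e) (Suc (Suc c)) (cix(u e := Suc c, w e := Suc (Suc c)))"
proof -
  note I = inv[unfolded cover_inv_def, THEN conjunct1]
    inv[unfolded cover_inv_def, THEN conjunct2, THEN conjunct1]
    inv[unfolded cover_inv_def, THEN conjunct2, THEN conjunct2, THEN conjunct1]
    inv[unfolded cover_inv_def, THEN conjunct2, THEN conjunct2, THEN conjunct2, THEN conjunct1]
    inv[unfolded cover_inv_def, THEN conjunct2, THEN conjunct2, THEN conjunct2, THEN conjunct2,
      THEN conjunct1]
    inv[unfolded cover_inv_def, THEN conjunct2, THEN conjunct2, THEN conjunct2, THEN conjunct2,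
      THEN conjunct2]
  define cix' where "cix' = cix(u e := Suc c, w e := Suc (Suc c))"
  have uw: "cix' (u e) = Suc c" "cix' (w e) = Suc (Suc c)"
    "\<And>v. v \<noteq> u e \<Longrightarrow> v \<noteq> w e \<Longrightarrow> cix' v = cix v" using e(2) by (simp_all add: cix'_def)
  have le: "\<And>v. v \<in> V \<Longrightarrow> cix v \<le> c" using I(2) by blast
  have V: "u e \<in> V" "w e \<in> V" using input_in_V e by simp_all
  have keep: "cix' v = cix v" if "cix v \<noteq> 0" for v
  proof (rule uw(3))
    show "v \<noteq> u e" using that e(3) by blast
    show "v \<noteq> w e" using that e(4) by blast
  qed
  have "\<forall>v\<in>V. cix' v \<le> Suc (Suc c)"
  proof
    fix v assume "v \<in> V"
    show "cix' v \<le> Suc (Suc c)"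
    proof (cases "v = u e \<or> v = w e")
      case True
      then show ?thesis using uw(1,2) by (elim disjE) simp_all
    next
      case False
      then show ?thesis using uw(3)[of v] le[OF \<open>v \<in> V\<close>] by simp
    qed
  qed
  moreover have "\<exists>v\<in>V. cix' v = Suc i" if i: "i < Suc (Suc c)" for i
  proof -
    consider "i < c" | "i = c" | "i = Suc c" using i by linarith
    then show ?thesis
    proof cases
      case 1
      then obtain v where v: "v \<in> V" "cix v = Suc i" using I(3) by blast
      then have "cix' v = Suc i" using keep[of v] by simp
      with v(1) show ?thesis by blast
    next
      case 2
      then show ?thesis using V(1) uw(1) by blast
    next
      case 3
      then show ?thesis using V(2) uw(2) by blast
    qed
  qed
  moreover have "inj_on cix' {v \<in> V. cix' v \<noteq> 0}"
  proof (rule inj_onI)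
    fix x y assume xy: "x \<in> {v \<in> V. cix' v \<noteq> 0}" "y \<in> {v \<in> V. cix' v \<noteq> 0}" "cix' x = cix' y"
    note inj = I(4)
    have lx: "cix x \<le> c" "cix y \<le> c" using xy le by simp_all
    show "x = y"
    proof (cases "x \<in> {u e, w e} \<or> y \<in> {u e, w e}")
      case True
      have val: "v = u e" if "cix' v = Suc c" "cix v \<le> c" for v
        using that uw(2) uw(3)[of v] by (cases "v = w e"; cases "v = u e") simp_all
      have val': "v = w e" if "cix' v = Suc (Suc c)" "cix v \<le> c" for v
        using that uw(1) uw(3)[of v] by (cases "v = w e"; cases "v = u e") simp_all
      have "cix' x = Suc c \<or> cix' x = Suc (Suc c)"
        using True xy(3) uw(1,2) by (elim disjE insertE emptyE) simp_all
      then show ?thesis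
      proof
        assume x: "cix' x = Suc c"
        show ?thesis
          by (rule trans[OF val[OF x lx(1)] val[OF trans[OF xy(3)[symmetric] x] lx(2), symmetric]])
      next
        assume x: "cix' x = Suc (Suc c)"
        show ?thesis
          by (rule trans[OF val'[OF x lx(1)] val'[OF trans[OF xy(3)[symmetric] x] lx(2), symmetric]])
      qed
    next
      case False
      then have eq: "cix' x = cix x" "cix' y = cix y" using uw(3) by simp_all
      have "x \<in> {v \<in> V. cix v \<noteq> 0}" "y \<in> {v \<in> V. cix v \<noteq> 0}" "cix x = cix y"
        using xy unfolding mem_Collect_eq eq by blast+
      then show ?thesis using inj by (simp add: inj_onD)
    qed
  qed
  moreover have "\<forall>i<Suc e. cix' (u i) \<noteq> 0 \<or> cix' (w i) \<noteq> 0"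
  proof (intro allI impI)
    fix i assume i: "i < Suc e"
    show "cix' (u i) \<noteq> 0 \<or> cix' (w i) \<noteq> 0"
    proof (cases "i = e")
      case True
      then show ?thesis using uw(1) by simp
    next
      case False
      then have "cix (u i) \<noteq> 0 \<or> cix (w i) \<noteq> 0"
        using I(5) i by simp
      then show ?thesis using keep[of "u i"] keep[of "w i"] by (elim disjE) simp_all
    qed
  qed
  moreover have "\<exists>A\<subseteq>edges. finite A \<and> 2 * card A = Suc (Suc c) \<and> disjoint A \<and> (\<forall>a\<in>A. \<forall>v\<in>a. cix' v \<noteq> 0)"
  proof -
    obtain A where A: "A \<subseteq> edges" "finite A" "2 * card A = c" "disjoint A"
      "\<forall>a\<in>A. \<forall>v\<in>a. cix v \<noteq> 0" using I(6) by blast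
    let ?A = "insert {u e, w e} A"
    have new: "{u e, w e} \<notin> A"
    proof
      assume "{u e, w e} \<in> A"
      from A(5)[rule_format, OF this, of "u e"] show False using e(3) by simp
    qed
    have apart: "a \<inter> {u e, w e} = {}" if "a \<in> A" for a
      using A(5)[rule_format, OF that, of "u e"] A(5)[rule_format, OF that, of "w e"] e(3,4) by auto
    have "{u e, w e} \<in> edges" unfolding edges_def using e(1) by blast
    then have "?A \<subseteq> edges" using A(1) by simp
    moreover have "2 * card ?A = Suc (Suc c)" using A(2,3) new by simp
    moreover have "disjoint ?A"
      using A(4) apart by (simp only: pairwise_insert disjnt_def Int_commute) simp
    moreover have "\<forall>a\<in>?A. \<forall>v\<in>a. cix' v \<noteq> 0"
    proof (intro ballI)
      fix a v assume a: "a \<in> ?A" "v \<in> a"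
      show "cix' v \<noteq> 0"
      proof (cases "a \<in> A")
        case True
        then have "cix v \<noteq> 0" using A(5) a(2) by blast
        then show ?thesis using keep[of v] by simp
      next
        case False
        then have "v = u e \<or> v = w e" using a by blast
        then show ?thesis using uw(1,2) by (elim disjE) simp_all
      qed
    qed
    ultimately show ?thesis using A(2) by (intro exI[of _ ?A]) simp
  qed
  moreover have "Suc (Suc c) \<le> 2 * Suc e" using I(1) by simp
  ultimately have "cover_inv (Suc e) (Suc (Suc c)) cix'"
    unfolding cover_inv_def by blast
  then show ?thesis by (simp only: cix'_def)
qed

end

text \<open>A loop would give its vertex two indices. The range condition makes
  \<open>{0..<n}\<close> a vertex cover, so \<open>vc_number\<close> is a minimum over a nonempty
  set.\<close>

locale valid_word = word +
  assumes loopless: "\<And>e. e < m \<Longrightarrow> u e \<noteq> w e" and in_range: "\<And>e. e < m \<Longrightarrow> u e < n"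
begin

lemma cover_com:
  assumes "base \<sigma>" "init_ok \<sigma>"
  shows "ok_com B cover_com \<sigma> \<and> base (ex cover_com \<sigma>) \<and>
    cover_inv m (fst (ex cover_com \<sigma>) vc) (snd (ex cover_com \<sigma>) aCix)"
proof -
  define I where "I e \<sigma> \<longleftrightarrow> base \<sigma> \<and> cover_inv e (fst \<sigma> vc) (snd \<sigma> aCix)" for e \<sigma>
  let ?c = "Cond (AndE (EqE (Idx aCix UE) (Num 0)) (EqE (Idx aCix WE) (Num 0)))
         (Seq (Write aCix UE (Plus (Var vc) (Num 1)))
         (Seq (Write aCix WE (Plus (Var vc) (Num 2)))
              (Assign vc (Plus (Var vc) (Num 2)))))
         Skip"
  have "ok_com B (For ve (Var vm) ?c) (set_var vc 0 \<sigma>) \<and> I m (ex (For ve (Var vm) ?c) (set_var vc 0 \<sigma>))"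
  proof (rule For_rule)
    have cix: "\<forall>v\<in>V. snd \<sigma> aCix v = 0" using assms(2) by (simp add: init_ok_def)
    then have empty: "{v \<in> V. snd \<sigma> aCix v \<noteq> 0} = {}" by simp
    have "cover_inv 0 0 (snd \<sigma> aCix)"
      unfolding cover_inv_def empty
    proof (intro conjI)
      show "\<exists>A\<subseteq>edges. finite A \<and> 2 * card A = 0 \<and> disjoint A \<and> (\<forall>a\<in>A. \<forall>v\<in>a. snd \<sigma> aCix v \<noteq> 0)"
        by (rule exI[of _ "{}"]) simp
    qed (use cix in simp_all)
    then show "I 0 (set_var vc 0 \<sigma>)" using assms(1) by (simp add: I_def)
    fix e \<sigma> assume e: "e < m" and I: "I e \<sigma>"
    let ?\<sigma> = "set_var ve e \<sigma>"
    have b: "base ?\<sigma>" using I by (simp add: I_def)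
    have b': "base (set_cell aCix j x ?\<sigma>)" for j x using b by simp
    have ev: "ev UE ?\<sigma> = u e" "ev WE ?\<sigma> = w e" "ev WE (set_cell aCix j x ?\<sigma>) = w e" for j x
      using ev_input(2,3)[OF b] ev_input(3)[OF b'] e by simp_all
    have inv: "cover_inv e (fst \<sigma> vc) (snd \<sigma> aCix)" using I by (simp add: I_def)
    show "ok_com B ?c ?\<sigma> \<and> I (Suc e) (ex ?c ?\<sigma>)"
    proof (cases "snd \<sigma> aCix (u e) = 0 \<and> snd \<sigma> aCix (w e) = 0")
      case True
      then show ?thesis
        using cover_inv_add[OF inv e loopless[OF e]] b by (simp add: I_def ev)
    next
      case False
      then show ?thesis using cover_inv_skip[OF inv] b by (auto simp: I_def ev)
    qed
  qed (use assms m_p_le in \<open>simp_all add: base_vars\<close>)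
  then show ?thesis by (simp add: cover_com_def I_def)
qed

section \<open>Components of the demand graph\<close>

lemma merge_com:
  assumes "base \<sigma>" "fst \<sigma> ve < p"
  defines "a \<equiv> snd \<sigma> aGrp (s (fst \<sigma> ve))" and "b \<equiv> snd \<sigma> aGrp (t (fst \<sigma> ve))"
  shows "ok_com B merge_com \<sigma> \<and> base (ex merge_com \<sigma>) \<and>
    (\<forall>v\<in>V. snd (ex merge_com \<sigma>) aGrp v = (if snd \<sigma> aGrp v = b then a else snd \<sigma> aGrp v))"
proof -
  define grp where "grp = snd \<sigma> aGrp"
  define I where "I j \<sigma>' \<longleftrightarrow> base \<sigma>' \<and> fst \<sigma>' va = a \<and> fst \<sigma>' vb = b \<and>
    (\<forall>v\<in>V. snd \<sigma>' aGrp v = (if v \<in> set (take j xs) \<and> grp v = b then a else grp v))" for j \<sigma>'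
  let ?c = "Cond (EqE (Idx aGrp (XE vj)) (Var vb)) (Write aGrp (XE vj) (Var va)) Skip"
  let ?\<sigma> = "set_var vb b (set_var va a \<sigma>)"
  have b0: "base (set_var va a \<sigma>)" using assms(1) by simp
  have "ok_com B (For vj (Var vL) ?c) ?\<sigma> \<and> I L (ex (For vj (Var vL) ?c) ?\<sigma>)"
  proof (rule For_rule)
    fix j \<sigma>' assume j: "j < L" and I: "I j \<sigma>'"
    have b: "base (set_var vj j \<sigma>')" using I by (simp add: I_def)
    have ev: "ev (XE vj) (set_var vj j \<sigma>') = xs ! j" using ev_input(1)[OF b] j by simp
    have I': "fst \<sigma>' va = a" "fst \<sigma>' vb = b"
      "\<And>v. v \<in> V \<Longrightarrow> snd \<sigma>' aGrp v = (if v \<in> set (take j xs) \<and> grp v = b then a else grp v)"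
      using I by (simp_all add: I_def)
    have tk: "set (take (Suc j) xs) = insert (xs ! j) (set (take j xs))"
      using j by (simp add: take_Suc_conv_app_nth)
    have Vj: "xs ! j \<in> V" using j by simp
    show "ok_com B ?c (set_var vj j \<sigma>') \<and> I (Suc j) (ex ?c (set_var vj j \<sigma>'))"
    proof (cases "snd \<sigma>' aGrp (xs ! j) = b")
      case True
      have "(snd \<sigma>' aGrp)(xs ! j := a) = snd (ex ?c (set_var vj j \<sigma>')) aGrp"
        using True I'(1,2) by (simp add: ev)
      moreover have "((snd \<sigma>' aGrp)(xs ! j := a)) v =
          (if v \<in> set (take (Suc j) xs) \<and> grp v = b then a else grp v)" if "v \<in> V" for v
        using True I'(3)[OF that] unfolding tk by (cases "v = xs ! j") (auto split: if_splits)
      ultimately show ?thesis using b I' True by (simp add: I_def ev)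
    next
      case False
      have "snd \<sigma>' aGrp v = (if v \<in> set (take (Suc j) xs) \<and> grp v = b then a else grp v)"
        if "v \<in> V" for v
        using False I'(3)[OF that] unfolding tk by (cases "v = xs ! j") (auto split: if_splits)
      then show ?thesis using b I' False by (simp add: I_def ev)
    qed
  qed (use assms B b0 in \<open>simp_all add: I_def base_vars grp_def\<close>)
  moreover have "ev SE \<sigma> = s (fst \<sigma> ve)" "ev TE (set_var va a \<sigma>) = t (fst \<sigma> ve)"
    using ev_input(4)[OF assms(1,2)] ev_input(5)[OF b0] assms(2) by simp_all
  then have "ex merge_com \<sigma> = ex (For vj (Var vL) ?c) ?\<sigma>"
    "ok_com B merge_com \<sigma> = ok_com B (For vj (Var vL) ?c) ?\<sigma>"
    unfolding merge_com_def ex.simps ok_com.simps by (simp_all add: a_def b_def)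
  ultimately show ?thesis by (simp add: I_def grp_def)
qed

text \<open>The first clause keeps every label an input word, so that the outer scan meets it. The
  second clause refers to all demands; it holds from the start and survives every merge.\<close>

definition groups_inv :: "nat \<Rightarrow> (nat \<Rightarrow> nat) \<Rightarrow> (nat \<Rightarrow> nat) \<Rightarrow> bool" where
  "groups_inv e grp act \<longleftrightarrow> (\<forall>v\<in>V. grp v \<in> V) \<and>
     (\<forall>x\<in>V. \<forall>y\<in>V. grp x = grp y \<longrightarrow> (x, y) \<in> (demands \<union> demands\<inverse>)\<^sup>*) \<and>
     (\<forall>i<e. grp (s i) = grp (t i)) \<and>
     (\<forall>v\<in>V. act v \<noteq> 0 \<longleftrightarrow> (\<exists>i<e. s i \<noteq> t i \<and> (v = s i \<or> v = t i)))"

lemma demands_sym: "(x, y) \<in> (demands \<union> demands\<inverse>)\<^sup>* \<Longrightarrow> (y, x) \<in> (demands \<union> demands\<inverse>)\<^sup>*"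
proof -
  have "sym ((demands \<union> demands\<inverse>)\<^sup>*)" by (rule sym_rtrancl) (auto simp: sym_def)
  then show "(x, y) \<in> (demands \<union> demands\<inverse>)\<^sup>* \<Longrightarrow> (y, x) \<in> (demands \<union> demands\<inverse>)\<^sup>*"
    by (auto simp: sym_def)
qed

text \<open>Vertices whose labels become equal are connected through the demand that is being
  merged.\<close>

lemma groups_inv_merge:
  assumes inv: "groups_inv e grp act" and e: "e < p" "s e \<noteq> t e"
    and grp': "\<And>v. v \<in> V \<Longrightarrow> grp' v = (if grp v = grp (t e) then grp (s e) else grp v)"
  shows "groups_inv (Suc e) grp' (act(s e := 1, t e := 1))"
proof -
  let ?R = "(demands \<union> demands\<inverse>)\<^sup>*"
  have V: "s i \<in> V" "t i \<in> V" if "i \<le> e" for i using input_in_V e that by simp_all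
  have R: "(x, y) \<in> ?R" if "x \<in> V" "y \<in> V" "grp x = grp y" for x y
    using inv that by (simp add: groups_inv_def)
  have st: "(s e, t e) \<in> ?R" using e by (auto simp: demands_def intro!: r_into_rtrancl)
  have ts: "(t e, s e) \<in> ?R" by (rule demands_sym[OF st])
  have "(x, y) \<in> ?R" if xy: "x \<in> V" "y \<in> V" "grp' x = grp' y" for x y
  proof -
    consider "grp x = grp y" | "grp x = grp (t e)" "grp (s e) = grp y"
      | "grp x = grp (s e)" "grp (t e) = grp y"
      using xy(3) unfolding grp'[OF xy(1)] grp'[OF xy(2)] by (auto split: if_splits)
    then show ?thesis
    proof cases
      case 1
      then show ?thesis using R xy by simp
    next
      case 2
      then show ?thesis
        using rtrancl_trans[OF rtrancl_trans[OF R[OF xy(1) V(2)[OF order.refl]] ts]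
            R[OF V(1)[OF order.refl] xy(2)]] by simp
    next
      case 3
      then show ?thesis
        using rtrancl_trans[OF rtrancl_trans[OF R[OF xy(1) V(1)[OF order.refl]] st]
            R[OF V(2)[OF order.refl] xy(2)]] by simp
    qed
  qed
  moreover have "\<forall>v\<in>V. grp' v \<in> V"
    using inv V(1)[OF order.refl] by (simp add: groups_inv_def grp')
  moreover have "\<forall>i<Suc e. grp' (s i) = grp' (t i)"
    using inv V by (auto simp: groups_inv_def grp' less_Suc_eq)
  moreover have "\<forall>v\<in>V. (act(s e := 1, t e := 1)) v \<noteq> 0 \<longleftrightarrow> (\<exists>i<Suc e. s i \<noteq> t i \<and> (v = s i \<or> v = t i))"
    using inv e by (auto simp: groups_inv_def less_Suc_eq)
  ultimately show ?thesis unfolding groups_inv_def by blast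
qed

lemma groups_com:
  assumes "base \<sigma>" "\<forall>v\<in>V. snd \<sigma> aGrp v = v \<and> snd \<sigma> aAct v = 0"
  shows "ok_com B groups_com \<sigma> \<and> base (ex groups_com \<sigma>) \<and>
    groups_inv p (snd (ex groups_com \<sigma>) aGrp) (snd (ex groups_com \<sigma>) aAct)"
proof -
  define I where "I e \<sigma> \<longleftrightarrow> base \<sigma> \<and> groups_inv e (snd \<sigma> aGrp) (snd \<sigma> aAct)" for e \<sigma>
  let ?c = "Cond (EqE SE TE) Skip
       (Seq (Write aAct SE (Num 1)) (Seq (Write aAct TE (Num 1)) merge_com))"
  have "ok_com B (For ve (Var vp) ?c) \<sigma> \<and> I p (ex (For ve (Var vp) ?c) \<sigma>)"
  proof (rule For_rule)
    fix e \<sigma> assume e: "e < p" and I: "I e \<sigma>"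
    let ?\<sigma> = "set_var ve e \<sigma>"
    have b: "base ?\<sigma>" using I by (simp add: I_def)
    have b': "base (set_cell aAct j x ?\<sigma>)" for j x using b by simp
    have ev: "ev SE ?\<sigma> = s e" "ev TE ?\<sigma> = t e" "ev TE (set_cell aAct j x ?\<sigma>) = t e" for j x
      using ev_input(4,5)[OF b] ev_input(5)[OF b'] e by simp_all
    have inv: "groups_inv e (snd \<sigma> aGrp) (snd \<sigma> aAct)" using I by (simp add: I_def)
    show "ok_com B ?c ?\<sigma> \<and> I (Suc e) (ex ?c ?\<sigma>)"
    proof (cases "s e = t e")
      case True
      then have "groups_inv (Suc e) (snd \<sigma> aGrp) (snd \<sigma> aAct)"
        using inv by (auto simp: groups_inv_def less_Suc_eq)
      then show ?thesis using b True by (simp add: I_def ev)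
    next
      case False
      let ?\<tau> = "set_cell aAct (t e) 1 (set_cell aAct (s e) 1 ?\<sigma>)"
      have eq: "ex ?c ?\<sigma> = ex merge_com ?\<tau>" "ok_com B ?c ?\<sigma> = ok_com B merge_com ?\<tau>"
        using False by (simp_all add: ev)
      have m: "ok_com B merge_com ?\<tau> \<and> base (ex merge_com ?\<tau>) \<and>
        (\<forall>v\<in>V. snd (ex merge_com ?\<tau>) aGrp v =
          (if snd \<sigma> aGrp v = snd \<sigma> aGrp (t e) then snd \<sigma> aGrp (s e) else snd \<sigma> aGrp v))"
        using merge_com[of ?\<tau>] b e by simp
      have act: "snd (ex merge_com ?\<tau>) aAct = (snd \<sigma> aAct)(s e := 1, t e := 1)"
        by (subst unwritten_array) (simp_all add: merge_com_def)
      have "groups_inv (Suc e) (snd (ex merge_com ?\<tau>) aGrp) (snd (ex merge_com ?\<tau>) aAct)"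
        unfolding act by (rule groups_inv_merge[OF inv e False]) (use m in blast)
      then show ?thesis using m unfolding eq I_def by blast
    qed
  qed (use assms m_p_le in \<open>simp_all add: I_def base_vars groups_inv_def\<close>)
  then show ?thesis by (simp add: groups_com_def I_def)
qed

end

text \<open>Turns \<open>num_states c \<le> B\<close> into \<open>c < B\<close>, as required by the
  loops of length \<open>c + 1\<close>.\<close>

lemma less_num_states: "c < num_states c"
proof -
  have "c + 1 \<le> (c + 1) ^ (3 * c + 1)" by (rule self_le_power) simp_all
  then show ?thesis by (simp add: num_states_def)
qed

lemma num_states_mono: "c \<le> c' \<Longrightarrow> num_states c \<le> num_states c'"
  unfolding num_states_def by (rule power_mono[THEN order.trans, OF _ _ power_increasing]) simp_all

text \<open>The program stores only the adjacency row of the current vertex, so the array agrees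
  with the true relation at \<open>v\<close> alone.\<close>

lemma trans_ok_cong:
  assumes "\<And>i. i < c \<Longrightarrow> adj v i \<longleftrightarrow> adj' v i"
  shows "trans_ok c cix adj act v first x y = trans_ok c cix adj' act v first x y"
  using assms unfolding trans_ok_def by blast

context word
begin

section \<open>The table of the dynamic program\<close>

lemma powers_com:
  assumes "base \<sigma>" "fst \<sigma> vc = c" "3 * c + 1 \<le> B"
  shows "ok_com B powers_com \<sigma> \<and> base (ex powers_com \<sigma>) \<and> powers_ok c (ex powers_com \<sigma>) \<and>
    fst (ex powers_com \<sigma>) vM = num_states c"
proof -
  define I where "I i \<sigma> \<longleftrightarrow> base \<sigma> \<and> fst \<sigma> vc = c \<and> (\<forall>l\<le>i. snd \<sigma> aPow l = (c + 1) ^ l)"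
    for i \<sigma>
  let ?c = "Write aPow (Plus (Var vi) (Num 1)) (Sum vz (Plus (Var vc) (Num 1)) (Idx aPow (Var vi)))"
  let ?for = "For vi (Plus (Plus (Plus (Var vc) (Var vc)) (Var vc)) (Num 1)) ?c"
  let ?\<sigma> = "set_cell aPow 0 1 \<sigma>"
  have main: "ok_com B ?for ?\<sigma> \<and> I (c + c + c + 1) (ex ?for ?\<sigma>)"
  proof (rule For_rule)
    fix i \<sigma> assume i: "i < c + c + c + 1" and I: "I i \<sigma>"
    have c: "fst \<sigma> vc = c" and b: "base \<sigma>" and pow: "\<And>l. l \<le> i \<Longrightarrow> snd \<sigma> aPow l = (c + 1) ^ l"
      using I by (simp_all add: I_def)
    have "ex ?c (set_var vi i \<sigma>) = set_cell aPow (Suc i) ((c + 1) * (c + 1) ^ i) (set_var vi i \<sigma>)"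
      using c pow[OF order.refl] by simp
    moreover have "ok_com B ?c (set_var vi i \<sigma>)" using c assms(3) by simp
    moreover have "I (Suc i) (set_cell aPow (Suc i) ((c + 1) * (c + 1) ^ i) (set_var vi i \<sigma>))"
      using b c pow by (simp add: I_def le_Suc_eq)
    ultimately show "ok_com B ?c (set_var vi i \<sigma>) \<and> I (Suc i) (ex ?c (set_var vi i \<sigma>))" by simp
  qed (use assms in \<open>simp_all add: I_def\<close>)
  have c3: "c + c + c + 1 = 3 * c + 1" by simp
  have r: "ok_com B ?for ?\<sigma>" "I (3 * c + 1) (ex ?for ?\<sigma>)"
    using main unfolding c3 by blast+
  have eq: "ev (Plus (Plus (Plus (Var vc) (Var vc)) (Var vc)) (Num 1)) (ex ?for ?\<sigma>) = 3 * c + 1"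
    using r(2) by (simp add: I_def)
  have pow: "snd (ex ?for ?\<sigma>) aPow (3 * c + 1) = num_states c"
    using r(2) unfolding I_def num_states_def by blast
  have "ex powers_com \<sigma> = set_var vM (num_states c) (ex ?for ?\<sigma>)"
    unfolding powers_com_def ex.simps(1-4) ev.simps(1,3) eq pow ..
  moreover have "ok_com B powers_com \<sigma>" using r(1) by (simp add: powers_com_def)
  ultimately show ?thesis using r(2) by (simp add: I_def powers_ok_def)
qed

definition adjacent :: "(nat \<Rightarrow> nat) \<Rightarrow> nat \<Rightarrow> nat \<Rightarrow> bool" where
  "adjacent cix v i \<longleftrightarrow> (\<exists>e<m. (u e = v \<and> cix (w e) = Suc i) \<or> (w e = v \<and> cix (u e) = Suc i))"

definition ready :: "nat \<Rightarrow> (nat \<Rightarrow> nat) \<Rightarrow> (nat \<Rightarrow> nat) \<Rightarrow> (nat \<Rightarrow> nat) \<Rightarrow> store \<Rightarrow> bool" where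
  "ready c cix grp act \<sigma> \<longleftrightarrow> base \<sigma> \<and> powers_ok c \<sigma> \<and> fst \<sigma> vM = num_states c \<and>
     snd \<sigma> aCix = cix \<and> snd \<sigma> aGrp = grp \<and> snd \<sigma> aAct = act"

lemma ready_set_var [simp]:
  "i \<notin> {vL, vn, vm, vp, vk, vc, vM} \<Longrightarrow> ready c cix grp act (set_var i j \<sigma>) = ready c cix grp act \<sigma>"
  by (simp add: ready_def)

lemma ready_set_cell [simp]:
  "a \<notin> {aX, aPow, aCix, aGrp, aAct} \<Longrightarrow>
    ready c cix grp act (set_cell a i j \<sigma>) = ready c cix grp act \<sigma>"
  by (simp add: ready_def powers_ok_def)

lemma readyD:
  assumes "ready c cix grp act \<sigma>"
  shows "base \<sigma>" "powers_ok c \<sigma>" "fst \<sigma> vM = num_states c" "fst \<sigma> vc = c" "fst \<sigma> vL = L"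
    "fst \<sigma> vm = m" "fst \<sigma> vk = k" "snd \<sigma> aCix = cix" "snd \<sigma> aGrp = grp" "snd \<sigma> aAct = act"
  using assms by (simp_all add: ready_def powers_ok_def base_vars)

text \<open>Comparison with every threshold \<open>q \<le> k\<close> avoids a minimum, which may not
  exist, and hides how values above \<open>k\<close> are represented.\<close>

definition dp_spec :: "nat \<Rightarrow> (nat \<Rightarrow> nat) \<Rightarrow> (nat \<Rightarrow> nat) \<Rightarrow> (nat \<Rightarrow> nat) \<Rightarrow> nat list \<Rightarrow>
    (nat \<Rightarrow> nat) \<Rightarrow> bool" where
  "dp_spec c cix grp act vs D \<longleftrightarrow> (\<forall>y<num_states c. \<forall>q\<le>k.
     D y \<le> q \<longleftrightarrow> reach c cix (adjacent cix) (\<lambda>v. act v \<noteq> 0) grp vs y q)"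

lemma start_com:
  assumes "ready c cix grp act \<sigma>" "num_states c \<le> B"
  shows "ok_com B start_com \<sigma> \<and> ready c cix grp act (ex start_com \<sigma>) \<and>
    dp_spec c cix grp act [] (snd (ex start_com \<sigma>) aDp)"
proof -
  define I where "I j \<sigma> \<longleftrightarrow> ready c cix grp act \<sigma> \<and>
    (\<forall>y<j. snd \<sigma> aDp y = (if start c y then 0 else Suc k))" for j \<sigma>
  let ?t = "AllE vi (Var vc) (EqE (LabelE vx vi) (Var vi))"
  let ?c = "Cond ?t (Write aDp (Var vx) (Num 0)) (Write aDp (Var vx) (Plus (Var vk) (Num 1)))"
  have "ok_com B (For vx (Var vM) ?c) \<sigma> \<and> I (num_states c) (ex (For vx (Var vM) ?c) \<sigma>)"
  proof (rule For_rule)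
    fix j \<sigma> assume j: "j < num_states c" and I: "I j \<sigma>"
    have r: "ready c cix grp act \<sigma>" and D: "\<And>y. y < j \<Longrightarrow> snd \<sigma> aDp y = (if start c y then 0 else Suc k)"
      using I by (simp_all add: I_def)
    have h: "holds ?t (set_var vx j \<sigma>) \<longleftrightarrow> start c j"
      using readyD(2,4)[OF r] by (simp add: start_def)
    have "ok_exp B ?t (set_var vx j \<sigma>)"
      using readyD(4)[OF r] j assms(2) less_num_states[of c] by simp
    moreover have "ex ?c (set_var vx j \<sigma>) =
        set_cell aDp j (if start c j then 0 else Suc k) (set_var vx j \<sigma>)"
      using readyD(7)[OF r] unfolding ex_Cond h by simp
    moreover have "I (Suc j) (set_cell aDp j (if start c j then 0 else Suc k) (set_var vx j \<sigma>))"
      using r D by (simp add: I_def less_Suc_eq)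
    ultimately show "ok_com B ?c (set_var vx j \<sigma>) \<and> I (Suc j) (ex ?c (set_var vx j \<sigma>))"
      by (simp del: ex_Cond)
  qed (use assms readyD(3)[OF assms(1)] in \<open>simp_all add: I_def\<close>)
  then show ?thesis unfolding start_com_def I_def dp_spec_def by simp
qed

lemma adj_com:
  assumes "ready c cix grp act \<sigma>" "c \<le> B"
  shows "ok_com B adj_com \<sigma> \<and> ready c cix grp act (ex adj_com \<sigma>) \<and>
    (\<forall>i<c. snd (ex adj_com \<sigma>) aAdj i \<noteq> 0 \<longleftrightarrow> adjacent cix (fst \<sigma> vv) i)"
proof -
  define v where "v = fst \<sigma> vv"
  define t where "t = ExE ve (Var vm)
     (OrE (AndE (EqE UE (Var vv)) (EqE (Idx aCix WE) (Plus (Var vi) (Num 1))))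
          (AndE (EqE WE (Var vv)) (EqE (Idx aCix UE) (Plus (Var vi) (Num 1)))))"
  define I where "I j \<sigma> \<longleftrightarrow> ready c cix grp act \<sigma> \<and> fst \<sigma> vv = v \<and>
    (\<forall>i<j. snd \<sigma> aAdj i \<noteq> 0 \<longleftrightarrow> adjacent cix v i)" for j \<sigma>
  have "ok_com B (For vi (Var vc) (Write aAdj (Var vi) t)) \<sigma> \<and>
    I c (ex (For vi (Var vc) (Write aAdj (Var vi) t)) \<sigma>)"
  proof (rule For_rule)
    fix i \<sigma> assume i: "i < c" and I: "I i \<sigma>"
    let ?\<sigma> = "set_var vi i \<sigma>"
    have r: "ready c cix grp act \<sigma>" "fst \<sigma> vv = v"
      and A: "\<And>i'. i' < i \<Longrightarrow> snd \<sigma> aAdj i' \<noteq> 0 \<longleftrightarrow> adjacent cix v i'"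
      using I by (simp_all add: I_def)
    have b: "base (set_var ve e ?\<sigma>)" for e using readyD(1)[OF r(1)] by simp
    have ev: "ev UE (set_var ve e ?\<sigma>) = u e" "ev WE (set_var ve e ?\<sigma>) = w e" if "e < m" for e
      using ev_input(2,3)[OF b] that by simp_all
    have "holds t ?\<sigma> \<longleftrightarrow> adjacent cix v i"
      unfolding t_def adjacent_def using readyD(6,8)[OF r(1)] r(2) by (simp add: ev cong: conj_cong)
    then have h: "ev t ?\<sigma> \<noteq> 0 \<longleftrightarrow> adjacent cix v i" by (simp only: holds_def)
    have "ok_exp B t ?\<sigma>" unfolding t_def using readyD(6)[OF r(1)] m_p_le by simp
    moreover have "I (Suc i) (set_cell aAdj i (ev t ?\<sigma>) ?\<sigma>)"
      using r A h by (simp add: I_def less_Suc_eq)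
    ultimately show "ok_com B (Write aAdj (Var vi) t) ?\<sigma> \<and> I (Suc i) (ex (Write aAdj (Var vi) t) ?\<sigma>)"
      by simp
  qed (use assms readyD(4)[OF assms(1)] in \<open>simp_all add: I_def v_def\<close>)
  then show ?thesis unfolding adj_com_def I_def t_def v_def by simp
qed

lemma relax_com:
  assumes "ready c cix grp act \<sigma>" "num_states c \<le> B"
    and adj: "\<And>i. i < c \<Longrightarrow> snd \<sigma> aAdj i \<noteq> 0 \<longleftrightarrow> adj (fst \<sigma> vv) i"
  shows "ok_com B relax_com \<sigma> \<and> ready c cix grp act (ex relax_com \<sigma>) \<and>
    (\<forall>y<num_states c. \<forall>q\<le>k. snd (ex relax_com \<sigma>) aNew y \<le> q \<longleftrightarrow>
      (\<exists>x<num_states c. trans_ok c cix adj (\<lambda>v. act v \<noteq> 0) (fst \<sigma> vv) (fst \<sigma> vf \<noteq> 0) x y \<and>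
         snd \<sigma> aDp x + cost c y \<le> q))"
proof -
  define v f D A where "v = fst \<sigma> vv" and "f = fst \<sigma> vf" and "D = snd \<sigma> aDp" and "A = snd \<sigma> aAdj"
  define T where "T = trans_ok c cix adj (\<lambda>v. act v \<noteq> 0) v (f \<noteq> 0)"
  define K where "K \<sigma> \<longleftrightarrow> ready c cix grp act \<sigma> \<and> fst \<sigma> vv = v \<and> fst \<sigma> vf = f \<and>
    snd \<sigma> aDp = D \<and> snd \<sigma> aAdj = A" for \<sigma>
  \<comment> \<open>\<open>N\<close> is the minimum over the predecessors below \<open>n\<close>, as
    far as thresholds up to \<open>k\<close> can tell.\<close>
  define ok where "ok n y N \<longleftrightarrow> (\<forall>q\<le>k. N \<le> q \<longleftrightarrow> (\<exists>x<n. T x y \<and> D x + cost c y \<le> q))" for n y N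
  define I where "I y \<sigma> \<longleftrightarrow> K \<sigma> \<and> (\<forall>y'<y. ok (num_states c) y' (snd \<sigma> aNew y'))" for y \<sigma>
  define J where "J y x \<sigma> \<longleftrightarrow> I y \<sigma> \<and> fst \<sigma> vy = y \<and> ok x y (snd \<sigma> aNew y)" for y x \<sigma>
  have K_var: "K (set_var i j \<sigma>) = K \<sigma>" if "i \<in> {vx, vy}" for i j \<sigma>
    using that by (auto simp: K_def)
  have K_cell: "K (set_cell aNew i j \<sigma>) = K \<sigma>" for i j \<sigma> by (simp add: K_def)
  let ?s = "Plus (Idx aDp (Var vx)) CostE"
  let ?t = "AndE TransE (LtE ?s (Idx aNew (Var vy)))"
  let ?in = "Cond ?t (Write aNew (Var vy) ?s) Skip"
  let ?out = "Seq (Write aNew (Var vy) (Plus (Var vk) (Num 1))) (For vx (Var vM) ?in)"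
  have inner: "ok_com B ?in (set_var vx x \<sigma>) \<and> J y (Suc x) (ex ?in (set_var vx x \<sigma>))"
    if x: "x < num_states c" and y: "y < num_states c" and J: "J y x \<sigma>" for x y \<sigma>
  proof -
    let ?\<sigma> = "set_var vx x \<sigma>"
    have K: "K \<sigma>" and Y: "fst \<sigma> vy = y" and old: "\<forall>y'<y. ok (num_states c) y' (snd \<sigma> aNew y')"
      and N: "ok x y (snd \<sigma> aNew y)" using J by (simp_all add: J_def I_def)
    have r: "ready c cix grp act \<sigma>" using K by (simp add: K_def)
    have p: "powers_ok c ?\<sigma>" using readyD(2)[OF r] by simp
    have "holds TransE ?\<sigma> \<longleftrightarrow> trans_ok c cix (\<lambda>_ i. A i \<noteq> 0) (\<lambda>v. act v \<noteq> 0) v (f \<noteq> 0) x y"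
      using holds_TransE[OF p] K Y readyD(8,10)[OF r] by (simp add: K_def)
    also have "\<dots> = T x y"
      unfolding T_def by (rule trans_ok_cong) (use adj in \<open>simp add: A_def v_def\<close>)
    finally have t: "holds TransE ?\<sigma> \<longleftrightarrow> T x y" .
    have s: "ev ?s ?\<sigma> = D x + cost c y" using ev_CostE[OF p] K Y by (simp add: K_def)
    have h: "holds ?t ?\<sigma> \<longleftrightarrow> T x y \<and> D x + cost c y < snd \<sigma> aNew y"
      using t s Y by simp
    have "fst ?\<sigma> vc < B" "fst ?\<sigma> vx \<le> B" "fst ?\<sigma> vy \<le> B"
      using readyD(4)[OF r] x y Y assms(2) less_num_states[of c] by simp_all
    then have "ok_com B ?in ?\<sigma>" by (simp add: ok_TransE ok_CostE)
    moreover have "J y (Suc x) (ex ?in ?\<sigma>)"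
    proof (cases "T x y \<and> D x + cost c y < snd \<sigma> aNew y")
      case True
      then have "ex ?in ?\<sigma> = set_cell aNew y (D x + cost c y) ?\<sigma>"
        using h s Y by (simp only: ex_Cond if_True ex.simps) simp
      moreover have "ok (Suc x) y (D x + cost c y)"
        unfolding ok_def
      proof (intro allI impI)
        fix q assume "q \<le> k"
        then have "(\<exists>x'<x. T x' y \<and> D x' + cost c y \<le> q) \<longrightarrow> D x + cost c y \<le> q"
          using N True unfolding ok_def by (meson less_imp_le le_trans)
        then show "D x + cost c y \<le> q \<longleftrightarrow> (\<exists>x'<Suc x. T x' y \<and> D x' + cost c y \<le> q)"
          using True less_Suc_eq by blast
      qed
      ultimately show ?thesis
        using K old Y by (simp add: J_def I_def K_var K_cell)
    next
      case False
      then have "ex ?in ?\<sigma> = ?\<sigma>" using h by (simp only: ex_Cond if_False ex.simps)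
      moreover have "ok (Suc x) y (snd \<sigma> aNew y)"
        unfolding ok_def
      proof (intro allI impI)
        fix q assume "q \<le> k"
        then have "snd \<sigma> aNew y \<le> q \<longleftrightarrow> (\<exists>x'<x. T x' y \<and> D x' + cost c y \<le> q)"
          using N unfolding ok_def by blast
        moreover have "T x y \<Longrightarrow> D x + cost c y \<le> q \<Longrightarrow> snd \<sigma> aNew y \<le> q"
          using False by linarith
        ultimately show "snd \<sigma> aNew y \<le> q \<longleftrightarrow> (\<exists>x'<Suc x. T x' y \<and> D x' + cost c y \<le> q)"
          using less_Suc_eq by blast
      qed
      ultimately show ?thesis
        using K old Y by (simp add: J_def I_def K_var)
    qed
    ultimately show ?thesis by blast
  qed
  have "ok_com B (For vy (Var vM) ?out) \<sigma> \<and> I (num_states c) (ex (For vy (Var vM) ?out) \<sigma>)"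
  proof (rule For_rule)
    fix y \<sigma> assume y: "y < num_states c" and I: "I y \<sigma>"
    let ?\<sigma> = "set_cell aNew y (Suc k) (set_var vy y \<sigma>)"
    have r: "ready c cix grp act \<sigma>" using I by (simp add: I_def K_def)
    have "ok 0 y (Suc k)" by (simp add: ok_def)
    then have J: "J y 0 ?\<sigma>" using I by (simp add: J_def I_def K_var K_cell)
    have "ok_com B (For vx (Var vM) ?in) ?\<sigma> \<and> J y (num_states c) (ex (For vx (Var vM) ?in) ?\<sigma>)"
      by (rule For_rule[where I = "J y"])
        (use readyD(3)[OF r] J assms(2) inner[OF _ y] in simp_all)
    moreover have "ex ?out (set_var vy y \<sigma>) = ex (For vx (Var vM) ?in) ?\<sigma>"
      "ok_com B ?out (set_var vy y \<sigma>) = ok_com B (For vx (Var vM) ?in) ?\<sigma>"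
      using readyD(7)[OF r] unfolding ex.simps(4) ok_com.simps(4) by simp_all
    ultimately show "ok_com B ?out (set_var vy y \<sigma>) \<and> I (Suc y) (ex ?out (set_var vy y \<sigma>))"
      unfolding J_def I_def by (metis less_Suc_eq)
  qed (use assms readyD(3)[OF assms(1)] in \<open>simp_all add: I_def K_def v_def f_def D_def A_def\<close>)
  then show ?thesis
    unfolding relax_com_def I_def K_def ok_def T_def v_def f_def D_def by blast
qed

lemma copy_com:
  assumes "ready c cix grp act \<sigma>" "num_states c \<le> B"
  shows "ok_com B copy_com \<sigma> \<and> ready c cix grp act (ex copy_com \<sigma>) \<and>
    (\<forall>y<num_states c. snd (ex copy_com \<sigma>) aDp y = snd \<sigma> aNew y)"
proof -
  define I where "I j \<sigma>' \<longleftrightarrow> ready c cix grp act \<sigma>' \<and> snd \<sigma>' aNew = snd \<sigma> aNew \<and>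
    (\<forall>y<j. snd \<sigma>' aDp y = snd \<sigma> aNew y)" for j \<sigma>'
  have "ok_com B copy_com \<sigma> \<and> I (num_states c) (ex copy_com \<sigma>)"
    unfolding copy_com_def
    by (rule For_rule) (use assms readyD(3)[OF assms(1)] in \<open>simp_all add: I_def less_Suc_eq\<close>)
  then show ?thesis by (simp add: I_def)
qed

lemma step_com:
  assumes r: "ready c cix grp act \<sigma>" and B: "num_states c \<le> B"
    and dp: "dp_spec c cix grp act vs (snd \<sigma> aDp)"
    and first: "fst \<sigma> vf \<noteq> 0 \<longleftrightarrow> grp (fst \<sigma> vv) \<notin> grp ` set vs"
  shows "ok_com B step_com \<sigma> \<and> ready c cix grp act (ex step_com \<sigma>) \<and>
    dp_spec c cix grp act (fst \<sigma> vv # vs) (snd (ex step_com \<sigma>) aDp)"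
proof -
  let ?v = "fst \<sigma> vv" and ?act = "\<lambda>v. act v \<noteq> 0" and ?D = "snd \<sigma> aDp"
  define \<sigma>1 where "\<sigma>1 = ex adj_com \<sigma>"
  define \<sigma>2 where "\<sigma>2 = ex relax_com \<sigma>1"
  have "c \<le> B" using B less_num_states[of c] by simp
  from adj_com[OF r this] have 1: "ok_com B adj_com \<sigma>" "ready c cix grp act \<sigma>1"
    "\<And>i. i < c \<Longrightarrow> snd \<sigma>1 aAdj i \<noteq> 0 \<longleftrightarrow> adjacent cix ?v i" by (simp_all add: \<sigma>1_def)
  have fr: "fst \<sigma>1 vv = ?v" "fst \<sigma>1 vf = fst \<sigma> vf" "snd \<sigma>1 aDp = ?D"
    by (simp_all add: \<sigma>1_def unwritten_var unwritten_array adj_com_def)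
  have 2: "ok_com B relax_com \<sigma>1" "ready c cix grp act \<sigma>2"
    "\<And>y q. y < num_states c \<Longrightarrow> q \<le> k \<Longrightarrow> snd \<sigma>2 aNew y \<le> q \<longleftrightarrow> (\<exists>x<num_states c.
      trans_ok c cix (adjacent cix) ?act ?v (fst \<sigma> vf \<noteq> 0) x y \<and> ?D x + cost c y \<le> q)"
    using relax_com[OF 1(2) B, of "adjacent cix"] 1(3) unfolding fr \<sigma>2_def by blast+
  have 3: "ok_com B copy_com \<sigma>2" "ready c cix grp act (ex copy_com \<sigma>2)"
    "\<And>y. y < num_states c \<Longrightarrow> snd (ex copy_com \<sigma>2) aDp y = snd \<sigma>2 aNew y"
    using copy_com[OF 2(2) B] by blast+
  have eq: "ex step_com \<sigma> = ex copy_com \<sigma>2" "ok_com B step_com \<sigma>"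
    using 1(1) 2(1) 3(1) by (simp_all add: step_com_def \<sigma>1_def \<sigma>2_def)
  have "dp_spec c cix grp act (?v # vs) (snd (ex step_com \<sigma>) aDp)"
    unfolding dp_spec_def
  proof (intro allI impI)
    fix y q assume y: "y < num_states c" and q: "q \<le> k"
    let ?T = "\<lambda>x. trans_ok c cix (adjacent cix) ?act ?v (grp ?v \<notin> grp ` set vs) x y"
    let ?R = "reach c cix (adjacent cix) ?act grp vs"
    have dpx: "?D x \<le> q' \<longleftrightarrow> ?R x q'" if "x < num_states c" "q' \<le> k" for x q'
      using dp that by (simp add: dp_spec_def)
    have "snd (ex step_com \<sigma>) aDp y \<le> q \<longleftrightarrow> (\<exists>x<num_states c. ?T x \<and> ?D x + cost c y \<le> q)"
      using 2(3)[OF y q] 3(3)[OF y] eq(1) first by simp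
    \<comment> \<open>The table entry is the least possible \<open>q'\<close>. The specification of
      the table applies because all budgets involved are at most \<open>q \<le> k\<close>.\<close>
    also have "\<dots> \<longleftrightarrow> (\<exists>x<num_states c. \<exists>q'. ?R x q' \<and> ?T x \<and> q' + cost c y \<le> q)"
    proof
      assume "\<exists>x<num_states c. ?T x \<and> ?D x + cost c y \<le> q"
      then obtain x where x: "x < num_states c" "?T x" "?D x + cost c y \<le> q" by blast
      then have "?R x (?D x)" using dpx[of x "?D x"] q by simp
      then show "\<exists>x<num_states c. \<exists>q'. ?R x q' \<and> ?T x \<and> q' + cost c y \<le> q" using x by blast
    next
      assume "\<exists>x<num_states c. \<exists>q'. ?R x q' \<and> ?T x \<and> q' + cost c y \<le> q"
      then obtain x q' where x: "x < num_states c" "?R x q'" "?T x" "q' + cost c y \<le> q" by blast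
      then have "?D x \<le> q'" using dpx[of x q'] q by simp
      then show "\<exists>x<num_states c. ?T x \<and> ?D x + cost c y \<le> q" using x by (meson add_le_mono1 le_trans)
    qed
    finally show "snd (ex step_com \<sigma>) aDp y \<le> q \<longleftrightarrow>
      reach c cix (adjacent cix) ?act grp (?v # vs) y q" by simp
  qed
  then show ?thesis using eq 3(2) by simp
qed

section \<open>The order in which the vertices are processed\<close>

primrec block :: "(nat \<Rightarrow> nat) \<Rightarrow> (nat \<Rightarrow> nat) \<Rightarrow> nat \<Rightarrow> nat \<Rightarrow> nat list" where
  "block pos grp g 0 = []"
| "block pos grp g (Suc j) = (if pos (xs ! j) = j \<and> grp (xs ! j) = g
     then xs ! j # block pos grp g j else block pos grp g j)"

text \<open>As in \<open>block\<close>, later vertices stand in front, since \<open>reach\<close>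
  works towards the head. Both recursions mirror the scans of the program.\<close>

primrec order :: "(nat \<Rightarrow> nat) \<Rightarrow> (nat \<Rightarrow> nat) \<Rightarrow> nat \<Rightarrow> nat list" where
  "order pos grp 0 = []"
| "order pos grp (Suc g) = (if pos (xs ! g) = g
     then block pos grp (xs ! g) L @ order pos grp g else order pos grp g)"

lemma set_block: "v \<in> set (block pos grp g j) \<longleftrightarrow> pos v < j \<and> xs ! pos v = v \<and> grp v = g"
proof (induction j)
  case (Suc j)
  have "v \<in> set (block pos grp g (Suc j)) \<longleftrightarrow>
      (v = xs ! j \<and> pos v = j \<and> grp v = g) \<or> v \<in> set (block pos grp g j)"
    by (cases "v = xs ! j"; simp; blast)
  then show ?case unfolding Suc.IH less_Suc_eq by metis
qed simp

lemma distinct_block: "distinct (block pos grp g j)"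
  by (induction j) (auto simp: set_block)

text \<open>A vertex enters when the outer scan reaches the position that \<open>pos\<close> assigns
  to its group label.\<close>

lemma set_order:
  "v \<in> set (order pos grp r) \<longleftrightarrow>
    pos v < L \<and> xs ! pos v = v \<and> pos (grp v) < r \<and> xs ! pos (grp v) = grp v"
  by (induction r) (auto simp: set_block less_Suc_eq)

lemma not_in_order: "r \<le> pos (grp v) \<Longrightarrow> v \<notin> set (order pos grp r)"
  using set_order[of v pos grp r] by linarith

lemma distinct_order: "distinct (order pos grp r)"
proof (induction r)
  case (Suc r)
  have "v \<notin> set (order pos grp r)" if "pos (xs ! r) = r" "v \<in> set (block pos grp (xs ! r) L)" for v
    by (rule not_in_order) (use that in \<open>simp add: set_block\<close>)
  then show ?case using Suc distinct_block by auto
qed simp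

lemma grouped_block:
  "grouped grp vs \<Longrightarrow> g \<notin> grp ` set vs \<Longrightarrow> grouped grp (block pos grp g j @ vs)"
proof (induction j)
  case (Suc j)
  show ?case
  proof (cases "block pos grp g j")
    case Nil
    then show ?thesis using Suc by auto
  next
    case (Cons v bs)
    then have "v \<in> set (block pos grp g j)" by simp
    then have "grp v = g" by (simp add: set_block)
    then show ?thesis using Suc Cons by auto
  qed
qed simp

text \<open>Every label is accepted at one position only, so its group is new when its block is put
  in front.\<close>

lemma grouped_order: "grouped grp (order pos grp r)"
proof (induction r)
  case (Suc r)
  show ?case
  proof (cases "pos (xs ! r) = r")
    case True
    have "grp v \<noteq> xs ! r" if "v \<in> set (order pos grp r)" for v
      using not_in_order[of r pos grp v] that True by force
    then have "xs ! r \<notin> grp ` set (order pos grp r)" by force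
    then show ?thesis using grouped_block[OF Suc] True by simp
  qed (use Suc in simp)
qed simp

section \<open>Correctness of the nested scans and of the answer\<close>

lemma group_com:
  assumes "ready c cix grp act \<sigma>" "num_states c \<le> B" "snd \<sigma> aPos = pos" "fst \<sigma> vg < L"
    and "dp_spec c cix grp act vs (snd \<sigma> aDp)" "xs ! fst \<sigma> vg \<notin> grp ` set vs"
  shows "ok_com B group_com \<sigma> \<and> ready c cix grp act (ex group_com \<sigma>) \<and>
    dp_spec c cix grp act (block pos grp (xs ! fst \<sigma> vg) L @ vs) (snd (ex group_com \<sigma>) aDp)"
proof -
  define g where "g = fst \<sigma> vg"
  define I where "I j \<sigma> \<longleftrightarrow> ready c cix grp act \<sigma> \<and> snd \<sigma> aPos = pos \<and> fst \<sigma> vg = g \<and>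
    dp_spec c cix grp act (block pos grp (xs ! g) j @ vs) (snd \<sigma> aDp) \<and>
    (fst \<sigma> vf \<noteq> 0 \<longleftrightarrow> block pos grp (xs ! g) j = [])" for j \<sigma>
  let ?t = "AndE (EqE (Idx aPos (XE vj)) (Var vj)) (EqE (Idx aGrp (XE vj)) (XE vg))"
  let ?c = "Cond ?t (Seq (Assign vv (XE vj)) (Seq step_com (Assign vf (Num 0)))) Skip"
  have "ok_com B (For vj (Var vL) ?c) (set_var vf 1 \<sigma>) \<and> I L (ex (For vj (Var vL) ?c) (set_var vf 1 \<sigma>))"
  proof (rule For_rule)
    fix j \<sigma> assume j: "j < L" and I: "I j \<sigma>"
    let ?\<sigma> = "set_var vj j \<sigma>"
    let ?bl = "block pos grp (xs ! g)"
    have r: "ready c cix grp act \<sigma>" "snd \<sigma> aPos = pos" "fst \<sigma> vg = g"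
      and dp: "dp_spec c cix grp act (?bl j @ vs) (snd \<sigma> aDp)"
      and f: "fst \<sigma> vf \<noteq> 0 \<longleftrightarrow> ?bl j = []" using I by (simp_all add: I_def)
    have b: "base ?\<sigma>" using readyD(1)[OF r(1)] by simp
    have ev: "ev (XE vj) ?\<sigma> = xs ! j" "ev (XE vg) ?\<sigma> = xs ! g"
      using ev_input(1)[OF b, of vj] ev_input(1)[OF b, of vg] j r(3) assms(4) by (simp_all add: g_def)
    have h: "holds ?t ?\<sigma> \<longleftrightarrow> pos (xs ! j) = j \<and> grp (xs ! j) = xs ! g"
      using ev r readyD(9)[OF r(1)] by simp
    show "ok_com B ?c ?\<sigma> \<and> I (Suc j) (ex ?c ?\<sigma>)"
    proof (cases "pos (xs ! j) = j \<and> grp (xs ! j) = xs ! g")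
      case True
      let ?\<tau> = "set_var vv (xs ! j) ?\<sigma>"
      have "grp v = xs ! g" if "v \<in> set (?bl j)" for v using that by (simp add: set_block)
      \<comment> \<open>Vertices of the current block all have group \<open>xs ! g\<close> and those
        of \<open>vs\<close> do not, so the flag is set exactly at the first vertex of the
        group.\<close>
      then have "fst \<sigma> vf \<noteq> 0 \<longleftrightarrow> xs ! g \<notin> grp ` set (?bl j @ vs)"
        using f assms(6) unfolding g_def[symmetric] by (cases "?bl j") auto
      then have step: "ok_com B step_com ?\<tau> \<and> ready c cix grp act (ex step_com ?\<tau>) \<and>
        dp_spec c cix grp act (xs ! j # ?bl j @ vs) (snd (ex step_com ?\<tau>) aDp)"
        using step_com[of c cix grp act ?\<tau> "?bl j @ vs"] r(1) assms(2) dp True by simp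
      have fr: "snd (ex step_com ?\<tau>) aPos = pos" "fst (ex step_com ?\<tau>) vg = g"
        using r(2,3)
        by (simp_all add: unwritten_var unwritten_array step_com_def adj_com_def relax_com_def copy_com_def)
      have ex: "ex ?c ?\<sigma> = set_var vf 0 (ex step_com ?\<tau>)" "ok_com B ?c ?\<sigma> = ok_com B step_com ?\<tau>"
        unfolding ex_Cond ok_com_Cond h using True by (simp_all add: ev)
      show ?thesis using step fr True unfolding ex I_def by simp
    next
      case False
      have "ok_exp B ?t ?\<sigma>" by simp
      then have ok: "ok_com B ?c ?\<sigma>"
        unfolding ok_com_Cond h if_not_P[OF False] by simp
      have ex: "ex ?c ?\<sigma> = ?\<sigma>"
        unfolding ex_Cond h if_not_P[OF False] by simp
      have "?bl (Suc j) = ?bl j" using False by (simp only: block.simps if_False)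
      then show ?thesis unfolding ex I_def using ok r dp f by simp
    qed
  qed (use assms readyD(5)[OF assms(1)] B in \<open>simp_all add: I_def g_def\<close>)
  then show ?thesis by (simp add: group_com_def I_def g_def)
qed

lemma loop_com:
  assumes "ready c cix grp act \<sigma>" "num_states c \<le> B" "snd \<sigma> aPos = pos"
    and "dp_spec c cix grp act [] (snd \<sigma> aDp)"
  shows "ok_com B loop_com \<sigma> \<and> ready c cix grp act (ex loop_com \<sigma>) \<and>
    dp_spec c cix grp act (order pos grp L) (snd (ex loop_com \<sigma>) aDp)"
proof -
  define I where "I g \<sigma> \<longleftrightarrow> ready c cix grp act \<sigma> \<and> snd \<sigma> aPos = pos \<and>
    dp_spec c cix grp act (order pos grp g) (snd \<sigma> aDp)" for g \<sigma>
  let ?c = "Cond (EqE (Idx aPos (XE vg)) (Var vg)) group_com Skip"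
  have "ok_com B (For vg (Var vL) ?c) \<sigma> \<and> I L (ex (For vg (Var vL) ?c) \<sigma>)"
  proof (rule For_rule)
    fix g \<sigma> assume g: "g < L" and I: "I g \<sigma>"
    let ?\<sigma> = "set_var vg g \<sigma>"
    have r: "ready c cix grp act \<sigma>" "snd \<sigma> aPos = pos"
      and dp: "dp_spec c cix grp act (order pos grp g) (snd \<sigma> aDp)" using I by (simp_all add: I_def)
    have b: "base ?\<sigma>" using readyD(1)[OF r(1)] by simp
    have h: "holds (EqE (Idx aPos (XE vg)) (Var vg)) ?\<sigma> \<longleftrightarrow> pos (xs ! g) = g"
      using ev_input(1)[OF b, of vg] r g by simp
    show "ok_com B ?c ?\<sigma> \<and> I (Suc g) (ex ?c ?\<sigma>)"
    proof (cases "pos (xs ! g) = g")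
      case True
      have "grp v \<noteq> xs ! g" if "v \<in> set (order pos grp g)" for v
        using not_in_order[of g pos grp v] that True by force
      then have "xs ! g \<notin> grp ` set (order pos grp g)" by force
      then have "ok_com B group_com ?\<sigma> \<and> ready c cix grp act (ex group_com ?\<sigma>) \<and>
        dp_spec c cix grp act (block pos grp (xs ! g) L @ order pos grp g) (snd (ex group_com ?\<sigma>) aDp)"
        using group_com[of c cix grp act ?\<sigma> pos "order pos grp g"] r assms(2) dp g by simp
      moreover have "snd (ex group_com ?\<sigma>) aPos = pos" using r(2)
        by (simp add: unwritten_array group_com_def step_com_def adj_com_def relax_com_def copy_com_def)
      moreover have "ex ?c ?\<sigma> = ex group_com ?\<sigma>" "ok_com B ?c ?\<sigma> = ok_com B group_com ?\<sigma>"
        unfolding ex_Cond ok_com_Cond h using True by simp_all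
      ultimately show ?thesis using True unfolding I_def by simp
    next
      case False
      then have ok: "ok_com B ?c ?\<sigma>" unfolding ok_com_Cond h by simp
      have ex: "ex ?c ?\<sigma> = ?\<sigma>" unfolding ex_Cond h if_not_P[OF False] by simp
      show ?thesis unfolding ex using ok I False by (simp add: I_def del: ok_com_Cond)
    qed
  qed (use assms readyD(5)[OF assms(1)] B in \<open>simp_all add: I_def\<close>)
  then show ?thesis by (simp add: loop_com_def I_def)
qed

lemma final_com:
  assumes "ready c cix grp act \<sigma>" "num_states c \<le> B"
    and dp: "dp_spec c cix grp act vs (snd \<sigma> aDp)"
  shows "ok_com B final_com \<sigma> \<and>
    fst (ex final_com \<sigma>) vOut = of_bool (decide c cix (adjacent cix) (\<lambda>v. act v \<noteq> 0) grp vs k)"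
proof -
  let ?f = "AllE vi (Var vc) (AllE vj (Var vc)
       (ImpE (EqE (PartE vx vi) (PartE vx vj)) (EqE (LabelE vx vi) (LabelE vx vj))))"
  note r = readyD[OF assms(1)]
  have f: "holds ?f (set_var vx x \<sigma>) \<longleftrightarrow> final c x" for x
    using r(2,4) by (simp add: final_def)
  have "ok_exp B ?f (set_var vx x \<sigma>)" if "x < num_states c" for x
    using r(4) that assms(2) less_num_states[of c] by simp
  then have "ok_com B final_com \<sigma>"
    unfolding final_com_def using r(3) assms(2) by simp
  moreover have "(\<exists>x<num_states c. snd \<sigma> aDp x \<le> k \<and> final c x) \<longleftrightarrow>
      decide c cix (adjacent cix) (\<lambda>v. act v \<noteq> 0) grp vs k"
    using dp by (auto simp: decide_def dp_spec_def)
  then have "fst (ex final_com \<sigma>) vOut = of_bool (decide c cix (adjacent cix) (\<lambda>v. act v \<noteq> 0) grp vs k)"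
    unfolding final_com_def using r(3,7) by (simp add: f del: holds_simps(10))
  ultimately show ?thesis by blast
qed

end

context valid_word
begin

text \<open>\<open>cov\<close> inverts \<open>cix\<close>: all indices from 1 to \<open>c\<close>
  occur, and injectivity makes the chosen vertex unique.\<close>

lemma covered_instance:
  assumes cover: "cover_inv m c cix" and groups: "groups_inv p grp act"
  shows "covered_instance edges demands V c cix (\<lambda>i. SOME v. v \<in> V \<and> cix v = Suc i) grp
    (adjacent cix) (\<lambda>v. act v \<noteq> 0)"
proof -
  define cov where "cov i = (SOME v. v \<in> V \<and> cix v = Suc i)" for i
  have le: "\<forall>v\<in>V. cix v \<le> c" and ex: "\<forall>i<c. \<exists>v\<in>V. cix v = Suc i"
    and inj: "inj_on cix {v \<in> V. cix v \<noteq> 0}" and edge: "\<forall>i<m. cix (u i) \<noteq> 0 \<or> cix (w i) \<noteq> 0"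
    using cover unfolding cover_inv_def by blast+
  have cov: "cov i \<in> V \<and> cix (cov i) = Suc i" if "i < c" for i
    unfolding cov_def by (rule someI_ex) (use ex that in blast)
  have cov_cix: "cov i = v" if "v \<in> V" "cix v = Suc i" for v i
  proof -
    have "i < c" using le that by fastforce
    note ci = cov[OF this]
    show ?thesis by (rule inj_onD[OF inj]) (use ci that in simp_all)
  qed
  have E: "\<exists>e<m. (x = u e \<and> y = w e) \<or> (x = w e \<and> y = u e)" if "{x, y} \<in> edges" for x y
    using that unfolding edges_def doubleton_eq_iff mem_Collect_eq by blast
  have E': "{u e, w e} \<in> edges" if "e < m" for e using that unfolding edges_def by blast
  then have E'': "{w e, u e} \<in> edges" if "e < m" for e using that by (subst insert_commute)
  have "covered_instance edges demands V c cix cov grp (adjacent cix) (\<lambda>v. act v \<noteq> 0)"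
  proof
    show "finite V" by simp
    show "\<exists>x y. e = {x, y} \<and> x \<noteq> y \<and> x \<in> V \<and> y \<in> V" if "e \<in> edges" for e
      using that loopless input_in_V(1,2) unfolding edges_def by blast
    show "cix x \<noteq> 0 \<or> cix y \<noteq> 0" if "{x, y} \<in> edges" for x y
      using E[OF that] edge by blast
    show "cix v \<le> c" if "v \<in> V" for v using le that by blast
    show "cov i \<in> V \<and> cix (cov i) = Suc i" if "i < c" for i by (rule cov[OF that])
    show "cov i = v" if "v \<in> V" "cix v = Suc i" for v i by (rule cov_cix[OF that])
    show "x \<in> V \<and> y \<in> V" if "(x, y) \<in> demands" for x y
      using that input_in_V(3,4) unfolding demands_def by blast
    show "act v \<noteq> 0 \<longleftrightarrow> (\<exists>(x, y)\<in>demands. x \<noteq> y \<and> (v = x \<or> v = y))" if "v \<in> V" for v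
    proof -
      have "act v \<noteq> 0 \<longleftrightarrow> (\<exists>i<p. s i \<noteq> t i \<and> (v = s i \<or> v = t i))"
        using groups that unfolding groups_inv_def by blast
      also have "\<dots> \<longleftrightarrow> (\<exists>(x, y)\<in>demands. x \<noteq> y \<and> (v = x \<or> v = y))"
        unfolding demands_def by blast
      finally show ?thesis .
    qed
    show "grp x = grp y" if "(x, y) \<in> demands" for x y
      using that groups unfolding demands_def groups_inv_def by blast
    show "(x, y) \<in> (demands \<union> demands\<inverse>)\<^sup>*" if "x \<in> V" "y \<in> V" "grp x = grp y" for x y
      using that groups unfolding groups_inv_def by blast
    show "adjacent cix v i \<longleftrightarrow> {v, cov i} \<in> edges" if v: "v \<in> V" and i: "i < c" for v i
    proof
      assume "adjacent cix v i"
      then obtain e where e: "e < m" "(u e = v \<and> cix (w e) = Suc i) \<or> (w e = v \<and> cix (u e) = Suc i)"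
        unfolding adjacent_def by blast
      then show "{v, cov i} \<in> edges"
        using cov_cix[OF input_in_V(1)] cov_cix[OF input_in_V(2)] E'[OF e(1)] E''[OF e(1)] by metis
    next
      assume "{v, cov i} \<in> edges"
      then show "adjacent cix v i" using E cov[OF i] unfolding adjacent_def by metis
    qed
  qed
  then show ?thesis by (simp only: cov_def[abs_def])
qed

text \<open>A vertex cover meets every edge of the matching, and these edges are disjoint, so it has
  at least \<open>card A\<close> vertices, half of \<open>c\<close>.\<close>

lemma cover_le:
  assumes "cover_inv m c cix"
  shows "c \<le> 2 * vc_number n edges"
proof -
  obtain A where A: "A \<subseteq> edges" "2 * card A = c" "disjoint A"
    using assms unfolding cover_inv_def by blast
  have le: "card A \<le> card K" if K: "vertex_cover n edges K" for K
  proof -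
    have hit: "\<exists>x. x \<in> a \<inter> K" if "a \<in> A" for a
      using K A(1) that unfolding vertex_cover_def by blast
    define f where "f a = (SOME x. x \<in> a \<inter> K)" for a
    have f: "f a \<in> a \<inter> K" if "a \<in> A" for a
      unfolding f_def by (rule someI_ex[OF hit[OF that]])
    have "inj_on f A"
    proof (rule inj_onI)
      fix a b assume ab: "a \<in> A" "b \<in> A" "f a = f b"
      then have "f a \<in> a \<inter> b" using f[OF ab(1)] f[OF ab(2)] by simp
      then show "a = b" using A(3) ab(1,2) unfolding disjoint_def by blast
    qed
    moreover have "finite K" using K finite_subset unfolding vertex_cover_def by blast
    moreover have "f ` A \<subseteq> K" using f by blast
    ultimately show ?thesis using card_inj_on_le by blast
  qed
  let ?C = "{card K | K. vertex_cover n edges K}"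
  have "?C \<subseteq> card ` Pow {0..<n}" unfolding vertex_cover_def by blast
  then have "finite ?C" by (rule finite_subset) simp
  moreover have "vertex_cover n edges {0..<n}"
    using in_range unfolding vertex_cover_def edges_def by fastforce
  then have "?C \<noteq> {}" by blast
  ultimately have "Min ?C \<in> ?C" by (rule Min_in)
  then show ?thesis using le A(2) unfolding vc_number_def by auto
qed

text \<open>\<open>3 * L + 1\<close> covers the scans of the input and the loop over the powers, as
  \<open>c \<le> L\<close>. The loops over states are controlled by the parameter, as
  \<open>c\<close> is at most twice the vertex cover number.\<close>

lemma main_com:
  assumes "base \<sigma>" "3 * L + 1 \<le> B" "num_states (2 * vc_number n edges) \<le> B"
  shows "ok_com B main_com \<sigma> \<and>
    fst (ex main_com \<sigma>) vOut = of_bool (\<exists>F. steiner_forest edges demands F \<and> card F \<le> k)"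
proof -
  define \<sigma>1 where "\<sigma>1 = ex init_com \<sigma>"
  define \<sigma>2 where "\<sigma>2 = ex cover_com \<sigma>1"
  define \<sigma>3 where "\<sigma>3 = ex groups_com \<sigma>2"
  define \<sigma>4 where "\<sigma>4 = ex powers_com \<sigma>3"
  define \<sigma>5 where "\<sigma>5 = ex start_com \<sigma>4"
  define \<sigma>6 where "\<sigma>6 = ex loop_com \<sigma>5"
  note defs = \<sigma>1_def \<sigma>2_def \<sigma>3_def \<sigma>4_def \<sigma>5_def \<sigma>6_def
  have 1: "ok_com B init_com \<sigma>" "base \<sigma>1" "init_ok \<sigma>1"
    using init_com[OF assms(1)] by (simp_all add: defs)
  define c where "c = fst \<sigma>2 vc"
  define cix where "cix = snd \<sigma>2 aCix"
  have 2: "ok_com B cover_com \<sigma>1" "base \<sigma>2" "cover_inv m c cix"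
    using cover_com[OF 1(2,3)] by (simp_all add: defs c_def cix_def)
  have c: "num_states c \<le> B" "3 * c + 1 \<le> B"
  proof -
    show "num_states c \<le> B"
      using num_states_mono[OF cover_le[OF 2(3)]] assms(3) by simp
    have "c \<le> 2 * m" using 2(3) unfolding cover_inv_def by blast
    then show "3 * c + 1 \<le> B" using m_p_le(3) assms(2) by linarith
  qed
  have unw: "snd \<sigma>2 aGrp = snd \<sigma>1 aGrp" "snd \<sigma>2 aAct = snd \<sigma>1 aAct"
    by (simp_all add: \<sigma>2_def unwritten_array cover_com_def)
  have "\<forall>v\<in>V. snd \<sigma>2 aGrp v = v \<and> snd \<sigma>2 aAct v = 0"
    using 1(3) unfolding unw init_ok_def by blast
  from groups_com[OF 2(2) this]
  have 3: "ok_com B groups_com \<sigma>2" "base \<sigma>3" "groups_inv p (snd \<sigma>3 aGrp) (snd \<sigma>3 aAct)"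
    by (simp_all add: defs)
  define grp act where "grp = snd \<sigma>3 aGrp" and "act = snd \<sigma>3 aAct"
  have c3: "fst \<sigma>3 vc = c" "snd \<sigma>3 aCix = cix"
    by (simp_all add: c_def cix_def \<sigma>3_def unwritten_var unwritten_array groups_com_def merge_com_def)
  have 4: "ok_com B powers_com \<sigma>3" "ready c cix grp act \<sigma>4"
  proof -
    note p = powers_com[OF 3(2) c3(1) c(2)]
    then show "ok_com B powers_com \<sigma>3" by blast
    have "snd \<sigma>4 aCix = cix" "snd \<sigma>4 aGrp = grp" "snd \<sigma>4 aAct = act"
      using c3(2) by (simp_all add: \<sigma>4_def grp_def act_def unwritten_array powers_com_def)
    then show "ready c cix grp act \<sigma>4"
      using p unfolding ready_def \<sigma>4_def by blast
  qed
  define pos where "pos = snd \<sigma>1 aPos"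
  have pos5: "snd \<sigma>5 aPos = pos"
    by (simp add: pos_def defs unwritten_array cover_com_def groups_com_def merge_com_def powers_com_def
        start_com_def)
  have 5: "ok_com B start_com \<sigma>4" "ready c cix grp act \<sigma>5" "dp_spec c cix grp act [] (snd \<sigma>5 aDp)"
    using start_com[OF 4(2) c(1)] by (simp_all add: \<sigma>5_def)
  have 6: "ok_com B loop_com \<sigma>5" "ready c cix grp act \<sigma>6"
    "dp_spec c cix grp act (order pos grp L) (snd \<sigma>6 aDp)"
    using loop_com[OF 5(2) c(1) pos5 5(3)] by (simp_all add: \<sigma>6_def)
  note 7 = final_com[OF 6(2) c(1) 6(3)]
  have grp_V: "grp v \<in> V" if "v \<in> V" for v using 3(3) that unfolding groups_inv_def grp_def by blast
  have pos: "pos v < L \<and> xs ! pos v = v" if "v \<in> V" for v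
    using 1(3) that unfolding init_ok_def pos_def by blast
  \<comment> \<open>Every group label is itself an input word and thus is met by the outer scan, so
    no vertex is missed.\<close>
  have "set (order pos grp L) = V"
  proof (intro set_eqI iffI)
    fix v assume "v \<in> set (order pos grp L)"
    then have "pos v < L \<and> xs ! pos v = v" unfolding set_order by blast
    then show "v \<in> V" using nth_mem[of "pos v" xs] by simp
  next
    fix v assume "v \<in> V"
    then show "v \<in> set (order pos grp L)" unfolding set_order using pos grp_V by blast
  qed
  from covered_instance.decide_correct[OF 
      covered_instance[OF 2(3) 3(3)[folded grp_def act_def]] this distinct_order grouped_order]
  have "decide c cix (adjacent cix) (\<lambda>v. act v \<noteq> 0) grp (order pos grp L) k \<longleftrightarrow>
      (\<exists>F. steiner_forest edges demands F \<and> card F \<le> k)"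
    .
  with 7 have "fst (ex final_com \<sigma>6) vOut = of_bool (\<exists>F. steiner_forest edges demands F \<and> card F \<le> k)"
    by simp
  moreover have "ex main_com \<sigma> = ex final_com \<sigma>6"
    by (simp add: main_com_def defs)
  moreover have "ok_com B main_com \<sigma>"
    using 1(1) 2(1) 3(1) 4(1) 5(1) 6(1) 7 by (simp add: main_com_def defs)
  ultimately show ?thesis by simp
qed

end

subsection \<open>Decoding\<close>

lemma set_pairs:
  "length ys = q + q \<Longrightarrow> set (pairs ys) = {(ys ! (e + e), ys ! (e + e + 1)) | e. e < q}"
proof (induction q arbitrary: ys)
  case (Suc q)
  then obtain a b zs where ys: "ys = a # b # zs" "length zs = q + q"
    by (auto simp: length_Suc_conv)
  have "{(ys ! (e + e), ys ! (e + e + 1)) | e. e < Suc q} =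
      insert (a, b) {(zs ! (e + e), zs ! (e + e + 1)) | e. e < q}" (is "?l = insert _ ?r")
  proof (intro set_eqI iffI)
    fix x assume "x \<in> ?l"
    then obtain e where e: "e < Suc q" "x = (ys ! (e + e), ys ! (e + e + 1))" by blast
    then show "x \<in> insert (a, b) ?r" by (cases e) (auto simp: ys)
  next
    fix x assume "x \<in> insert (a, b) ?r"
    then consider "x = (a, b)" | e where "e < q" "x = (zs ! (e + e), zs ! (e + e + 1))" by blast
    then show "x \<in> ?l"
    proof cases
      case 1
      then have "x = (ys ! (0 + 0), ys ! (0 + 0 + 1))" by (simp add: ys)
      then show ?thesis by blast
    next
      case 2
      then have "x = (ys ! (Suc e + Suc e), ys ! (Suc e + Suc e + 1))" "Suc e < Suc q"
        by (simp_all add: ys)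
      then show ?thesis by blast
    qed
  qed
  then show ?case using Suc.IH[OF ys(2)] by (simp add: ys(1))
qed simp

text \<open>Justifies rejection by the length test alone: when the equation fails, the encoding is
  malformed.\<close>

lemma decode_length:
  assumes "decode xs \<noteq> None"
  shows "length xs = 2 * (xs ! 1) + 2 * (xs ! (2 + 2 * (xs ! 1))) + 4"
proof -
  obtain n m rest where xs: "xs = n # m # rest"
    using assms by (auto simp: decode_def split: list.splits)
  obtain p rest3 where rest: "drop (2 * m) rest = p # rest3" "length rest3 = 2 * p + 1"
    using assms by (auto simp: decode_def xs Let_def split: list.splits if_splits)
  have "length rest = 2 * m + (2 * p + 2)"
  proof -
    have "length (drop (2 * m) rest) = 2 * p + 2" by (simp add: rest)
    then show ?thesis by simp
  qed
  moreover have "rest ! (2 * m) = p"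
    using rest(1) calculation by (metis hd_drop_conv_nth le_add1 list.sel(1) less_add_same_cancel1 zero_less_Suc add_2_eq_Suc')
  ultimately show ?thesis by (simp add: xs)
qed

context word
begin

lemma decode_eq:
  "decode xs = (if (\<forall>e<m. u e < n \<and> w e < n \<and> u e \<noteq> w e) \<and> (\<forall>e<p. s e < n \<and> t e < n)
     then Some (n, edges, demands, k) else None)"
proof -
  define rest where "rest = drop 2 xs"
  define rest3 where "rest3 = drop (3 + 2 * m) xs"
  have "2 \<le> L" using len by simp
  then obtain a b zs where "xs = a # b # zs"
    by (cases xs; cases "tl xs") auto
  then have xs: "xs = n # m # rest" by (simp add: rest_def n m)
  have "2 + 2 * m < L" using len by simp
  moreover have "Suc (2 + 2 * m) = 3 + 2 * m" by simp
  ultimately have "drop (2 + 2 * m) xs = p # rest3"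
    using Cons_nth_drop_Suc[of "2 + 2 * m" xs] unfolding rest3_def p by metis
  then have rest2: "drop (2 * m) rest = p # rest3" by (simp add: rest_def add.commute)
  have lens: "\<not> length rest < 2 * m" "length rest3 = 2 * p + 1"
    using len by (simp_all add: rest_def rest3_def)
  have k': "last rest3 = k" using len by (simp add: rest3_def k)
  have at: "take (2 * q) (drop a xs) ! j = xs ! (a + j)" if "j < 2 * q" "a \<le> L" for a q j
    using that by (simp only: nth_take nth_drop)
  have es: "set (pairs (take (2 * m) rest)) = {(u e, w e) | e. e < m}"
  proof -
    have "take (2 * m) rest ! (e + e) = u e" "take (2 * m) rest ! (e + e + 1) = w e" if "e < m" for e
    proof -
      have "e + e < 2 * m" "e + e + 1 < 2 * m" "2 \<le> L" using that len by linarith+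
      moreover have "2 + (e + e + 1) = 3 + (e + e)" by simp
      ultimately show "take (2 * m) rest ! (e + e) = u e" "take (2 * m) rest ! (e + e + 1) = w e"
        unfolding rest_def u_def w_def using at by metis+
    qed
    then have "{(take (2 * m) rest ! (e + e), take (2 * m) rest ! (e + e + 1)) | e. e < m} =
        {(u e, w e) | e. e < m}"
      by (intro Collect_cong) metis
    moreover have "length (take (2 * m) rest) = m + m" using lens(1) by simp
    ultimately show ?thesis using set_pairs by simp
  qed
  have ts: "set (pairs (take (2 * p) rest3)) = demands"
  proof -
    have "take (2 * p) rest3 ! (e + e) = s e" "take (2 * p) rest3 ! (e + e + 1) = t e" if "e < p" for e
    proof -
      have "e + e < 2 * p" "e + e + 1 < 2 * p" "3 + 2 * m \<le> L" using that len by linarith+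
      moreover have "3 + 2 * m + (e + e) = 3 + ((m + m) + (e + e))"
        "3 + 2 * m + (e + e + 1) = 4 + ((m + m) + (e + e))" by simp_all
      ultimately show "take (2 * p) rest3 ! (e + e) = s e" "take (2 * p) rest3 ! (e + e + 1) = t e"
        unfolding rest3_def s_def t_def using at by metis+
    qed
    then have "{(take (2 * p) rest3 ! (e + e), take (2 * p) rest3 ! (e + e + 1)) | e. e < p} = demands"
      unfolding demands_def by (intro Collect_cong) metis
    moreover have "length (take (2 * p) rest3) = p + p" using lens(2) by simp
    ultimately show ?thesis using set_pairs by simp
  qed
  have E: "{{x, y} | x y. (x, y) \<in> {(u e, w e) | e. e < m}} = edges" unfolding edges_def by blast
  have c1: "(\<forall>(x, y) \<in> {(u e, w e) | e. e < m}. x < n \<and> y < n \<and> x \<noteq> y) \<longleftrightarrow>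
      (\<forall>e<m. u e < n \<and> w e < n \<and> u e \<noteq> w e)" by blast
  have c2: "(\<forall>(x, y) \<in> demands. x < n \<and> y < n) \<longleftrightarrow> (\<forall>e<p. s e < n \<and> t e < n)"
    unfolding demands_def by blast
  have "decode xs = decode (n # m # rest)" using xs by simp
  also have "\<dots> = (if (\<forall>e<m. u e < n \<and> w e < n \<and> u e \<noteq> w e) \<and> (\<forall>e<p. s e < n \<and> t e < n)
     then Some (n, edges, demands, k) else None)"
    unfolding decode_def list.case Let_def rest2 es ts E k' c1 c2 using lens by simp
  finally show ?thesis .
qed

lemma valid_exp:
  assumes "base \<sigma>"
  shows "ok_exp B valid_exp \<sigma>"
    and "holds valid_exp \<sigma> \<longleftrightarrow>
      (\<forall>e<m. u e < n \<and> w e < n \<and> u e \<noteq> w e) \<and> (\<forall>e<p. s e < n \<and> t e < n)"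
proof -
  have b: "base (set_var ve e \<sigma>)" for e using assms by simp
  have ev: "e < m \<Longrightarrow> ev UE (set_var ve e \<sigma>) = u e" "e < m \<Longrightarrow> ev WE (set_var ve e \<sigma>) = w e"
    "e < p \<Longrightarrow> ev SE (set_var ve e \<sigma>) = s e" "e < p \<Longrightarrow> ev TE (set_var ve e \<sigma>) = t e" for e
    using ev_input(2-5)[OF b] by simp_all
  show "ok_exp B valid_exp \<sigma>"
    using m_p_le base_vars[OF assms] by (simp add: valid_exp_def)
  show "holds valid_exp \<sigma> \<longleftrightarrow>
      (\<forall>e<m. u e < n \<and> w e < n \<and> u e \<noteq> w e) \<and> (\<forall>e<p. s e < n \<and> t e < n)"
    using base_vars(2-4)[OF assms] by (simp add: valid_exp_def ev)
qed

end

lemma program: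
  assumes input: "input_store xs \<sigma>" and "xs \<noteq> []"
    and bound: "3 * length xs + 1 \<le> B" "num_states (2 * vc_param xs) \<le> B"
  shows "ok_com B program \<sigma> \<and> fst (ex program \<sigma>) 0 = (if xs \<in> SF_lang then 1 else 0)"
proof -
  let ?L = "length xs"
  define m where "m = snd \<sigma> aX 1"
  define p where "p = snd \<sigma> aX (2 + (m + m))"
  have mm: "m + m = 2 * m" by simp
  have X: "snd \<sigma> aX j = xs ! j" if "j < ?L" for j using input that by (simp add: input_store_def)
  have L: "fst \<sigma> vL = ?L" using input by (simp add: input_store_def)
  define \<sigma>1 where "\<sigma>1 = ex read_com \<sigma>"
  have \<sigma>1: "fst \<sigma>1 vL = ?L" "fst \<sigma>1 vn = snd \<sigma> aX 0" "fst \<sigma>1 vm = m" "fst \<sigma>1 vp = p"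
    "fst \<sigma>1 vk = snd \<sigma> aX (?L - 1)" "snd \<sigma>1 = snd \<sigma>"
    using L by (simp_all add: \<sigma>1_def read_com_def m_def p_def)
  have ok1: "ok_com B read_com \<sigma>" by (simp add: read_com_def)
  let ?eq = "EqE (Var vL) (Plus (Num 4) (Plus (Plus (Var vm) (Var vm)) (Plus (Var vp) (Var vp))))"
  have heq: "holds ?eq \<sigma>1 \<longleftrightarrow> ?L = 4 + ((m + m) + (p + p))" using \<sigma>1 by simp
  have ex: "ex program \<sigma> = (if ?L = 4 + ((m + m) + (p + p)) then ex (Cond valid_exp main_com (Assign vOut (Num 0))) \<sigma>1
      else set_var vOut 0 \<sigma>1)"
    and okp: "ok_com B program \<sigma> \<longleftrightarrow> (?L = 4 + ((m + m) + (p + p)) \<longrightarrow>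
      ok_com B (Cond valid_exp main_com (Assign vOut (Num 0))) \<sigma>1)"
    unfolding program_def ex.simps(4) ok_com.simps(4) \<sigma>1_def[symmetric] ex_Cond[of ?eq] ok_com_Cond[of _ ?eq] heq
    using ok1 by simp_all
  have lang: "xs \<in> SF_lang \<longleftrightarrow> (\<exists>n E S k. decode xs = Some (n, E, S, k) \<and>
      (\<exists>F. steiner_forest E S F \<and> card F \<le> k))" by (simp add: SF_lang_def)
  show ?thesis
  proof (cases "?L = 4 + ((m + m) + (p + p))")
    case False
    have "decode xs = None"
    proof (rule ccontr)
      assume "decode xs \<noteq> None"
      \<comment> \<open>Beyond the input the array is arbitrary, so the values read can be
        identified with input words only once this equation places them inside.\<close>
      note l = decode_length[OF this]
      then have m: "m = xs ! 1" unfolding m_def by (intro X) linarith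
      have p: "p = xs ! (2 + 2 * m)"
        unfolding p_def mm by (rule X) (use l m in linarith)
      show False using l False unfolding m[symmetric] p[symmetric] by linarith
    qed
    then show ?thesis using ex okp False lang by simp
  next
    case True
    have m: "m = xs ! 1" unfolding m_def by (rule X) (use True in simp)
    have p: "p = xs ! (2 + 2 * m)" unfolding p_def mm by (rule X) (use True in linarith)
    interpret word xs "xs ! 0" m p "last xs" B
      by unfold_locales (use True m p bound in simp_all)
    have "last xs = snd \<sigma> aX (?L - 1)" using X[of "?L - 1"] assms(2) by (simp add: last_conv_nth)
    moreover have "snd \<sigma> aX 0 = xs ! 0" by (rule X) (use True in simp)
    ultimately have b: "base \<sigma>1" unfolding base_def using \<sigma>1 X by simp
    note v = valid_exp[OF b]
    show ?thesis
    proof (cases "(\<forall>e<m. u e < xs ! 0 \<and> w e < xs ! 0 \<and> u e \<noteq> w e) \<and> (\<forall>e<p. s e < xs ! 0 \<and> t e < xs ! 0)")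
      case False
      then have "decode xs = None" unfolding decode_eq by (rule if_not_P)
      moreover have "\<not> holds valid_exp \<sigma>1" using v(2) False by blast
      ultimately show ?thesis using ex okp lang v(1) True by simp
    next
      case valid: True
      then have dec: "decode xs = Some (xs ! 0, edges, demands, last xs)"
        unfolding decode_eq by (rule if_P)
      then have vc: "vc_param xs = vc_number (xs ! 0) edges" by (simp add: vc_param_def)
      interpret valid_word xs "xs ! 0" m p "last xs" B
        by unfold_locales (use valid in blast)+
      have "ok_com B main_com \<sigma>1 \<and> fst (ex main_com \<sigma>1) vOut =
          of_bool (\<exists>F. steiner_forest edges demands F \<and> card F \<le> last xs)"
        by (rule main_com[OF b]) (use bound vc in simp_all)
      moreover have "holds valid_exp \<sigma>1" using v(2) valid by blast
      moreover have "xs \<in> SF_lang \<longleftrightarrow> (\<exists>F. steiner_forest edges demands F \<and> card F \<le> last xs)"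
        unfolding lang dec by auto
      ultimately show ?thesis using ex okp v(1) True by simp
    qed
  qed
qed

text \<open>Multiplying 1 by \<open>2 * x + 1\<close> in \<open>6 * x + 1 = 3 * (2 * x) + 1\<close>
  rounds gives \<open>num_states (2 * x)\<close>. The rest multiplies \<open>D\<close> by
  \<open>4 + num_states (2 * x)\<close> in \<open>d\<close> rounds.\<close>

definition bound_com :: "nat \<Rightarrow> nat \<Rightarrow> com" where
  "bound_com D d = Seq (Assign 2 (Num 1))
     (Seq (For 3 (Plus (Sum 4 (Num 6) (Var 1)) (Num 1))
        (Assign 2 (Sum 4 (Plus (Plus (Var 1) (Var 1)) (Num 1)) (Var 2))))
     (Seq (Assign 0 (Num D))
        (For 3 (Num d) (Assign 0 (Sum 4 (Plus (Num 4) (Var 2)) (Var 0))))))"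

lemma computable_bound: "computable (\<lambda>x. D * (4 + num_states (2 * x)) ^ d)"
proof (rule computable_intro)
  show "fits_com (bound_com D d) 64" by (simp add: bound_com_def)
  fix x and s :: store assume x: "fst s 1 = x"
  define N where "N = num_states (2 * x)"
  \<comment> \<open>Large enough for all loop lengths that occur: 6, \<open>2 * x + 1\<close>,
    \<open>6 * x + 1\<close>, \<open>4 + N\<close> and \<open>d\<close>.\<close>
  define B where "B = 6 * x + 7 + N + d"
  define I where "I i s \<longleftrightarrow> fst s 1 = x \<and> fst s 2 = (2 * x + 1) ^ i" for i and s :: store
  let ?c1 = "Assign 2 (Sum 4 (Plus (Plus (Var 1) (Var 1)) (Num 1)) (Var 2))"
  let ?f1 = "For 3 (Plus (Sum 4 (Num 6) (Var 1)) (Num 1)) ?c1"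
  have 1: "ok_com B ?f1 (set_var 2 1 s) \<and> I (6 * x + 1) (ex ?f1 (set_var 2 1 s))"
    by (rule For_rule) (use x in \<open>simp_all add: I_def B_def algebra_simps\<close>)
  define s1 where "s1 = set_var 0 D (ex ?f1 (set_var 2 1 s))"
  have s1: "fst s1 2 = N" "fst s1 0 = D"
  proof -
    have "3 * (2 * x) + 1 = 6 * x + 1" by simp
    then show "fst s1 2 = N" using 1 by (simp add: s1_def I_def N_def num_states_def)
  qed (simp add: s1_def)
  define J where "J i s \<longleftrightarrow> fst s 2 = N \<and> fst s 0 = D * (4 + N) ^ i" for i and s :: store
  let ?c2 = "Assign 0 (Sum 4 (Plus (Num 4) (Var 2)) (Var 0))"
  have 2: "ok_com B (For 3 (Num d) ?c2) s1 \<and> J d (ex (For 3 (Num d) ?c2) s1)"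
    by (rule For_rule) (use s1 in \<open>simp_all add: J_def B_def algebra_simps\<close>)
  have "ok_com B (bound_com D d) s" using 1 2 by (simp add: bound_com_def s1_def)
  moreover have "ex (bound_com D d) s = ex (For 3 (Num d) ?c2) s1" by (simp add: bound_com_def s1_def)
  ultimately show "(\<exists>B. ok_com B (bound_com D d) s) \<and>
      fst (ex (bound_com D d) s) 0 = D * (4 + num_states (2 * x)) ^ d"
    using 2 by (auto simp: J_def N_def)
qed

theorem theorem5:
  shows "FPT SF_lang vc_param"
proof -
  obtain A d where time: "\<And>B. time_com B program \<le> A * Suc B ^ d"
    using time_com_poly[of program] by blast
  \<comment> \<open>81 pays for the boot code, and the 4 makes room for the linear part of the loop
    bound in \<open>Suc (B xs) \<le> N * l\<close>.\<close>
  define f where "f x = (A + 81) * (4 + num_states (2 * x)) ^ d" for x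
  define B where "B xs = 3 * length xs + 1 + num_states (2 * vc_param xs)" for xs
  define T where "T xs = f (vc_param xs) * Suc (enc_size xs) ^ Suc d" for xs
  have "computable f" unfolding f_def by (rule computable_bound)
  moreover have "\<exists>P. decides_in_time P SF_lang T"
  proof (rule decides_intro[OF fits_program])
    show "[] \<notin> SF_lang" by (simp add: SF_lang_def decode_def)
    show "ok_com (B xs) program \<sigma> \<and> fst (ex program \<sigma>) 0 = (if xs \<in> SF_lang then 1 else 0)"
      if "xs \<noteq> []" "input_store xs \<sigma>" for xs \<sigma>
      by (rule program[OF that(2,1)]) (simp_all add: B_def)
    show "81 + 23 * length xs + time_com (B xs) program \<le> T xs" for xs
    proof -
      \<comment> \<open>Everything is compared with \<open>N ^ d * l ^ d\<close>. One further factor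
        \<open>l\<close> absorbs the linear time of the boot code, hence the exponent
        \<open>Suc d\<close>.\<close>
      define l N where "l = Suc (length xs)" and "N = 4 + num_states (2 * vc_param xs)"
      have pos: "1 \<le> N ^ d * l ^ d" by (simp add: N_def l_def)
      have "3 * length xs \<le> N * length xs" by (rule mult_le_mono1) (simp add: N_def)
      moreover have "N * l = N * length xs + N" by (simp add: l_def)
      moreover have "Suc (B xs) = 3 * length xs + N - 2" "N \<ge> 4" by (simp_all add: B_def N_def)
      ultimately have "Suc (B xs) \<le> N * l" by linarith
      then have "Suc (B xs) ^ d \<le> N ^ d * l ^ d"
        unfolding power_mult_distrib[symmetric] by (rule power_mono) simp
      then have "time_com (B xs) program \<le> A * (N ^ d * l ^ d)"
        using time[of "B xs"] by (meson le_trans mult_le_mono2)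
      also have "\<dots> \<le> A * (N ^ d * l ^ d) * l" by (simp add: l_def)
      finally have 1: "time_com (B xs) program \<le> A * (N ^ d * l ^ d) * l" .
      have "81 + 23 * length xs \<le> 81 * 1 * l" by (simp add: l_def)
      also have "\<dots> \<le> 81 * (N ^ d * l ^ d) * l" using pos by (intro mult_le_mono) simp_all
      finally have "81 + 23 * length xs + time_com (B xs) program \<le> (A + 81) * N ^ d * l ^ Suc d"
        using 1 by (simp add: algebra_simps)
      also have "\<dots> \<le> T xs"
        unfolding T_def f_def N_def
        by (intro mult_le_mono power_mono order.refl) (simp_all add: l_def enc_size_def)
      finally show ?thesis .
    qed
    show "T xs \<ge> 1" for xs
    proof -
      have "0 < T xs" unfolding T_def f_def by (intro mult_pos_pos zero_less_power) simp_all
      then show ?thesis by linarith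
    qed
  qed
  ultimately show ?thesis unfolding FPT_def T_def by blast
qed

end
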